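(* Let $\phi$ be an Orlicz function such that $\phi(t)=o(t^2)$ as $t\to0$. There exists a function $f=\sum_i a_iz^i$ in $\ell_a^{\phi}$ that satisfies the following two properties: (1) Let $(r_n)_n$ be a sequence of real numbers in $(0,1)$ that converges to $1$. Given any measurable function $\varphi$ on $\partial\mathbb{D}$, there exists an increasing sequence $(n_l)_l$ such that, for any $w\in\mathbb{D}$ and a.e. $\zeta\in\partial\mathbb{D}$, $$f\big(r_{n_l}(\zeta-w)+w\big)\to\varphi(\zeta)\quad\text{as }l\to\infty;$$ (2) Given any measurable function $\varphi$ on $\partial\mathbb{D}$, there exists an increasing sequence $(d_n)_n$ such that, for a.e. $\zeta\in\partial\mathbb{D}$, $$\sum_{i=0}^{d_n}a_i\zeta^i\to\varphi(\zeta)\quad\text{as }n\to\infty.$$ If we assume that $\phi$ satisfies the $\Delta_2$ condition, then the set of such functions is dense and $G_\delta$ in $\ell_a^{\phi}$.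
   Context: $\mathbb{D}=\{z\in\mathbb{C}:|z|<1\}$ is the unit disc and $\partial\mathbb{D}$ is the unit circle; "a.e." and "measurable" refer to Lebesgue measure on $\partial\mathbb{D}$. The sequences $(n_l)_l$ and $(d_n)_n$ are sequences of integers. An Orlicz function is an increasing convex function $\phi:\mathbb{R}_+\to\mathbb{R}_+$ with $\phi(0)=0$. It satisfies the $\Delta_2$ condition if there exist constants $K>0$ and $t_0\in(0,1)$ such that $\phi(2t)\le K\phi(t)$ for all $t\in(0,t_0)$. For $f$ analytic in $\mathbb{D}$, $\hat f(k)$ denotes its $k$-th Fourier (i.e. Taylor) coefficient, so $f(z)=\sum_{k\ge0}\hat f(k)z^k$. The Orlicz space $\ell_a^{\phi}$ consists of all functions $f$ analytic in $\mathbb{D}$ such that $\sum_k\phi(|\hat f(k)|/\lambda)<+\infty$ for some $\lambda>0$; it is a Banach space when endowed with the Luxemburg norm $$\|f\|_{\ell^{\phi}}:=\inf\Big\{\lambda>0:\ \sum_k\phi\Big(\frac{|\hat f(k)|}{\lambda}\Big)\le1\Big\},$$ and topological notions in $\ell_a^{\phi}$ refer to this norm.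
   Formalization: The sequence (r_n) is fixed before f, since no f can satisfy (1) for all (r_n); and "is dense and G_δ" becomes "is dense and contains a dense G_δ set", since one (n_l) serving all w makes the set itself fail to be G_δ in general. *)

theory Defs
  imports
    "HOL-Complex_Analysis.Complex_Analysis"
    "HOL-Library.Landau_Symbols"
begin

(* Functions on the half line [0,infinity) are total functions real => real of which only the
   values on {0..} matter.  "Increasing" is read strictly: for phi = 0 the Luxemburg functional
   would vanish identically and not be a norm. *)
definition orlicz_function :: "(real \<Rightarrow> real) \<Rightarrow> bool" where
  "orlicz_function \<phi> \<longleftrightarrow>
     \<phi> \<in> {0..} \<rightarrow> {0..} \<and> strict_mono_on {0..} \<phi> \<and> convex_on {0..} \<phi> \<and> \<phi> 0 = 0"

definition Delta2 :: "(real \<Rightarrow> real) \<Rightarrow> bool" where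
  "Delta2 \<phi> \<longleftrightarrow> (\<exists>K>0. \<exists>t0\<in>{0<..<1}. \<forall>t\<in>{0<..<t0}. \<phi> (2 * t) \<le> K * \<phi> t)"

definition taylor_coeff :: "(complex \<Rightarrow> complex) \<Rightarrow> nat \<Rightarrow> complex" where
  "taylor_coeff f k = fps_nth (fps_expansion f 0) k"

(* A function on the open unit disc is represented by its extension by 0 to the whole plane, so
   that equality of functions on the disc is equality in HOL. *)
definition ell_a :: "(real \<Rightarrow> real) \<Rightarrow> (complex \<Rightarrow> complex) set" where
  "ell_a \<phi> = {f. f analytic_on ball 0 1 \<and> (\<forall>z. z \<notin> ball 0 1 \<longrightarrow> f z = 0) \<and>
                 (\<exists>c>0. summable (\<lambda>k. \<phi> (norm (taylor_coeff f k) / c)))}"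

definition luxemburg_norm :: "(real \<Rightarrow> real) \<Rightarrow> (complex \<Rightarrow> complex) \<Rightarrow> real" where
  "luxemburg_norm \<phi> f =
     Inf {c. 0 < c \<and> summable (\<lambda>k. \<phi> (norm (taylor_coeff f k) / c)) \<and>
             (\<Sum>k. \<phi> (norm (taylor_coeff f k) / c)) \<le> 1}"

(* The locale Metric_space asks for symmetry and nonnegativity on the whole type, hence the
   default value 0 outside ell_a. *)
definition luxemburg_dist ::
  "(real \<Rightarrow> real) \<Rightarrow> (complex \<Rightarrow> complex) \<Rightarrow> (complex \<Rightarrow> complex) \<Rightarrow> real" where
  "luxemburg_dist \<phi> f g =
     (if f \<in> ell_a \<phi> \<and> g \<in> ell_a \<phi> then luxemburg_norm \<phi> (\<lambda>z. f z - g z) else 0)"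

(* Metric_space_ell_a below shows that this is a genuine metric topology. *)
definition ell_a_topology :: "(real \<Rightarrow> real) \<Rightarrow> (complex \<Rightarrow> complex) topology" where
  "ell_a_topology \<phi> = Metric_space.mtopology (ell_a \<phi>) (luxemburg_dist \<phi>)"

(* The completion makes all Lebesgue measurable (not only Borel) sets of the circle available. *)
definition circle_measure :: "complex measure" where
  "circle_measure =
     completion (distr (restrict_space lborel {0..<2 * pi}) (restrict_space borel (sphere 0 1)) cis)"

(* The sequence r is a parameter, fixed before f: no f can have this property for all r
   simultaneously.  (If f (r (n l) * zeta) tends to 0 a.e., then for the sequence r o n no
   subsequence can yield the limit function 1.)
   A single n serves all w; the exceptional null set may depend on w. *)
definition universal_radial :: "(nat \<Rightarrow> real) \<Rightarrow> (complex \<Rightarrow> complex) \<Rightarrow> bool" where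
  "universal_radial r f \<longleftrightarrow>
     (\<forall>\<psi> \<in> borel_measurable circle_measure. \<exists>n :: nat \<Rightarrow> nat. strict_mono n \<and>
        (\<forall>w \<in> ball 0 1. AE \<zeta> in circle_measure.
           (\<lambda>l. f (of_real (r (n l)) * (\<zeta> - w) + w)) \<longlonglongrightarrow> (\<psi> \<zeta> :: complex)))"

definition universal_partial_sums :: "(complex \<Rightarrow> complex) \<Rightarrow> bool" where
  "universal_partial_sums f \<longleftrightarrow>
     (\<forall>\<psi> \<in> borel_measurable circle_measure. \<exists>d :: nat \<Rightarrow> nat. strict_mono d \<and>
        (AE \<zeta> in circle_measure.
           (\<lambda>n. \<Sum>i = 0..d n. taylor_coeff f i * \<zeta> ^ i) \<longlonglongrightarrow> (\<psi> \<zeta> :: complex)))"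

(* Because one n has to serve uncountably many w, with convergence only pointwise in w, this set
   need not itself be a G_delta; the f for which the convergence is locally uniform in w form a
   G_delta contained in it, which is dense under Delta2. *)
definition universal_functions ::
  "(real \<Rightarrow> real) \<Rightarrow> (nat \<Rightarrow> real) \<Rightarrow> (complex \<Rightarrow> complex) set" where
  "universal_functions \<phi> r = {f \<in> ell_a \<phi>. universal_radial r f \<and> universal_partial_sums f}"


lemma space_circle_measure: "space circle_measure = sphere 0 1"
  by (simp add: circle_measure_def space_restrict_space)

lemma emeasure_circle_measure: "emeasure circle_measure (sphere 0 1) = ennreal (2 * pi)"
proof -
  have [measurable]: "cis \<in> borel_measurable borel"
    by (intro borel_measurable_continuous_onI continuous_intros)
  have m: "cis \<in> restrict_space lborel {0..<2 * pi} \<rightarrow>\<^sub>M restrict_space borel (sphere 0 1)"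
    by (intro measurable_restrict_space3) auto
  have "sphere 0 1 \<in> sets (restrict_space borel (sphere (0::complex) 1))"
    using sets.top[of "restrict_space borel (sphere (0::complex) 1)"]
    by (simp add: space_restrict_space)
  then show ?thesis
    unfolding circle_measure_def
    by (simp add: emeasure_distr[OF m] space_restrict_space emeasure_restrict_space vimage_def)
qed

lemma universal_radialD:
  assumes "universal_radial r f"
  obtains n :: "nat \<Rightarrow> nat" where "strict_mono n"
    "AE \<zeta> in circle_measure. (\<lambda>l. f (of_real (r (n l)) * \<zeta>)) \<longlonglongrightarrow> c"
proof -
  have "(\<lambda>_. c) \<in> borel_measurable circle_measure" by simp
  with assms obtain n :: "nat \<Rightarrow> nat" where n: "strict_mono n"
    "\<forall>w \<in> ball 0 1. AE \<zeta> in circle_measure.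
       (\<lambda>l. f (of_real (r (n l)) * (\<zeta> - w) + w)) \<longlonglongrightarrow> c"
    unfolding universal_radial_def by meson
  from n(2)[rule_format, of 0] show ?thesis by (intro that[OF n(1)]) simp
qed

lemma not_universal_radial_for_all:
  fixes r :: "nat \<Rightarrow> real"
  assumes r: "\<And>n. r n \<in> {0<..<1}" "r \<longlonglongrightarrow> 1"
  shows "\<not> (\<forall>r. (\<forall>n. r n \<in> {0<..<1}) \<and> r \<longlonglongrightarrow> 1 \<longrightarrow> universal_radial r f)"
proof
  assume U: "\<forall>r. (\<forall>n. r n \<in> {0<..<1}) \<and> r \<longlonglongrightarrow> 1 \<longrightarrow> universal_radial r f"
  have "universal_radial r f" using U r by blast
  then obtain n :: "nat \<Rightarrow> nat" where n: "strict_mono n" and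
    n0: "AE \<zeta> in circle_measure. (\<lambda>l. f (of_real (r (n l)) * \<zeta>)) \<longlonglongrightarrow> 0"
    by (rule universal_radialD)
  have "\<forall>k. (r \<circ> n) k \<in> {0<..<1}" using r(1) by simp
  moreover have "(r \<circ> n) \<longlonglongrightarrow> 1" by (rule LIMSEQ_subseq_LIMSEQ[OF r(2) n])
  ultimately have "universal_radial (r \<circ> n) f" using U by blast
  then obtain m :: "nat \<Rightarrow> nat" where m: "strict_mono m" and
    m1: "AE \<zeta> in circle_measure. (\<lambda>l. f (of_real ((r \<circ> n) (m l)) * \<zeta>)) \<longlonglongrightarrow> 1"
    by (rule universal_radialD)
  have "AE \<zeta> in circle_measure. False"
    using n0 m1
  proof eventually_elim
    case (elim \<zeta>)
    from LIMSEQ_subseq_LIMSEQ[OF elim(1) m]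
    have "(\<lambda>l. f (of_real ((r \<circ> n) (m l)) * \<zeta>)) \<longlonglongrightarrow> 0" by (simp add: o_def)
    from LIMSEQ_unique[OF this elim(2)] show ?case by simp
  qed
  then have "emeasure circle_measure (space circle_measure) = 0"
    using AE_iff_measurable[OF sets.top, of circle_measure "\<lambda>_. False"] by simp
  then show False by (simp add: space_circle_measure emeasure_circle_measure)
qed

lemma taylor_coeff_diff:
  assumes "f analytic_on ball 0 1" "g analytic_on ball 0 1"
  shows "taylor_coeff (\<lambda>z. f z - g z) k = taylor_coeff f k - taylor_coeff g k"
proof -
  have "f holomorphic_on ball 0 1" "g holomorphic_on ball 0 1"
    using assms analytic_imp_holomorphic by auto
  then show ?thesis
    unfolding taylor_coeff_def fps_expansion_def
    using higher_deriv_diff[of f "ball 0 1" g 0 k] by (simp add: diff_divide_distrib)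
qed

context
  fixes \<phi> :: "real \<Rightarrow> real"
  assumes orl: "orlicz_function \<phi>"
begin

private lemma nonneg: "0 \<le> x \<Longrightarrow> 0 \<le> \<phi> x"
  using orl by (auto simp: orlicz_function_def)

private lemma pos: "0 < x \<Longrightarrow> 0 < \<phi> x"
  using orl strict_mono_onD[of "{0..}" \<phi> 0 x] by (auto simp: orlicz_function_def)

private lemma mono: "0 \<le> x \<Longrightarrow> x \<le> y \<Longrightarrow> \<phi> x \<le> \<phi> y"
  using orl strict_mono_onD[of "{0..}" \<phi> x y] by (cases "x = y") (auto simp: orlicz_function_def)

private lemma cvx:
  "0 \<le> x \<Longrightarrow> 0 \<le> y \<Longrightarrow> 0 \<le> s \<Longrightarrow> s \<le> 1 \<Longrightarrow> \<phi> ((1 - s) * x + s * y) \<le> (1 - s) * \<phi> x + s * \<phi> y"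
  using orl convex_onD[of "{0..}" \<phi> s x y] by (auto simp: orlicz_function_def)

private lemma scale: "0 \<le> x \<Longrightarrow> 0 \<le> s \<Longrightarrow> s \<le> 1 \<Longrightarrow> \<phi> (s * x) \<le> s * \<phi> x"
  using cvx[of 0 x s] orl by (auto simp: orlicz_function_def)

private definition adm :: "(complex \<Rightarrow> complex) \<Rightarrow> real set" where
  "adm f = {c. 0 < c \<and> summable (\<lambda>k. \<phi> (norm (taylor_coeff f k) / c)) \<and>
             (\<Sum>k. \<phi> (norm (taylor_coeff f k) / c)) \<le> 1}"

private lemma lux: "luxemburg_norm \<phi> f = Inf (adm f)"
  by (simp add: luxemburg_norm_def adm_def)

private lemma bdd: "bdd_below (adm f)"
  by (rule bdd_belowI[of _ 0]) (auto simp: adm_def)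

private lemma adm_ne: assumes "f \<in> ell_a \<phi>" shows "adm f \<noteq> {}"
proof -
  obtain l where l: "l > 0" "summable (\<lambda>k. \<phi> (norm (taylor_coeff f k) / l))"
    using assms by (auto simp: ell_a_def)
  define S where "S = (\<Sum>k. \<phi> (norm (taylor_coeff f k) / l))"
  define M where "M = max 1 S"
  have M: "M \<ge> 1" "M \<ge> S" by (auto simp: M_def)
  have le: "\<phi> (norm (taylor_coeff f k) / (l * M)) \<le> (1 / M) * \<phi> (norm (taylor_coeff f k) / l)" for k
    using scale[of "norm (taylor_coeff f k) / l" "1 / M"] l M by (simp add: field_simps)
  have s: "summable (\<lambda>k. (1 / M) * \<phi> (norm (taylor_coeff f k) / l))"
    by (intro summable_mult l)
  have s': "summable (\<lambda>k. \<phi> (norm (taylor_coeff f k) / (l * M)))"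
    by (rule summable_comparison_test'[OF s, of 0]) (use le l M nonneg in auto)
  have "(\<Sum>k. \<phi> (norm (taylor_coeff f k) / (l * M))) \<le> (1 / M) * S"
    unfolding S_def by (subst suminf_mult[symmetric, OF l(2)]) (intro suminf_le le s s')
  also have "\<dots> \<le> 1" using M by (simp add: field_simps)
  finally have "l * M \<in> adm f" using s' l M by (auto simp: adm_def)
  then show ?thesis by auto
qed

private lemma adm_diff:
  assumes f: "f \<in> ell_a \<phi>" and g: "g \<in> ell_a \<phi>" and a: "a \<in> adm f" and b: "b \<in> adm g"
  shows "a + b \<in> adm (\<lambda>z. f z - g z)"
proof -
  let ?F = "\<lambda>k. norm (taylor_coeff f k)" and ?G = "\<lambda>k. norm (taylor_coeff g k)"
  let ?D = "\<lambda>k. norm (taylor_coeff (\<lambda>z. f z - g z) k)"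
  have ab: "a > 0" "b > 0" using a b by (auto simp: adm_def)
  define s where "s = b / (a + b)"
  have s: "0 \<le> s" "s \<le> 1" "1 - s = a / (a + b)" using ab by (auto simp: s_def field_simps)
  have D: "?D k \<le> ?F k + ?G k" for k
    using f g by (simp add: ell_a_def taylor_coeff_diff norm_triangle_ineq4)
  have le: "\<phi> (?D k / (a + b)) \<le> (1 - s) * \<phi> (?F k / a) + s * \<phi> (?G k / b)" for k
  proof -
    have "?D k / (a + b) \<le> (?F k + ?G k) / (a + b)"
      using D ab by (intro divide_right_mono) auto
    also have "\<dots> = (1 - s) * (?F k / a) + s * (?G k / b)"
      unfolding s(3) using ab by (simp add: s_def add_divide_distrib)
    finally have "\<phi> (?D k / (a + b)) \<le> \<phi> ((1 - s) * (?F k / a) + s * (?G k / b))"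
      using ab by (intro mono) auto
    also have "\<dots> \<le> (1 - s) * \<phi> (?F k / a) + s * \<phi> (?G k / b)"
      using s ab by (intro cvx) auto
    finally show ?thesis .
  qed
  have sF: "summable (\<lambda>k. \<phi> (?F k / a))" "(\<Sum>k. \<phi> (?F k / a)) \<le> 1" using a by (auto simp: adm_def)
  have sG: "summable (\<lambda>k. \<phi> (?G k / b))" "(\<Sum>k. \<phi> (?G k / b)) \<le> 1" using b by (auto simp: adm_def)
  have sR: "summable (\<lambda>k. (1 - s) * \<phi> (?F k / a) + s * \<phi> (?G k / b))"
    by (intro summable_add summable_mult sF sG)
  have sD: "summable (\<lambda>k. \<phi> (?D k / (a + b)))"
    by (rule summable_comparison_test'[OF sR, of 0]) (use le ab nonneg in auto)
  have "(\<Sum>k. \<phi> (?D k / (a + b))) \<le> (\<Sum>k. (1 - s) * \<phi> (?F k / a) + s * \<phi> (?G k / b))"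
    by (intro suminf_le le sD sR)
  also have "\<dots> = (1 - s) * (\<Sum>k. \<phi> (?F k / a)) + s * (\<Sum>k. \<phi> (?G k / b))"
    using sF(1) sG(1) by (simp add: suminf_add[symmetric] suminf_mult summable_mult)
  also have "\<dots> \<le> (1 - s) * 1 + s * 1"
    using s(1,2) sF(2) sG(2) by (intro add_mono mult_left_mono) auto
  finally show ?thesis using ab sD by (auto simp: adm_def)
qed

lemma ell_a_diff:
  assumes f: "f \<in> ell_a \<phi>" and g: "g \<in> ell_a \<phi>"
  shows "(\<lambda>z. f z - g z) \<in> ell_a \<phi>"
proof -
  obtain a b where "a \<in> adm f" "b \<in> adm g" using adm_ne f g by blast
  from adm_diff[OF f g this] show ?thesis
    using f g by (auto simp: ell_a_def adm_def intro!: analytic_on_diff)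
qed

private lemma lux_triangle:
  assumes f: "f \<in> ell_a \<phi>" and g: "g \<in> ell_a \<phi>"
  shows "luxemburg_norm \<phi> (\<lambda>z. f z - g z) \<le> luxemburg_norm \<phi> f + luxemburg_norm \<phi> g"
proof -
  let ?N = "Inf (adm (\<lambda>z. f z - g z))"
  have 1: "?N - b \<le> Inf (adm f)" if b: "b \<in> adm g" for b
    by (rule cInf_greatest[OF adm_ne[OF f]])
       (use cInf_lower[OF adm_diff[OF f g _ b] bdd] in \<open>simp add: algebra_simps\<close>)
  have "?N - Inf (adm f) \<le> Inf (adm g)"
    by (rule cInf_greatest[OF adm_ne[OF g]]) (use 1 in \<open>simp add: algebra_simps\<close>)
  then show ?thesis by (simp add: lux)
qed

private lemma lux_nonneg: "f \<in> ell_a \<phi> \<Longrightarrow> 0 \<le> luxemburg_norm \<phi> f"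
  unfolding lux by (rule cInf_greatest[OF adm_ne]) (auto simp: adm_def)

private lemma lux_eq_0:
  assumes f: "f \<in> ell_a \<phi>" and 0: "luxemburg_norm \<phi> f = 0"
  shows "f = (\<lambda>z. 0)"
proof -
  have c0: "taylor_coeff f k = 0" for k
  proof (rule ccontr)
    assume nz: "taylor_coeff f k \<noteq> 0"
    let ?c = "norm (taylor_coeff f k)"
    have p: "\<phi> ?c > 0" using nz pos by simp
    have "Inf (adm f) < min 1 (\<phi> ?c)" using 0 p by (simp add: lux)
    then obtain l where l: "l \<in> adm f" "l < 1" "l < \<phi> ?c"
      using cInf_lessD[OF adm_ne[OF f]] by fastforce
    have l0: "l > 0" and sl: "summable (\<lambda>k. \<phi> (norm (taylor_coeff f k) / l))"
      "(\<Sum>k. \<phi> (norm (taylor_coeff f k) / l)) \<le> 1" using l by (auto simp: adm_def)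
    have "\<phi> (?c / l) \<le> (\<Sum>k. \<phi> (norm (taylor_coeff f k) / l))"
      using sum_le_suminf[OF sl(1), of "{k}"] nonneg l0 by auto
    then have "\<phi> (?c / l) \<le> 1" using sl by linarith
    moreover have "\<phi> ?c \<le> l * \<phi> (?c / l)" using scale[of "?c / l" l] l0 l by simp
    ultimately show False using l l0 by (smt (verit) mult_left_le)
  qed
  have h: "f holomorphic_on ball 0 1" and z: "\<And>z. z \<notin> ball 0 1 \<Longrightarrow> f z = 0"
    using f analytic_imp_holomorphic by (auto simp: ell_a_def)
  have "(deriv ^^ n) f 0 = 0" for n
    using c0[of n] by (simp add: taylor_coeff_def fps_expansion_def)
  then show ?thesis using holomorphic_fun_eq_0_on_ball[OF h] z by blast
qed

private lemma lux_0: "luxemburg_norm \<phi> (\<lambda>z. 0) = 0"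
proof -
  have "\<phi> 0 = 0" using orl by (simp add: orlicz_function_def)
  moreover have "taylor_coeff (\<lambda>z. 0) k = 0" for k
    by (simp add: taylor_coeff_def fps_expansion_def)
  ultimately have "adm (\<lambda>z. 0) = {0<..}" by (auto simp: adm_def)
  then show ?thesis by (simp add: lux)
qed

lemma zero_in_ell_a: "(\<lambda>z. 0) \<in> ell_a \<phi>"
  using orl by (auto simp: ell_a_def orlicz_function_def taylor_coeff_def fps_expansion_def
      intro!: exI[of _ 1])

private lemma lux_minus: assumes "f \<in> ell_a \<phi>" "g \<in> ell_a \<phi>"
  shows "luxemburg_norm \<phi> (\<lambda>z. f z - g z) = luxemburg_norm \<phi> (\<lambda>z. g z - f z)"
  using assms by (simp add: luxemburg_norm_def ell_a_def taylor_coeff_diff norm_minus_commute)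

lemma Metric_space_ell_a: "Metric_space (ell_a \<phi>) (luxemburg_dist \<phi>)"
proof
  fix f g :: "complex \<Rightarrow> complex"
  show "0 \<le> luxemburg_dist \<phi> f g"
    by (auto simp: luxemburg_dist_def intro!: lux_nonneg ell_a_diff)
  show "luxemburg_dist \<phi> f g = luxemburg_dist \<phi> g f"
    using lux_minus[of f g] by (auto simp: luxemburg_dist_def)
next
  fix f g assume fg: "f \<in> ell_a \<phi>" "g \<in> ell_a \<phi>"
  show "luxemburg_dist \<phi> f g = 0 \<longleftrightarrow> f = g"
  proof
    assume "luxemburg_dist \<phi> f g = 0"
    then have "(\<lambda>z. f z - g z) = (\<lambda>z. 0)"
      using fg lux_eq_0[OF ell_a_diff[OF fg]] by (simp add: luxemburg_dist_def)
    then show "f = g" by (simp add: fun_eq_iff)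
  qed (use lux_0 in \<open>simp add: luxemburg_dist_def\<close>)
next
  fix f g h assume H: "f \<in> ell_a \<phi>" "g \<in> ell_a \<phi>" "h \<in> ell_a \<phi>"
  have "(\<lambda>z. f z - h z) = (\<lambda>z. (f z - g z) - (h z - g z))" by simp
  then have "luxemburg_norm \<phi> (\<lambda>z. f z - h z)
      \<le> luxemburg_norm \<phi> (\<lambda>z. f z - g z) + luxemburg_norm \<phi> (\<lambda>z. h z - g z)"
    using lux_triangle[OF ell_a_diff[OF H(1,2)] ell_a_diff[OF H(3,2)]] by simp
  then show "luxemburg_dist \<phi> f h \<le> luxemburg_dist \<phi> f g + luxemburg_dist \<phi> g h"
    using H lux_minus[of g h] by (simp add: luxemburg_dist_def)
qed

lemma topspace_ell_a_topology: "topspace (ell_a_topology \<phi>) = ell_a \<phi>"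
  unfolding ell_a_topology_def by (rule Metric_space.topspace_mtopology[OF Metric_space_ell_a])

end

end

theory Submission
  imports Defs "HOL-Probability.Probability"
begin

text \<open>Call a measurable function on the circle \<^emph>\<open>free\<close> if, for every \<open>\<epsilon> > 0\<close>, some polynomial of
Luxemburg norm at most \<open>\<epsilon>\<close> is within \<open>\<epsilon>\<close> of it off a set of measure less than \<open>\<epsilon>\<close>. If everything
is free, then universality is generic by Baire's theorem: to a polynomial \<open>p\<close> one may add a small
polynomial that takes it close to any prescribed target \<open>g\<close>, in measure on the circle; for a
polynomial the values at the points \<open>r n (\<zeta> - w) + w\<close> tend to the value at \<open>\<zeta>\<close>, uniformly in \<open>\<zeta>\<close>
and \<open>w\<close>, and the partial sums are eventually the polynomial itself. The functions for which such
an approximation of \<open>g\<close> occurs at some index beyond a given one form an open set, because the norm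
controls the coefficients and hence uniform convergence on compact subsets of the disc. Countably
many targets suffice, since trigonometric polynomials with rational coefficients are dense in
measure (\<open>rational_trig_dense\<close>), and Borel--Cantelli upgrades approximation in measure to
convergence almost everywhere (\<open>universal_of_approximations\<close>). Baire's theorem is applied in the
closure of the polynomials, a closed subspace of the complete space \<open>ell_a \<phi>\<close> (\<open>mcomplete_ell_a\<close>).
This produces a universal function for every \<open>\<phi>\<close>; under \<open>Delta2\<close> the subspace is the whole space
(\<open>Delta2_poly_dense\<close>), and so the universal functions contain a dense \<open>G\<^sub>\<delta>\<close> set.

That everything is free reduces to the constant \<open>1\<close> (\<open>approximate_one\<close>). Multiplication by a fixed
polynomial is bounded, and a polynomial of small norm has small coefficients, so that its first
few coefficients may be dropped and a division by a power of \<open>z\<close> stays within the polynomials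
(\<open>approximate_trig\<close>).

For the constant \<open>1\<close> the hypothesis \<open>\<phi>(t) = o(t\<^sup>2)\<close> is decisive: a polynomial whose coefficients
are all tiny has small norm even if their squares add up to a fixed constant (\<open>lux_le_flat\<close>). Let
\<open>X\<close> be a normalised lacunary polynomial with \<open>N\<close> terms and unimodular coefficients. All its powers
\<open>X ^ k\<close> with \<open>1 \<le> k \<le> m\<close> are flat in this sense as \<open>N\<close> grows (\<open>lacunary_power_bounds\<close>), hence so
is \<open>G(X)\<close> for every fixed polynomial \<open>G\<close> without constant term. If the coefficients of \<open>X\<close> are
random, the central limit theorem makes the values of \<open>X\<close> on the circle approximately Gaussian, so
that for most points they lie in a fixed compact set \<open>off_strip \<kappa> R\<close> that omits a strip around the
imaginary axis (\<open>lacunary_poly_off_strip\<close>). That compact set does not separate the origin from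
infinity, and therefore there is a polynomial \<open>G\<close> with \<open>G(0) = 0\<close> that is close to \<open>1\<close> on it
(\<open>polynomial_one_off_strip\<close>). The polynomial \<open>G(X)\<close> then has small norm and is close to \<open>1\<close> off a
small subset of the circle.\<close>

section \<open>Polynomials close to one off a strip\<close>

definition poly_approximable :: "complex set \<Rightarrow> (complex \<Rightarrow> complex) \<Rightarrow> bool" where
  "poly_approximable S f \<longleftrightarrow> (\<forall>e>0. \<exists>p. \<forall>z\<in>S. norm (f z - poly p z) < e)"

lemma poly_approximable_poly: "poly_approximable S (poly p)"
  unfolding poly_approximable_def by (intro allI impI exI[of _ p]) simp

lemma poly_approximable_bounded:
  assumes "poly_approximable S f" "bounded S"
  obtains B where "B > 0" "\<And>z. z \<in> S \<Longrightarrow> norm (f z) \<le> B"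
proof -
  obtain p where p: "\<And>z. z \<in> S \<Longrightarrow> norm (f z - poly p z) < 1"
    using assms(1) unfolding poly_approximable_def by (metis zero_less_one)
  obtain R where R: "\<And>z. z \<in> S \<Longrightarrow> norm z \<le> R"
    using assms(2) unfolding bounded_iff by blast
  have "compact (poly p ` cball 0 R)"
    by (intro compact_continuous_image compact_cball continuous_on_poly continuous_on_id)
  from compact_imp_bounded[OF this]
  obtain C where C: "\<And>z. z \<in> cball 0 R \<Longrightarrow> norm (poly p z) \<le> C"
    unfolding bounded_iff by blast
  have "norm (f z) \<le> \<bar>C\<bar> + 1" if "z \<in> S" for z
  proof -
    have "norm (poly p z) \<le> C" using C R[OF that] by simp
    then show ?thesis using p[OF that] norm_triangle_ineq[of "f z - poly p z" "poly p z"] by simp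
  qed
  then show ?thesis by (intro that[of "\<bar>C\<bar> + 1"]) auto
qed

lemma poly_approximable_mult:
  assumes f: "poly_approximable S f" and g: "poly_approximable S g" and S: "bounded S"
  shows "poly_approximable S (\<lambda>z. f z * g z)"
  unfolding poly_approximable_def
proof (intro allI impI)
  fix e :: real assume e: "e > 0"
  obtain Bg where Bg: "Bg > 0" "\<And>z. z \<in> S \<Longrightarrow> norm (g z) \<le> Bg"
    using poly_approximable_bounded[OF g S] by blast
  obtain p where p: "\<And>z. z \<in> S \<Longrightarrow> norm (f z - poly p z) < e / (2 * Bg)"
    using f e Bg
      unfolding poly_approximable_def by (metis divide_pos_pos mult_pos_pos zero_less_numeral)
  obtain Bp where Bp: "Bp > 0" "\<And>z. z \<in> S \<Longrightarrow> norm (poly p z) \<le> Bp"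
    using poly_approximable_bounded[OF poly_approximable_poly S] by blast
  obtain q where q: "\<And>z. z \<in> S \<Longrightarrow> norm (g z - poly q z) < e / (2 * Bp)"
    using g e Bp
      unfolding poly_approximable_def by (metis divide_pos_pos mult_pos_pos zero_less_numeral)
  have "norm (f z * g z - poly (p * q) z) < e" if z: "z \<in> S" for z
  proof -
    have "f z * g z - poly (p * q) z = (f z - poly p z) * g z + poly p z * (g z - poly q z)"
      by (simp add: algebra_simps)
    then have "norm (f z * g z - poly (p * q) z)
        \<le> norm (f z - poly p z) * norm (g z) + norm (poly p z) * norm (g z - poly q z)"
      by (metis norm_mult norm_triangle_ineq)
    also have "\<dots> \<le> norm (f z - poly p z) * Bg + Bp * norm (g z - poly q z)"
      using Bg Bp z by (intro add_mono mult_left_mono mult_right_mono) auto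
    also have "\<dots> < e / (2 * Bg) * Bg + Bp * (e / (2 * Bp))"
      using Bg Bp p[OF z] q[OF z]
        by (intro add_strict_mono mult_strict_right_mono mult_strict_left_mono) auto
    also have "\<dots> = e" using Bg Bp by simp
    finally show ?thesis .
  qed
  then show "\<exists>p. \<forall>z\<in>S. norm (f z * g z - poly p z) < e" by blast
qed

lemma poly_approximable_sum_powers:
  assumes f: "poly_approximable S f" and S: "bounded S"
  shows "poly_approximable S (\<lambda>z. \<Sum>n<N. f z ^ n)"
proof (induction N)
  case 0
  have "poly_approximable S (\<lambda>z. poly 0 z)" by (rule poly_approximable_poly)
  then show ?case unfolding poly_0 lessThan_0 sum.empty .
next
  case (Suc N)
  have "(\<Sum>n<Suc N. f z ^ n) = 1 + f z * (\<Sum>n<N. f z ^ n)" for z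
    by (simp add: sum.lessThan_Suc_shift sum_distrib_left del: sum.lessThan_Suc)
  moreover have "poly_approximable S (\<lambda>z. 1 + f z * (\<Sum>n<N. f z ^ n))"
    unfolding poly_approximable_def
  proof (intro allI impI)
    fix e :: real assume "e > 0"
    then obtain p where "\<forall>z\<in>S. norm (f z * (\<Sum>n<N. f z ^ n) - poly p z) < e"
      using poly_approximable_mult[OF f Suc S] unfolding poly_approximable_def by blast
    then show "\<exists>p. \<forall>z\<in>S. norm (1 + f z * (\<Sum>n<N. f z ^ n) - poly p z) < e"
      by (intro exI[of _ "1 + p"]) simp
  qed
  ultimately show ?case by simp
qed

text \<open>The partial sums of the geometric series converge uniformly where the ratio is at most
\<open>1/2\<close>.\<close>

lemma poly_approximable_geometric:
  assumes f: "poly_approximable S f" and S: "bounded S" and le: "\<And>z. z \<in> S \<Longrightarrow> norm (f z) \<le> 1/2"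
  shows "poly_approximable S (\<lambda>z. 1 / (1 - f z))"
  unfolding poly_approximable_def
proof (intro allI impI)
  fix e :: real assume e: "e > 0"
  obtain N where N: "(1/2::real) ^ N < e / 4"
    using real_arch_pow_inv[of "e/4" "1/2"] e by auto
  obtain p where p: "\<And>z. z \<in> S \<Longrightarrow> norm ((\<Sum>n<N. f z ^ n) - poly p z) < e / 2"
    using poly_approximable_sum_powers[OF f S, of N] e unfolding poly_approximable_def
    by (metis half_gt_zero)
  have "norm (1 / (1 - f z) - poly p z) < e" if z: "z \<in> S" for z
  proof -
    have h: "1/2 \<le> norm (1 - f z)" using le[OF z] norm_triangle_ineq2[of 1 "f z"] by simp
    then have nz: "1 - f z \<noteq> 0" by auto
    then have "1 / (1 - f z) - (\<Sum>n<N. f z ^ n) = f z ^ N / (1 - f z)"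
      by (simp add: geometric_sum field_simps sum_gp_strict)
    then have "norm (1 / (1 - f z) - (\<Sum>n<N. f z ^ n)) = norm (f z) ^ N / norm (1 - f z)"
      by (simp add: norm_divide norm_power)
    also have "\<dots> \<le> (1/2) ^ N / (1/2)"
      using h le[OF z] by (intro frac_le power_mono) auto
    also have "\<dots> < e / 2" using N by simp
    finally have "norm (1 / (1 - f z) - (\<Sum>n<N. f z ^ n)) < e / 2" .
    then show ?thesis
      using p[OF z] norm_triangle_ineq[of "1 / (1 - f z) - (\<Sum>n<N. f z ^ n)" "(\<Sum>n<N. f z ^ n) - poly p z"]
      by simp
  qed
  then show "\<exists>p. \<forall>z\<in>S. norm (1 / (1 - f z) - poly p z) < e" by blast
qed

lemma norm_real_over: "norm (of_real s * (1 / x) :: complex) = \<bar>s\<bar> / norm x"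
  by (simp add: norm_mult norm_divide)

text \<open>Pole pushing along the negative real axis. A pole beyond twice the radius of \<open>S\<close> causes no
difficulty, by the power series at the origin. A pole whose distance to \<open>S\<close> is at least \<open>t\<close> can be
moved by \<open>t/2\<close>, because the quotient of the new and the old pole term is the sum of a geometric
series with ratio at most \<open>1/2\<close>.\<close>

lemma poly_approximable_pole:
  fixes S :: "complex set" and t :: real
  assumes S: "bounded S" and t: "t > 0"
    and far: "\<And>z s. z \<in> S \<Longrightarrow> t \<le> s \<Longrightarrow> t \<le> norm (z + of_real s)"
  shows "poly_approximable S (\<lambda>z. 1 / (z + of_real t))"
proof -
  \<comment> \<open>The poles visited: from \<open>- b K\<close>, far away, down to \<open>- b 0 = - t\<close>.\<close>
  define b where "b k = t + of_nat k * (t/2)" for k :: nat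
  have bt: "t \<le> b k" for k using t by (simp add: b_def)
  obtain R where R: "R > 0" "\<And>z. z \<in> S \<Longrightarrow> norm z \<le> R"
    using S unfolding bounded_pos by blast
  obtain K :: nat where K: "2 * R \<le> K * (t/2)"
    using reals_Archimedean3[of "t/2"] t by (metis half_gt_zero less_eq_real_def)
  have "poly_approximable S (\<lambda>z. 1 / (z + of_real (b (K - j))))" if "j \<le> K" for j
    using that
  proof (induction j)
    case 0
    have bK: "2 * R \<le> b K" using K t by (simp add: b_def)
    then have b0: "b K > 0" using R by linarith
    have "poly_approximable S (\<lambda>z. 1 / (1 - poly [:0, - 1 / of_real (b K):] z))"
    proof (rule poly_approximable_geometric[OF poly_approximable_poly S])
      fix z assume "z \<in> S"
      then have "2 * norm z \<le> b K" using R(2)[of z] bK by simp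
      then show "norm (poly [:0, - 1 / of_real (b K):] z) \<le> 1/2"
        using b0 by (simp add: norm_divide norm_mult field_simps)
    qed
    from poly_approximable_mult[OF poly_approximable_poly[of _ "[:1 / of_real (b K):]"] this S]
    have "poly_approximable S (\<lambda>z. 1 / of_real (b K) * (1 / (1 + z / of_real (b K))))" by simp
    moreover have "1 / of_real (b K) * (1 / (1 + z / of_real (b K))) = 1 / (z + of_real (b K))" for z :: complex
      using b0 by (simp add: field_simps)
    ultimately show ?case by simp
  next
    case (Suc j)
    define c where "c = b (K - j)"
    define c' where "c' = b (K - Suc j)"
    have cc: "c - c' = t / 2"
      using Suc.prems by (simp add: b_def c_def c'_def of_nat_diff field_simps)
    have IH: "poly_approximable S (\<lambda>z. 1 / (z + of_real c))" using Suc by (simp add: c_def)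
    have far': "t \<le> norm (z + of_real c)" "z + of_real c' \<noteq> 0" if "z \<in> S" for z
      using far[OF that, of c] far[OF that, of c'] bt t by (auto simp: c_def c'_def)
    from poly_approximable_mult[OF poly_approximable_poly[of _ "[:of_real (t/2):]"] IH S]
    have "poly_approximable S (\<lambda>z. of_real (t/2) * (1 / (z + of_real c)))" by simp
    then have "poly_approximable S (\<lambda>z. 1 / (1 - of_real (t/2) * (1 / (z + of_real c))))"
    proof (rule poly_approximable_geometric[OF _ S])
      fix z assume "z \<in> S"
      then show "norm (of_real (t/2) * (1 / (z + of_real c))) \<le> 1/2"
        using far'(1)[of z] t unfolding norm_real_over by (auto simp: divide_le_eq)
    qed
    from poly_approximable_mult[OF IH this S]
    have "poly_approximable S (\<lambda>z. 1 / (z + of_real c) * (1 / (1 - of_real (t/2) * (1 / (z + of_real c)))))" .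
    moreover have "1 / (z + of_real c) * (1 / (1 - of_real (t/2) * (1 / (z + of_real c)))) = 1 / (z + of_real c')"
      if "z \<in> S" for z
    proof -
      have nz: "z + of_real c \<noteq> 0" using far'(1)[OF that] t by auto
      have "x * (1 - u * (1 / x)) = x - u" if "x \<noteq> 0" for x u :: complex
        using that by (simp add: right_diff_distrib)
      from this[OF nz] have "(z + of_real c) * (1 - of_real (t/2) * (1 / (z + of_real c))) = z + of_real c - of_real (t/2)" .
      also have "\<dots> = z + of_real c'" unfolding cc[symmetric] by simp
      finally show ?thesis by (metis mult_1 times_divide_times_eq)
    qed
    ultimately have "poly_approximable S (\<lambda>z. 1 / (z + of_real c'))"
      unfolding poly_approximable_def by simp
    then show ?case by (simp add: c'_def)
  qed
  from this[of K] show ?thesis by (simp add: b_def)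
qed

text \<open>The special case of Runge's theorem that is needed: \<open>L\<close> does not surround the origin, since
it stays away from the negative real axis. With \<open>t = d/2\<close> the function \<open>t / (z + t)\<close> equals \<open>1\<close> at
the origin and is at most \<open>1/2\<close> on \<open>L\<close>; a high power of a polynomial close to it, normalised at
the origin, does the job.\<close>

lemma peak_polynomial:
  fixes L :: "complex set" and d e :: real
  assumes L: "bounded L" and d: "d > 0" and e: "e > 0"
    and far: "\<And>z s. z \<in> L \<Longrightarrow> 0 \<le> s \<Longrightarrow> d \<le> norm (z + of_real s)"
  obtains Q where "poly Q 0 = 1" "\<And>z. z \<in> L \<Longrightarrow> norm (poly Q z) \<le> e"
proof -
  define t where "t = d / 2"
  have t: "t > 0" using d by (simp add: t_def)
  let ?S = "insert 0 L"
  have S: "bounded ?S" using L by simp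
  have pole: "poly_approximable ?S (\<lambda>z. 1 / (z + of_real t))"
  proof (rule poly_approximable_pole[OF S t])
    fix z s assume z: "z \<in> ?S" "t \<le> s"
    show "t \<le> norm (z + of_real s)"
    proof (cases "z \<in> L")
      case True
      then show ?thesis using far[OF True, of s] z t d by (simp add: t_def)
    qed (use z t in auto)
  qed
  from poly_approximable_mult[OF poly_approximable_poly[of _ "[:of_real t:]"] this S]
  have q: "poly_approximable ?S (\<lambda>z. of_real t * (1 / (z + of_real t)))" by simp
  \<comment> \<open>An error of \<open>1/8\<close> leaves a ratio of at most \<open>(1/2 + 1/8) / (1 - 1/8) = 5/7\<close>.\<close>
  obtain p where p: "\<And>z. z \<in> ?S \<Longrightarrow> norm (of_real t * (1 / (z + of_real t)) - poly p z) < 1/8"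
    using q unfolding poly_approximable_def by (metis zero_less_divide_1_iff zero_less_numeral)
  have p0: "norm (1 - poly p 0) < 1/8" using p[of 0] t by simp
  then have p0': "norm (poly p 0) \<ge> 7/8" using norm_triangle_ineq2[of 1 "1 - poly p 0"] by simp
  have pL: "norm (poly p z) \<le> 5/8" if "z \<in> L" for z
  proof -
    have "d \<le> norm (z + of_real t)" using far[OF that] t by simp
    then have "norm (of_real t * (1 / (z + of_real t))) \<le> 1/2"
      using d t unfolding norm_real_over by (auto simp: divide_le_eq t_def)
    moreover have "norm (poly p z) \<le> norm (of_real t * (1 / (z + of_real t)))
        + norm (of_real t * (1 / (z + of_real t)) - poly p z)"
      by (metis norm_minus_commute norm_triangle_sub)
    ultimately show ?thesis using p[of z] that by simp
  qed
  obtain n where n: "(5/7::real) ^ n < e"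
    using real_arch_pow_inv[of e "5/7"] e by auto
  define Q where "Q = smult (1 / poly p 0 ^ n) (p ^ n)"
  have nz: "poly p 0 \<noteq> 0" using p0' by auto
  have "poly Q 0 = 1" using nz by (simp add: Q_def)
  moreover have "norm (poly Q z) \<le> e" if "z \<in> L" for z
  proof -
    have "norm (poly p z) / norm (poly p 0) \<le> (5/8) / (7/8)"
      using pL[OF that] p0' by (intro frac_le) auto
    then have "(norm (poly p z) / norm (poly p 0)) ^ n \<le> (5/7) ^ n"
      by (intro power_mono) auto
    then show ?thesis using n by (simp add: Q_def norm_divide norm_mult norm_power power_divide)
  qed
  ultimately show ?thesis by (rule that)
qed

text \<open>Squaring folds the two halves of the compact set into one set that keeps the distance \<open>\<kappa>\<^sup>2\<close>
from the negative real axis, because \<open>w\<^sup>2 + s = (w + \<i> \<surd>s) (w - \<i> \<surd>s)\<close> and both factors have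
modulus at least \<open>\<bar>Re w\<bar>\<close>. So \<open>1 - Q(w\<^sup>2)\<close> with \<open>Q\<close> from \<open>peak_polynomial\<close> serves.\<close>

lemma polynomial_one_off_strip:
  fixes \<kappa> R e :: real
  assumes \<kappa>: "\<kappa> > 0" and e: "e > 0"
  obtains G :: "complex poly" where "poly G 0 = 0"
    "\<And>w. \<kappa> \<le> \<bar>Re w\<bar> \<Longrightarrow> \<bar>Re w\<bar> \<le> R \<Longrightarrow> \<bar>Im w\<bar> \<le> R \<Longrightarrow> norm (poly G w - 1) \<le> e"
proof -
  define K where "K = {w. \<kappa> \<le> \<bar>Re w\<bar> \<and> \<bar>Re w\<bar> \<le> R \<and> \<bar>Im w\<bar> \<le> R}"
  define L where "L = (\<lambda>w. w\<^sup>2) ` K"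
  have "bounded L"
    unfolding bounded_iff
  proof (intro exI ballI)
    fix z assume "z \<in> L"
    then obtain w where w: "w \<in> K" "z = w\<^sup>2" by (auto simp: L_def)
    have "norm w \<le> 2 * R" using cmod_le[of w] w by (simp add: K_def)
    then show "norm z \<le> (2 * R)\<^sup>2" unfolding w(2) norm_power by (intro power_mono) auto
  qed
  moreover have "\<kappa>\<^sup>2 \<le> norm (z + of_real s)" if z: "z \<in> L" and s: "0 \<le> s" for z s
  proof -
    obtain w where w: "w \<in> K" "z = w\<^sup>2" using z by (auto simp: L_def)
    have *: "\<kappa> \<le> norm (w + \<i> * of_real u)" for u
      using w(1) abs_Re_le_cmod[of "w + \<i> * of_real u"] by (simp add: K_def)
    have "z + of_real s = (w + \<i> * of_real (sqrt s)) * (w + \<i> * of_real (- sqrt s))"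
      using s by (simp add: w(2) algebra_simps power2_eq_square flip: of_real_mult)
    then have "norm (z + of_real s) = norm (w + \<i> * of_real (sqrt s)) * norm (w + \<i> * of_real (- sqrt s))"
      by (simp only: norm_mult)
    also have "\<dots> \<ge> \<kappa> * \<kappa>"
      using \<kappa> by (intro mult_mono *) auto
    finally show ?thesis by (simp add: power2_eq_square)
  qed
  moreover have "\<kappa>\<^sup>2 > 0" using \<kappa> by simp
  ultimately obtain Q where Q: "poly Q 0 = 1" "\<And>z. z \<in> L \<Longrightarrow> norm (poly Q z) \<le> e"
    using peak_polynomial[of L "\<kappa>\<^sup>2" e] e by blast
  show ?thesis
  proof
    show "poly (1 - pcompose Q (monom 1 2)) 0 = 0" by (simp add: Q poly_pcompose poly_monom)
    fix w assume "\<kappa> \<le> \<bar>Re w\<bar>" "\<bar>Re w\<bar> \<le> R" "\<bar>Im w\<bar> \<le> R"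
    then have "w\<^sup>2 \<in> L" by (auto simp: L_def K_def)
    from Q(2)[OF this] show "norm (poly (1 - pcompose Q (monom 1 2)) w - 1) \<le> e"
      by (simp add: poly_pcompose poly_monom)
  qed
qed

section \<open>Powers of lacunary polynomials\<close>

text \<open>The base \<open>m + 1\<close> of the exponents makes sums of at most \<open>m\<close> exponents expansions to this
base without carries. So in the powers up to \<open>m\<close> different products of monomials never meet,
except by permuting the factors.\<close>

definition lacunary_poly :: "nat \<Rightarrow> (nat \<Rightarrow> complex) \<Rightarrow> nat \<Rightarrow> complex poly" where
  "lacunary_poly m c N = (\<Sum>j<N. monom (c j) ((m + 1) ^ j))"

lemma degree_lacunary_power:
  assumes "k \<le> m"
  shows "degree (lacunary_poly m c N ^ k) < (m + 1) ^ N"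
proof (cases N)
  case 0
  then show ?thesis by (cases k) (auto simp: lacunary_poly_def)
next
  case (Suc n)
  have "degree (lacunary_poly m c N) \<le> (m + 1) ^ n"
    unfolding lacunary_poly_def Suc
    by (intro degree_sum_le) (auto intro!: order.trans[OF degree_monom_le] power_increasing)
  then have "degree (lacunary_poly m c N) * k \<le> (m + 1) ^ n * m"
    using assms by (intro mult_mono) auto
  also have "\<dots> < (m + 1) ^ N" by (simp add: Suc)
  finally show ?thesis using degree_power_le[of "lacunary_poly m c N" k] by linarith
qed

text \<open>In the binomial expansion of the power, the terms occupy disjoint blocks of exponents, each
of length \<open>(m + 1) ^ N\<close>.\<close>

lemma coeff_lacunary_power_Suc:
  assumes k: "k \<le> m" and l: "l < (m + 1) ^ N"
  shows "coeff (lacunary_poly m c (Suc N) ^ k) (i * (m + 1) ^ N + l) =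
    (if i \<le> k then of_nat (k choose i) * c N ^ i * coeff (lacunary_poly m c N ^ (k - i)) l else 0)"
proof -
  let ?\<Lambda> = "(m + 1) ^ N" and ?X = "lacunary_poly m c N"
  have "lacunary_poly m c (Suc N) ^ k = (monom (c N) ?\<Lambda> + ?X) ^ k"
    by (simp add: lacunary_poly_def add.commute)
  also have "\<dots> = (\<Sum>j\<le>k. of_nat (k choose j) * monom (c N) ?\<Lambda> ^ j * ?X ^ (k - j))"
    by (rule binomial_ring)
  also have "\<dots> = (\<Sum>j\<le>k. monom (of_nat (k choose j) * c N ^ j) (j * ?\<Lambda>) * ?X ^ (k - j))"
    by (intro sum.cong refl)
       (simp add: monom_power of_nat_poly smult_monom mult.commute)
  finally have "coeff (lacunary_poly m c (Suc N) ^ k) (i * ?\<Lambda> + l) =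
      (\<Sum>j\<le>k. coeff (monom (of_nat (k choose j) * c N ^ j) (j * ?\<Lambda>) * ?X ^ (k - j)) (i * ?\<Lambda> + l))"
    by (simp add: coeff_sum)
  also have "\<dots> = (\<Sum>j\<le>k. if j = i then of_nat (k choose i) * c N ^ i * coeff (?X ^ (k - i)) l else 0)"
  proof (rule sum.cong[OF refl])
    fix j assume "j \<in> {..k}"
    have deg: "degree (?X ^ (k - j)) < ?\<Lambda>" using k by (intro degree_lacunary_power) auto
    consider "j = i" | "i < j" | "j < i" by linarith
    then show "coeff (monom (of_nat (k choose j) * c N ^ j) (j * ?\<Lambda>) * ?X ^ (k - j)) (i * ?\<Lambda> + l) =
        (if j = i then of_nat (k choose i) * c N ^ i * coeff (?X ^ (k - i)) l else 0)"
    proof cases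
      case 2
      then have "Suc i * ?\<Lambda> \<le> j * ?\<Lambda>" by (intro mult_right_mono) auto
      then have "i * ?\<Lambda> + l < j * ?\<Lambda>" using l by simp
      then show ?thesis using 2 by (simp add: coeff_monom_mult)
    next
      case 3
      then have "Suc j * ?\<Lambda> \<le> i * ?\<Lambda>" by (intro mult_right_mono) auto
      then have "?\<Lambda> \<le> i * ?\<Lambda> + l - j * ?\<Lambda>" by simp
      then have "coeff (?X ^ (k - j)) (i * ?\<Lambda> + l - j * ?\<Lambda>) = 0"
        using deg by (intro coeff_eq_0) linarith
      then show ?thesis using 3 by (simp add: coeff_monom_mult)
    qed (simp add: coeff_monom_mult)
  qed
  also have "\<dots> = (if i \<le> k then of_nat (k choose i) * c N ^ i * coeff (?X ^ (k - i)) l else 0)"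
    by simp
  finally show ?thesis .
qed

text \<open>The coefficients are multinomial coefficients up to factors of modulus at most \<open>1\<close>, so they
are at most \<open>fact k\<close>, and the sum of their squares is at most \<open>fact k\<close> times \<open>N ^ k\<close>, the sum of
the multinomial coefficients. The induction on the number of terms realises this block by block;
both bounds come from \<open>(k choose i) * fact (k - i) \<le> fact k\<close> and the binomial theorem.\<close>

lemma lacunary_power_bounds:
  assumes c: "\<And>j. norm (c j) \<le> 1" and "k \<le> m"
  shows "norm (coeff (lacunary_poly m c N ^ k) n) \<le> fact k"
    and "(\<Sum>n<D. (norm (coeff (lacunary_poly m c N ^ k) n))\<^sup>2) \<le> fact k * of_nat N ^ k"
proof -
  have "(\<forall>n. norm (coeff (lacunary_poly m c N ^ k) n) \<le> fact k) \<and>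
    (\<forall>D. (\<Sum>n<D. (norm (coeff (lacunary_poly m c N ^ k) n))\<^sup>2) \<le> fact k * of_nat N ^ k)"
    using \<open>k \<le> m\<close>
  proof (induction N arbitrary: k)
    case 0
    show ?case
    proof (cases k)
      case 0
      have "(\<Sum>n<D. (norm (coeff (1::complex poly) n))\<^sup>2) \<le> 1" for D
      proof -
        have "(\<Sum>n<D. (norm (coeff (1::complex poly) n))\<^sup>2) = (\<Sum>n<D. if n = 0 then 1 else 0)"
          by (intro sum.cong) (auto simp: coeff_1)
        then show ?thesis by simp
      qed
      then show ?thesis by (simp add: 0 coeff_1)
    qed (simp add: lacunary_poly_def)
  next
    case (Suc N)
    let ?\<Lambda> = "(m + 1) ^ N" and ?X = "lacunary_poly m c N" and ?Y = "lacunary_poly m c (Suc N)"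
    have L: "0 < ?\<Lambda>" by simp
    have co: "norm (coeff (?Y ^ k) (i * ?\<Lambda> + l)) \<le>
        (if i \<le> k then of_nat (k choose i) * norm (coeff (?X ^ (k - i)) l) else 0)"
      if "l < ?\<Lambda>" for i l
      unfolding coeff_lacunary_power_Suc[OF Suc.prems that]
      using power_le_one[OF _ c, of N i]
      by (auto simp: norm_mult norm_power mult.assoc intro!: mult_left_mono mult_left_le_one_le)
    have bin: "of_nat (k choose i) * fact (k - i) \<le> (fact k :: real)" if "i \<le> k" for i
    proof -
      have "fact k = fact i * (of_nat (k choose i) * fact (k - i) :: real)"
        using binomial_fact_lemma[OF that]
          by (metis (no_types) of_nat_fact of_nat_mult mult.assoc mult.commute)
      moreover have "1 * (of_nat (k choose i) * fact (k - i) :: real) \<le> fact i * (of_nat (k choose i) * fact (k - i))"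
        by (intro mult_right_mono) (auto simp: fact_ge_1)
      ultimately show ?thesis by simp
    qed
    have co_fact: "norm (coeff (?Y ^ k) (i * ?\<Lambda> + l)) \<le> fact k" if l: "l < ?\<Lambda>" for i l
    proof (cases "i \<le> k")
      case True
      have "norm (coeff (?X ^ (k - i)) l) \<le> fact (k - i)" using Suc.IH[of "k - i"] Suc.prems by auto
      then have "of_nat (k choose i) * norm (coeff (?X ^ (k - i)) l) \<le> of_nat (k choose i) * fact (k - i)"
        by (intro mult_left_mono) auto
      also note bin[OF True]
      finally show ?thesis using order.trans[OF co[OF l, of i]] True by simp
    next
      case False
      then have "norm (coeff (?Y ^ k) (i * ?\<Lambda> + l)) \<le> 0" using co[OF l, of i] by simp
      then show ?thesis by (rule order.trans) simp
    qed
    have "norm (coeff (?Y ^ k) n) \<le> fact k" for n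
      using co_fact[of "n mod ?\<Lambda>" "n div ?\<Lambda>"] L unfolding div_mult_mod_eq by simp
    moreover have "(\<Sum>n<D. (norm (coeff (?Y ^ k) n))\<^sup>2) \<le> fact k * of_nat (Suc N) ^ k" for D
    proof -
      let ?f = "\<lambda>n. (norm (coeff (?Y ^ k) n))\<^sup>2"
      have blk: "(\<Sum>n\<in>{i * ?\<Lambda>..<i * ?\<Lambda> + ?\<Lambda>}. ?f n) \<le>
          (if i \<le> k then (of_nat (k choose i))\<^sup>2 * (fact (k - i) * of_nat N ^ (k - i)) else 0)" for i
      proof -
        have "(\<Sum>n\<in>{i * ?\<Lambda>..<i * ?\<Lambda> + ?\<Lambda>}. ?f n) = (\<Sum>l<?\<Lambda>. ?f (i * ?\<Lambda> + l))"
         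
            using sum.shift_bounds_nat_ivl[of ?f 0 "i * ?\<Lambda>" ?\<Lambda>] by (simp add: add.commute lessThan_atLeast0)
        also have "\<dots> \<le> (\<Sum>l<?\<Lambda>. (if i \<le> k then of_nat (k choose i) * norm (coeff (?X ^ (k - i)) l) else 0)\<^sup>2)"
          using co by (intro sum_mono power_mono) auto
        also have "\<dots> = (if i \<le> k then (of_nat (k choose i))\<^sup>2 * (\<Sum>l<?\<Lambda>. (norm (coeff (?X ^ (k - i)) l))\<^sup>2) else 0)"
          by (simp add: power_mult_distrib sum_distrib_left)
        also have "\<dots> \<le> (if i \<le> k then (of_nat (k choose i))\<^sup>2 * (fact (k - i) * of_nat N ^ (k - i)) else 0)"
          using Suc.IH[of "k - i"] Suc.prems by (auto intro!: mult_left_mono)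
        finally show ?thesis .
      qed
      have "(\<Sum>n<D. ?f n) \<le> (\<Sum>n<(D + k + 1) * ?\<Lambda>. ?f n)"
      proof (intro sum_mono2)
        have "D * 1 \<le> (D + k + 1) * ?\<Lambda>" using L by (intro mult_mono) auto
        then show "{..<D} \<subseteq> {..<(D + k + 1) * ?\<Lambda>}" by auto
      qed auto
      also have "\<dots> = (\<Sum>i<D + k + 1. \<Sum>n\<in>{i * ?\<Lambda>..<i * ?\<Lambda> + ?\<Lambda>}. ?f n)"
        by (rule sum.nat_group[symmetric])
      also have "\<dots> \<le> (\<Sum>i<D + k + 1. if i \<le> k then (of_nat (k choose i))\<^sup>2 * (fact (k - i) * of_nat N ^ (k - i)) else 0)"
        by (intro sum_mono blk)
      also have "\<dots> = (\<Sum>i\<le>k. (of_nat (k choose i))\<^sup>2 * (fact (k - i) * of_nat N ^ (k - i)))"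
        by (rule sum.mono_neutral_cong_right) auto
      also have "\<dots> \<le> (\<Sum>i\<le>k. fact k * (of_nat (k choose i) * of_nat N ^ (k - i)))"
      proof (intro sum_mono)
        fix i assume "i \<in> {..k}"
        then have "(of_nat (k choose i) * fact (k - i)) * (of_nat (k choose i) * of_nat N ^ (k - i))
            \<le> (fact k :: real) * (of_nat (k choose i) * of_nat N ^ (k - i))"
          using bin by (intro mult_right_mono) auto
        then show "(of_nat (k choose i))\<^sup>2 * (fact (k - i) * of_nat N ^ (k - i))
            \<le> (fact k :: real) * (of_nat (k choose i) * of_nat N ^ (k - i))"
          by (simp add: power2_eq_square mult_ac)
      qed
      also have "\<dots> = fact k * (1 + of_nat N) ^ k"
        by (simp add: binomial_ring sum_distrib_left)
      finally show ?thesis by (simp add: add.commute)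
    qed
    ultimately show ?case by blast
  qed
  then show "norm (coeff (lacunary_poly m c N ^ k) n) \<le> fact k"
    and "(\<Sum>n<D. (norm (coeff (lacunary_poly m c N ^ k) n))\<^sup>2) \<le> fact k * of_nat N ^ k" by auto
qed

section \<open>The Luxemburg norm of coefficient sequences\<close>

locale orlicz =
  fixes \<phi> :: "real \<Rightarrow> real"
  assumes orlicz_function: "orlicz_function \<phi>"
begin

lemma phi_zero [simp]: "\<phi> 0 = 0"
  using orlicz_function by (simp add: orlicz_function_def)

lemma phi_nonneg: "0 \<le> x \<Longrightarrow> 0 \<le> \<phi> x"
  using orlicz_function by (auto simp: orlicz_function_def)

lemma phi_pos: "0 < x \<Longrightarrow> 0 < \<phi> x"
  using orlicz_function strict_mono_onD[of "{0..}" \<phi> 0 x] by (auto simp: orlicz_function_def)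

lemma phi_mono: "0 \<le> x \<Longrightarrow> x \<le> y \<Longrightarrow> \<phi> x \<le> \<phi> y"
  using orlicz_function strict_mono_onD[of "{0..}" \<phi> x y]
  by (cases "x = y") (auto simp: orlicz_function_def)

lemma phi_convex:
  "0 \<le> x \<Longrightarrow> 0 \<le> y \<Longrightarrow> 0 \<le> s \<Longrightarrow> s \<le> 1 \<Longrightarrow> \<phi> ((1 - s) * x + s * y) \<le> (1 - s) * \<phi> x + s * \<phi> y"
  using orlicz_function convex_onD[of "{0..}" \<phi> s x y] by (auto simp: orlicz_function_def)

lemma phi_scale: "0 \<le> x \<Longrightarrow> 0 \<le> s \<Longrightarrow> s \<le> 1 \<Longrightarrow> \<phi> (s * x) \<le> s * \<phi> x"
  using phi_convex[of 0 x s] by simp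

text \<open>The coefficient sequence has Luxemburg norm at most \<open>c\<close>, with the sum bounded through its
partial sums. All norm estimates are made with this predicate on sequences, which avoids the
infimum and questions of convergence.\<close>

definition lux_le :: "real \<Rightarrow> (nat \<Rightarrow> complex) \<Rightarrow> bool" where
  "lux_le c a \<longleftrightarrow> 0 < c \<and> (\<forall>n. (\<Sum>k<n. \<phi> (norm (a k) / c)) \<le> 1)"

lemma lux_le_iff_suminf:
  "lux_le c a \<longleftrightarrow> 0 < c \<and> summable (\<lambda>k. \<phi> (norm (a k) / c)) \<and> (\<Sum>k. \<phi> (norm (a k) / c)) \<le> 1"
proof -
  have nn: "0 \<le> \<phi> (norm (a k) / c)" if "0 < c" for k using that by (intro phi_nonneg) simp
  show ?thesis (is "_ \<longleftrightarrow> ?R")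
  proof
    assume "lux_le c a"
    then show ?R
      using nn unfolding lux_le_def by (auto intro!: suminf_le_const summableI_nonneg_bounded)
  next
    assume R: ?R
    then have "(\<Sum>k<n. \<phi> (norm (a k) / c)) \<le> (\<Sum>k. \<phi> (norm (a k) / c))" for n
      using nn by (intro sum_le_suminf) auto
    then show "lux_le c a" using R unfolding lux_le_def by (meson order.trans)
  qed
qed

lemma lux_le_mono:
  assumes a: "lux_le c a" and "\<And>k. norm (b k) \<le> norm (a k)" and "c \<le> d"
  shows "lux_le d b"
proof -
  have c: "0 < c" using a by (simp add: lux_le_def)
  have "(\<Sum>k<n. \<phi> (norm (b k) / d)) \<le> (\<Sum>k<n. \<phi> (norm (a k) / c))" for n
    using assms c by (intro sum_mono phi_mono frac_le) auto
  then show ?thesis using a assms c unfolding lux_le_def by (meson order.trans less_le_trans)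
qed

text \<open>The triangle inequality of the Luxemburg norm: \<open>(a + b) / (c + d)\<close> is the convex combination
of \<open>a / c\<close> and \<open>b / d\<close> with weights \<open>c / (c + d)\<close> and \<open>d / (c + d)\<close>.\<close>

lemma lux_le_add:
  assumes a: "lux_le c a" and b: "lux_le d b"
  shows "lux_le (c + d) (\<lambda>k. a k + b k)"
proof -
  have cd: "0 < c" "0 < d" using a b by (auto simp: lux_le_def)
  define s where "s = d / (c + d)"
  have s: "0 \<le> s" "s \<le> 1" "1 - s = c / (c + d)" using cd by (auto simp: s_def field_simps)
  have le: "\<phi> (norm (a k + b k) / (c + d)) \<le> (1 - s) * \<phi> (norm (a k) / c) + s * \<phi> (norm (b k) / d)" for k
  proof -
    have "norm (a k + b k) / (c + d) \<le> (norm (a k) + norm (b k)) / (c + d)"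
      using norm_triangle_ineq cd by (intro divide_right_mono) auto
    also have "\<dots> = (1 - s) * (norm (a k) / c) + s * (norm (b k) / d)"
      unfolding s(3) using cd by (simp add: s_def add_divide_distrib)
    finally have "\<phi> (norm (a k + b k) / (c + d)) \<le> \<phi> ((1 - s) * (norm (a k) / c) + s * (norm (b k) / d))"
      using cd by (intro phi_mono) auto
    also have "\<dots> \<le> (1 - s) * \<phi> (norm (a k) / c) + s * \<phi> (norm (b k) / d)"
      using s cd by (intro phi_convex) auto
    finally show ?thesis .
  qed
  have "(\<Sum>k<n. \<phi> (norm (a k + b k) / (c + d))) \<le> 1" for n
  proof -
    have "(\<Sum>k<n. \<phi> (norm (a k + b k) / (c + d)))
        \<le> (\<Sum>k<n. (1 - s) * \<phi> (norm (a k) / c) + s * \<phi> (norm (b k) / d))"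
      by (intro sum_mono le)
    also have "\<dots> = (1 - s) * (\<Sum>k<n. \<phi> (norm (a k) / c)) + s * (\<Sum>k<n. \<phi> (norm (b k) / d))"
      by (simp add: sum.distrib sum_distrib_left)
    also have "\<dots> \<le> (1 - s) * 1 + s * 1"
      using a b s unfolding lux_le_def by (intro add_mono mult_left_mono) auto
    finally show ?thesis by simp
  qed
  then show ?thesis using cd by (simp add: lux_le_def)
qed

lemma lux_le_zero: "0 < c \<Longrightarrow> lux_le c (\<lambda>k. 0)"
  by (simp add: lux_le_def)

lemma lux_le_smult:
  assumes "lux_le c a" "norm s \<le> B" "0 < B"
  shows "lux_le (B * c) (\<lambda>k. s * a k)"
proof -
  have c: "0 < c" using assms by (simp add: lux_le_def)
  have "(\<Sum>k<n. \<phi> (norm (s * a k) / (B * c))) \<le> (\<Sum>k<n. \<phi> (norm (a k) / c))" for n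
  proof (intro sum_mono phi_mono)
    fix k
    have "norm (s * a k) / (B * c) \<le> (B * norm (a k)) / (B * c)"
      unfolding norm_mult using assms c by (intro divide_right_mono mult_right_mono) auto
    then show "norm (s * a k) / (B * c) \<le> norm (a k) / c" using assms by simp
  qed (use assms c in auto)
  then show ?thesis using assms c unfolding lux_le_def by (meson order.trans mult_pos_pos)
qed

lemma lux_le_minus: "lux_le c (\<lambda>k. a k - b k) \<longleftrightarrow> lux_le c (\<lambda>k. b k - a k)"
  by (simp add: lux_le_def norm_minus_commute)

text \<open>A convex function that vanishes at \<open>0\<close> only grows at least linearly beyond \<open>1\<close>, so \<open>\<phi> C > 1\<close>
for some \<open>C\<close>, and then no term of an admissible sequence can exceed \<open>C * c\<close>.\<close>

lemma lux_le_coeff_bound: "\<exists>C>0. \<forall>c a k. lux_le c a \<longrightarrow> norm (a k) \<le> C * c"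
proof -
  define C where "C = 1 + 1 / \<phi> 1"
  have p1: "\<phi> 1 > 0" by (rule phi_pos) simp
  have C: "C > 1" using p1 by (simp add: C_def)
  have big: "\<phi> C > 1"
  proof -
    have "\<phi> 1 \<le> (1 / C) * \<phi> C" using phi_scale[of C "1 / C"] C by simp
    then have "C * \<phi> 1 \<le> \<phi> C" using C by (simp add: field_simps)
    moreover have "C * \<phi> 1 = \<phi> 1 + 1" using p1 by (simp add: C_def field_simps)
    ultimately show ?thesis using p1 by simp
  qed
  have "norm (a k) \<le> C * c" if "lux_le c a" for c a k
  proof (rule ccontr)
    have c: "c > 0" using that by (simp add: lux_le_def)
    assume "\<not> norm (a k) \<le> C * c"
    then have "C \<le> norm (a k) / c" using c by (simp add: field_simps)
    then have "\<phi> C \<le> \<phi> (norm (a k) / c)" using C by (intro phi_mono) auto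
    also have "\<dots> \<le> (\<Sum>k<Suc k. \<phi> (norm (a k) / c))"
      using c by (intro member_le_sum phi_nonneg) auto
    also have "\<dots> \<le> 1" using that unfolding lux_le_def by blast
    finally show False using big by simp
  qed
  then show ?thesis using C by (intro exI[of _ C]) auto
qed

lemma lux_le_pCons:
  assumes "lux_le c (coeff p)" shows "lux_le c (coeff (pCons 0 p))"
proof -
  have "(\<Sum>k<n. \<phi> (norm (coeff (pCons 0 p) k) / c)) \<le> 1" for n
    using assms
      by (cases n) (auto simp: lux_le_def sum.lessThan_Suc_shift simp del: sum.lessThan_Suc)
  then show ?thesis using assms by (simp add: lux_le_def)
qed

text \<open>Shifting a sequence does not change its norm, so multiplication by \<open>q\<close> is bounded by roughly
the sum of the moduli of its coefficients.\<close>

lemma lux_le_poly_mult: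
  obtains C where "C > 0" "\<And>c p. lux_le c (coeff p) \<Longrightarrow> lux_le (C * c) (coeff (q * p))"
proof -
  have "\<exists>C>0. \<forall>c p. lux_le c (coeff p) \<longrightarrow> lux_le (C * c) (coeff (q * p))"
  proof (induction q)
    case 0
    show ?case by (intro exI[of _ 1]) (auto simp: lux_le_def)
  next
    case (pCons a q)
    then obtain C where C: "C > 0" "\<And>c p. lux_le c (coeff p) \<Longrightarrow> lux_le (C * c) (coeff (q * p))"
      by blast
    have "lux_le ((norm a + 1 + C) * c) (coeff (pCons a q * p))" if p: "lux_le c (coeff p)" for c p
    proof -
      have "lux_le ((norm a + 1) * c) (\<lambda>k. a * coeff p k)"
        by (intro lux_le_smult p) (auto simp: add_nonneg_pos)
      from lux_le_add[OF this lux_le_pCons[OF C(2)[OF p]]] show ?thesis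
        by (simp add: mult_pCons_left algebra_simps flip: coeff_smult coeff_add)
    qed
    moreover have "norm a + 1 + C > 0" using C by (simp add: add_nonneg_pos)
    ultimately show ?case by blast
  qed
  then show ?thesis using that by blast
qed

lemma lux_le_sum:
  fixes n :: nat
  assumes "\<And>i. i < n \<Longrightarrow> lux_le (c i) (a i)" and "d > 0"
  shows "lux_le ((\<Sum>i<n. c i) + d) (\<lambda>k. \<Sum>i<n. a i k)"
  using assms(1)
proof (induction n rule: nat.induct)
  case zero
  then show ?case using lux_le_zero[OF assms(2)] by simp
next
  case (Suc n)
  from lux_le_add[OF Suc.IH[OF Suc.prems] Suc.prems[of n]] show ?case by (simp add: add_ac)
qed

text \<open>If all terms are so small that \<open>\<phi> t \<le> \<eta> t\<^sup>2\<close> applies to \<open>t = norm (a k) / \<epsilon>\<close>, with \<open>\<eta> = \<epsilon>\<^sup>2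
/ S\<close>, then a square sum of at most \<open>S\<close> makes the modular at scale \<open>\<epsilon>\<close> at most \<open>1\<close>.\<close>

lemma lux_le_flat:
  assumes small: "\<phi> \<in> o[at_right 0](\<lambda>t. t\<^sup>2)" and S: "S > 0" and \<epsilon>: "\<epsilon> > 0"
  obtains \<delta> where "\<delta> > 0"
    "\<And>a. (\<And>k. norm (a k) \<le> \<delta>) \<Longrightarrow> (\<And>n. (\<Sum>k<n. (norm (a k))\<^sup>2) \<le> S) \<Longrightarrow> lux_le \<epsilon> a"
proof -
  define \<eta> where "\<eta> = \<epsilon>\<^sup>2 / S"
  have \<eta>: "\<eta> > 0" using S \<epsilon> by (simp add: \<eta>_def)
  have "\<forall>\<^sub>F t in at_right 0. norm (\<phi> t) \<le> \<eta> * norm (t\<^sup>2)"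
    using landau_o.smallD[OF small \<eta>] .
  then obtain b where b: "b > 0" "\<And>t. 0 < t \<Longrightarrow> t < b \<Longrightarrow> norm (\<phi> t) \<le> \<eta> * norm (t\<^sup>2)"
    unfolding eventually_at_right_field by auto
  show ?thesis
  proof
    show "\<epsilon> * (b / 2) > 0" using b \<epsilon> by simp
    fix a :: "nat \<Rightarrow> complex"
    assume le: "\<And>k. norm (a k) \<le> \<epsilon> * (b / 2)" and sq: "\<And>n. (\<Sum>k<n. (norm (a k))\<^sup>2) \<le> S"
    have "\<phi> (norm (a k) / \<epsilon>) \<le> \<eta> * (norm (a k) / \<epsilon>)\<^sup>2" for k
    proof (cases "a k = 0")
      case False
      have "norm (a k) / \<epsilon> \<le> b / 2" using le[of k] \<epsilon> by (simp add: field_simps)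
      then have "norm (a k) / \<epsilon> < b" using b(1) by linarith
      then show ?thesis using b(2)[of "norm (a k) / \<epsilon>"] False \<epsilon> by simp
    qed simp
    moreover have "(norm (a k) / \<epsilon>)\<^sup>2 * \<eta> = (norm (a k))\<^sup>2 / S" for k
      using \<epsilon> by (simp add: \<eta>_def power_divide)
    ultimately have "(\<Sum>k<n. \<phi> (norm (a k) / \<epsilon>)) \<le> (\<Sum>k<n. (norm (a k))\<^sup>2 / S)" for n
      by (intro sum_mono) (metis mult.commute)
    also have "(\<Sum>k<n. (norm (a k))\<^sup>2 / S) \<le> 1" for n
      using sq[of n] S by (simp add: divide_le_eq flip: sum_divide_distrib)
    finally show "lux_le \<epsilon> a" using \<epsilon> by (simp add: lux_le_def)
  qed
qed

end

section \<open>Uniform and independent points on the circle\<close>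

text \<open>The measure lives on the Borel sets of the whole plane, normalised and not completed, so
that it can serve as the law of a complex random variable.\<close>

definition haar_circle :: "complex measure" where
  "haar_circle = distr (uniform_measure lborel {0..<2 * pi}) borel cis"

lemma measurable_cis [measurable]: "cis \<in> borel_measurable borel"
  by (intro borel_measurable_continuous_onI continuous_intros)

lemma sets_haar_circle [simp, measurable_cong]: "sets haar_circle = sets borel"
  by (simp add: haar_circle_def)

lemma space_haar_circle [simp]: "space haar_circle = UNIV"
  by (simp add: haar_circle_def)

lemma prob_space_haar_circle: "prob_space haar_circle"
  unfolding haar_circle_def
  by (intro prob_space.prob_space_distr prob_space_uniform_measure) auto

lemma emeasure_haar_circle:
  assumes [measurable]: "B \<in> sets borel"
  shows "emeasure haar_circle B = emeasure lborel {t \<in> {0..<2 * pi}. cis t \<in> B} / ennreal (2 * pi)"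
proof -
  have [measurable]: "cis -` B \<in> sets borel"
    using measurable_sets_borel[OF measurable_cis assms] by simp
  have "emeasure haar_circle B = emeasure (uniform_measure lborel {0..<2 * pi}) (cis -` B)"
    unfolding haar_circle_def by (subst emeasure_distr) simp_all
  also have "\<dots> = emeasure lborel ({0..<2 * pi} \<inter> cis -` B) / emeasure lborel {0..<2 * pi}"
    by (rule emeasure_uniform_measure) auto
  also have "{0..<2 * pi} \<inter> cis -` B = {t \<in> {0..<2 * pi}. cis t \<in> B}" by auto
  finally show ?thesis by simp
qed

lemma AE_haar_circle_norm: "AE z in haar_circle. norm z = 1"
  unfolding haar_circle_def by (subst AE_distr_iff) simp_all

lemma emeasure_lborel_shift:
  fixes c :: real assumes [measurable]: "X \<in> sets borel"
  shows "emeasure lborel {t. t + c \<in> X} = emeasure lborel X"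
proof -
  have "emeasure lborel X = emeasure (distr lborel borel ((+) c)) X"
    by (simp add: lborel_distr_plus)
  also have "\<dots> = emeasure lborel {t. t + c \<in> X}"
    by (subst emeasure_distr) (auto simp: vimage_def add.commute)
  finally show ?thesis ..
qed

text \<open>Rotation by the angle \<open>a\<close> translates the parameter interval; the part that leaves \<open>{0..<2 *
pi}\<close> is moved back by a period.\<close>

lemma haar_circle_rotation:
  assumes "norm u = 1"
  shows "distr haar_circle borel (\<lambda>z. u * z) = haar_circle"
proof (rule measure_eqI)
  fix B assume "B \<in> sets (distr haar_circle borel (\<lambda>z. u * z))"
  then have B [measurable]: "B \<in> sets borel" by simp
  obtain a where a: "0 \<le> a" "a < 2 * pi" "u = cis a"
    using Arg2pi_ge_0[of u] Arg2pi_lt_2pi[of u] Arg2pi_eq[of u] assms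
    by (intro that[of "Arg2pi u"]) (simp_all add: cis_conv_exp)
  define E where "E = {t. cis t \<in> B}"
  have E [measurable]: "E \<in> sets borel" unfolding E_def by measurable
  have per: "t + 2 * pi \<in> E \<longleftrightarrow> t \<in> E" for t by (simp add: E_def flip: cis_mult)
  have "{t \<in> {0..<2*pi}. t + a \<in> E} = {t. t + a \<in> {a..<2*pi} \<inter> E} \<union> {t. t + (a - 2*pi) \<in> {0..<a} \<inter> E}"
    (is "?L = ?P \<union> ?Q")
    using a per[of "_ + (a - 2*pi)"] by (auto simp: algebra_simps)
  moreover have "?P \<inter> ?Q = {}" by auto
  moreover have [measurable]: "?P \<in> sets borel" "?Q \<in> sets borel" by measurable
  ultimately have "emeasure lborel ?L = emeasure lborel ?P + emeasure lborel ?Q"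
    by (simp add: plus_emeasure)
  also have "\<dots> = emeasure lborel ({a..<2*pi} \<inter> E) + emeasure lborel ({0..<a} \<inter> E)"
    by (intro arg_cong2[of _ _ _ _ "(+)"] emeasure_lborel_shift) measurable
  also have "\<dots> = emeasure lborel (({a..<2*pi} \<inter> E) \<union> ({0..<a} \<inter> E))"
    by (intro plus_emeasure) auto
  also have "({a..<2*pi} \<inter> E) \<union> ({0..<a} \<inter> E) = {t \<in> {0..<2*pi}. t \<in> E}" using a by auto
  finally have *: "emeasure lborel {t \<in> {0..<2*pi}. t + a \<in> E} = emeasure lborel {t \<in> {0..<2*pi}. t \<in> E}" .
  have "emeasure (distr haar_circle borel (\<lambda>z. u * z)) B = emeasure haar_circle {z. u * z \<in> B}"
    by (subst emeasure_distr) (auto simp: vimage_def)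
  also have "\<dots> = emeasure lborel {t \<in> {0..<2*pi}. u * cis t \<in> B} / ennreal (2 * pi)"
    by (subst emeasure_haar_circle) auto
  also have "{t \<in> {0..<2*pi}. u * cis t \<in> B} = {t \<in> {0..<2*pi}. t + a \<in> E}"
    by (simp add: E_def a cis_mult add.commute)
  also have "emeasure lborel \<dots> / ennreal (2 * pi) = emeasure haar_circle B"
    unfolding * by (subst emeasure_haar_circle) (auto simp: E_def)
  finally show "emeasure (distr haar_circle borel (\<lambda>z. u * z)) B = emeasure haar_circle B" .
qed simp

lemma AE_circle_measure:
  assumes "AE z in haar_circle. P z"
  shows "AE z in circle_measure. P z"
proof -
  let ?M = "distr (restrict_space lborel {0..<2 * pi}) (restrict_space borel (sphere 0 1)) cis"
  have m: "cis \<in> restrict_space lborel {0..<2 * pi} \<rightarrow>\<^sub>M restrict_space borel (sphere 0 1)"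
    by (intro measurable_restrict_space3) auto
  obtain N where N: "N \<in> null_sets haar_circle" "{z. \<not> P z} \<subseteq> N"
    using assms by (auto simp: eventually_ae_filter)
  have Nb [measurable]: "N \<in> sets borel" using N(1) by auto
  have "emeasure lborel {t \<in> {0..<2 * pi}. cis t \<in> N} / ennreal (2 * pi) = 0"
    using null_setsD1[OF N(1)] unfolding emeasure_haar_circle[OF Nb] .
  then have 0: "emeasure lborel {t \<in> {0..<2 * pi}. cis t \<in> N} = 0"
    by (simp add: ennreal_divide_eq_0_iff)
  have sp: "N \<inter> sphere 0 1 \<in> sets (restrict_space borel (sphere 0 1))"
    by (auto simp: sets_restrict_space)
  have "emeasure ?M (N \<inter> sphere 0 1) = emeasure (restrict_space lborel {0..<2 * pi}) {t \<in> {0..<2 * pi}. cis t \<in> N}"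
    by (subst emeasure_distr[OF m sp]) (auto simp: space_restrict_space intro!: arg_cong2[where f = emeasure])
  also have "\<dots> = 0" using 0 by (subst emeasure_restrict_space) auto
  finally have "N \<inter> sphere 0 1 \<in> null_sets ?M" using sp by auto
  then have "AE z in ?M. P z"
    by (rule AE_I'[of "N \<inter> sphere 0 1"]) (use N(2) in \<open>auto simp: space_restrict_space\<close>)
  then show ?thesis unfolding circle_measure_def by (rule AE_completion)
qed

text \<open>Targets are Lebesgue measurable on the circle; changing them on a null set makes them Borel
functions on the plane.\<close>

lemma circle_measurable_borel_version:
  assumes "\<psi> \<in> borel_measurable circle_measure"
  obtains \<psi>' :: "complex \<Rightarrow> complex" where "\<psi>' \<in> borel_measurable borel" "AE z in circle_measure. \<psi> z = \<psi>' z"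
proof -
  let ?R = "restrict_space borel (sphere (0::complex) 1)"
  let ?M = "distr (restrict_space lborel {0..<2 * pi}) ?R cis"
  have real_version: "\<exists>h \<in> borel_measurable borel. AE z in circle_measure. g z = h z"
    if "g \<in> borel_measurable circle_measure" for g :: "complex \<Rightarrow> real"
  proof -
    from that have "g \<in> borel_measurable (completion ?M)" unfolding circle_measure_def .
    from completion_ex_borel_measurable_real[OF this]
    obtain g' where g': "g' \<in> borel_measurable ?M" "AE z in ?M. g z = g' z" by blast
    have "g' \<in> borel_measurable ?R" using g'(1) by simp
    then have h: "(\<lambda>x. indicator (sphere 0 1) x *\<^sub>R g' x) \<in> borel_measurable borel"
      by (subst (asm) borel_measurable_restrict_space_iff) auto
    have "AE z in circle_measure. g z = g' z"
      unfolding circle_measure_def by (rule AE_completion[OF g'(2)])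
    moreover have "AE z in circle_measure. z \<in> sphere 0 1"
      by (rule AE_I2) (simp add: space_circle_measure)
    ultimately have "AE z in circle_measure. g z = indicator (sphere 0 1) z *\<^sub>R g' z"
      by eventually_elim auto
    then show ?thesis by (rule bexI[OF _ h])
  qed
  obtain f where f [measurable]: "f \<in> borel_measurable borel" "AE z in circle_measure. Re (\<psi> z) = f z"
    using real_version[OF measurable_compose[OF assms borel_measurable_Re]] by blast
  obtain g where g [measurable]: "g \<in> borel_measurable borel" "AE z in circle_measure. Im (\<psi> z) = g z"
    using real_version[OF measurable_compose[OF assms borel_measurable_Im]] by blast
  show ?thesis
  proof
    show "(\<lambda>z. complex_of_real (f z) + \<i> * complex_of_real (g z)) \<in> borel_measurable borel"
      by measurable
    show "AE z in circle_measure. \<psi> z = complex_of_real (f z) + \<i> * complex_of_real (g z)"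
      using f(2) g(2) by eventually_elim (simp add: complex_eq_iff)
  qed
qed

lemma integrable_haar_circle:
  fixes g :: "complex \<Rightarrow> real"
  assumes [measurable]: "g \<in> borel_measurable borel" and "\<And>z. norm z = 1 \<Longrightarrow> \<bar>g z\<bar> \<le> B"
  shows "integrable haar_circle g"
proof -
  interpret prob_space haar_circle by (rule prob_space_haar_circle)
  have "AE z in haar_circle. norm (g z) \<le> B"
    using AE_haar_circle_norm by eventually_elim (use assms(2) in auto)
  then show ?thesis by (intro integrable_const_bound) auto
qed

lemma integral_haar_circle_rotation:
  fixes g :: "complex \<Rightarrow> real"
  assumes [measurable]: "g \<in> borel_measurable borel" and "norm u = 1"
  shows "(\<integral>z. g (u * z) \<partial>haar_circle) = (\<integral>z. g z \<partial>haar_circle)"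
  by (subst (2) haar_circle_rotation[OF assms(2), symmetric]) (subst integral_distr, auto)

text \<open>Rotation invariance gives the first moments, by the rotation \<open>-1\<close>, and the equality of the
two second moments, by the rotation \<open>\<i>\<close>; these add up to \<open>1\<close>.\<close>

lemma haar_circle_moments:
  shows "(\<integral>z. Re z \<partial>haar_circle) = 0" "(\<integral>z. Im z \<partial>haar_circle) = 0"
    and "(\<integral>z. (Re z)\<^sup>2 \<partial>haar_circle) = 1/2" "(\<integral>z. (Im z)\<^sup>2 \<partial>haar_circle) = 1/2"
proof -
  interpret prob_space haar_circle by (rule prob_space_haar_circle)
  show "(\<integral>z. Re z \<partial>haar_circle) = 0"
    using integral_haar_circle_rotation[of Re "-1"] by simp
  show "(\<integral>z. Im z \<partial>haar_circle) = 0"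
    using integral_haar_circle_rotation[of Im "-1"] by simp
  have eq: "(\<integral>z. (Re z)\<^sup>2 \<partial>haar_circle) = (\<integral>z. (Im z)\<^sup>2 \<partial>haar_circle)"
    using integral_haar_circle_rotation[of "\<lambda>z. (Re z)\<^sup>2" "\<i>"] by simp
  have int: "integrable haar_circle (\<lambda>z. (Re z)\<^sup>2)" "integrable haar_circle (\<lambda>z. (Im z)\<^sup>2)"
    by (auto intro!: integrable_haar_circle[of _ 1] simp: abs_square_le_1) (metis abs_Re_le_cmod, metis abs_Im_le_cmod)
  have "(\<integral>z. (Re z)\<^sup>2 \<partial>haar_circle) + (\<integral>z. (Im z)\<^sup>2 \<partial>haar_circle) = (\<integral>z. (Re z)\<^sup>2 + (Im z)\<^sup>2 \<partial>haar_circle)"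
    using int by simp
  also have "\<dots> = (\<integral>z. 1 \<partial>haar_circle)"
  proof (intro integral_cong_AE)
    show "AE z in haar_circle. (Re z)\<^sup>2 + (Im z)\<^sup>2 = 1"
      using AE_haar_circle_norm by eventually_elim (simp flip: cmod_power2)
  qed auto
  also have "\<dots> = 1" using prob_space by simp
  finally show "(\<integral>z. (Re z)\<^sup>2 \<partial>haar_circle) = 1/2" "(\<integral>z. (Im z)\<^sup>2 \<partial>haar_circle) = 1/2"
    using eq by auto
qed

text \<open>The law of a sequence of independent random variables that are uniform on the unit circle,
known as Steinhaus variables.\<close>

definition steinhaus :: "(nat \<Rightarrow> complex) measure" where
  "steinhaus = PiM UNIV (\<lambda>_. haar_circle)"

lemma prob_space_steinhaus: "prob_space steinhaus"
  unfolding steinhaus_def by (intro prob_space_PiM prob_space_haar_circle)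

lemma space_steinhaus [simp]: "space steinhaus = UNIV"
  by (simp add: steinhaus_def space_PiM)

lemma measurable_steinhaus_component [measurable]: "(\<lambda>\<omega>. \<omega> i) \<in> borel_measurable steinhaus"
proof -
  have "(\<lambda>\<omega>. \<omega> i) \<in> PiM UNIV (\<lambda>_. haar_circle) \<rightarrow>\<^sub>M haar_circle"
    by (rule measurable_component_singleton) simp
  then show ?thesis by (simp add: steinhaus_def measurable_cong_sets[OF refl sets_haar_circle])
qed

lemma distr_steinhaus_component: "distr steinhaus borel (\<lambda>\<omega>. \<omega> i) = haar_circle"
  using distr_PiM_component[of UNIV "\<lambda>_. haar_circle" i] prob_space_haar_circle
  by (simp add: steinhaus_def cong: distr_cong)

lemma AE_steinhaus_norm: "AE \<omega> in steinhaus. \<forall>i. norm (\<omega> i) = 1"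
  unfolding AE_all_countable steinhaus_def
  by (intro allI AE_PiM_component prob_space_haar_circle AE_haar_circle_norm) auto

lemma indep_steinhaus: "prob_space.indep_vars steinhaus (\<lambda>_. haar_circle) (\<lambda>i \<omega>. \<omega> i) UNIV"
proof -
  interpret prob_space steinhaus by (rule prob_space_steinhaus)
  have m: "(\<lambda>\<omega>. \<omega> i) \<in> steinhaus \<rightarrow>\<^sub>M haar_circle" for i by simp
  have "distr steinhaus haar_circle (\<lambda>\<omega>. \<omega> i) = haar_circle" for i
    using distr_steinhaus_component[of i] by (simp cong: distr_cong)
  then show ?thesis
    by (subst indep_vars_iff_distr_eq_PiM) (auto simp: steinhaus_def[symmetric] restrict_UNIV distr_id2)
qed

text \<open>This invariance is what makes the random polynomials below look alike at all points \<open>z\<close> of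
the circle: the powers of \<open>z\<close> are absorbed by the random coefficients.\<close>

lemma steinhaus_rotation:
  assumes u: "\<And>j. norm (u j) = 1"
  shows "distr steinhaus steinhaus (\<lambda>\<omega> j. u j * \<omega> j) = steinhaus"
proof -
  interpret prob_space steinhaus by (rule prob_space_steinhaus)
  have m: "(\<lambda>\<omega>. u i * \<omega> i) \<in> steinhaus \<rightarrow>\<^sub>M haar_circle" for i by simp
  have d: "distr steinhaus haar_circle (\<lambda>\<omega>. u i * \<omega> i) = haar_circle" for i
  proof -
    have "distr steinhaus haar_circle (\<lambda>\<omega>. u i * \<omega> i) = distr (distr steinhaus borel (\<lambda>\<omega>. \<omega> i)) borel (\<lambda>z. u i * z)"
      by (subst distr_distr) (auto simp: comp_def cong: distr_cong)
    then show ?thesis by (simp add: distr_steinhaus_component haar_circle_rotation u)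
  qed
  have "indep_vars (\<lambda>_. haar_circle) (\<lambda>i \<omega>. u i * \<omega> i) UNIV"
    by (rule indep_vars_compose2[OF indep_steinhaus, of "\<lambda>i z. u i * z"]) simp
  then show ?thesis
    by (subst (asm) indep_vars_iff_distr_eq_PiM) (auto simp: d steinhaus_def[symmetric] restrict_UNIV)
qed

text \<open>The real and imaginary parts of the variables are independent, centred, and have variance
\<open>1/2\<close>.\<close>

lemma steinhaus_clt:
  assumes h: "h = Re \<or> h = Im"
  shows "weak_conv_m (\<lambda>n. distr steinhaus borel (\<lambda>\<omega>. (\<Sum>i<n. h (\<omega> i)) / sqrt (n * (sqrt (1/2))\<^sup>2))) std_normal_distribution"
proof -
  interpret prob_space steinhaus by (rule prob_space_steinhaus)
  have hm [measurable]: "h \<in> borel_measurable borel" using h by auto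
  then have hm' [measurable]: "h \<in> borel_measurable haar_circle"
    by (simp add: measurable_cong_sets[OF sets_haar_circle refl])
  have le: "\<bar>h z\<bar> \<le> norm z" for z using h abs_Re_le_cmod abs_Im_le_cmod by auto
  have int: "(\<integral>\<omega>. g (\<omega> i) \<partial>steinhaus) = (\<integral>z. g z \<partial>haar_circle)"
    if [measurable]: "g \<in> borel_measurable borel" for g :: "complex \<Rightarrow> real" and i
    by (subst distr_steinhaus_component[of i, symmetric]) (simp add: integral_distr)
  have m1: "(\<integral>\<omega>. h (\<omega> i) \<partial>steinhaus) = 0" for i
    using int[of h i] h haar_circle_moments by auto
  have m2: "(\<integral>\<omega>. (h (\<omega> i))\<^sup>2 \<partial>steinhaus) = 1/2" for i
    using int[of "\<lambda>z. (h z)\<^sup>2" i] h haar_circle_moments by auto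
  show ?thesis
  proof (rule central_limit_theorem_zero_mean)
    show "indep_vars (\<lambda>i. borel) (\<lambda>i \<omega>. h (\<omega> i)) UNIV"
      by (rule indep_vars_compose2[OF indep_steinhaus]) (rule hm')
    show "integrable steinhaus (\<lambda>x. (h (x n))\<^sup>2)" for n
    proof (rule integrable_const_bound[of _ 1])
      show "AE x in steinhaus. norm ((h (x n))\<^sup>2) \<le> 1"
        using AE_steinhaus_norm
          by eventually_elim (use le in \<open>metis abs_square_le_1 power_abs real_norm_def abs_power2\<close>)
    qed simp
    show "variance (\<lambda>\<omega>. h (\<omega> n)) = (sqrt (1/2))\<^sup>2" for n by (simp add: m1 m2)
    show "distr steinhaus borel (\<lambda>\<omega>. h (\<omega> n)) = distr haar_circle borel h" for n
    proof -
      have "distr (distr steinhaus borel (\<lambda>\<omega>. \<omega> n)) borel h = distr steinhaus borel (h \<circ> (\<lambda>\<omega>. \<omega> n))"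
        by (rule distr_distr) simp_all
      then show ?thesis by (simp add: distr_steinhaus_component comp_def)
    qed
  qed (auto simp: m1)
qed

section \<open>Polynomials of small norm close to one\<close>

text \<open>A compact set that avoids the origin without separating it from infinity, and that a
Gaussian random variable hits with probability close to \<open>1\<close> if \<open>\<kappa>\<close> is small and \<open>R\<close> is large.\<close>

definition off_strip :: "real \<Rightarrow> real \<Rightarrow> complex set" where
  "off_strip \<kappa> R = {w. \<kappa> \<le> \<bar>Re w\<bar> \<and> \<bar>Re w\<bar> \<le> R \<and> \<bar>Im w\<bar> \<le> R}"

lemma sets_off_strip [measurable]: "off_strip \<kappa> R \<in> sets borel"
  unfolding off_strip_def by measurable

lemma isCont_cdf_std_normal: "isCont (cdf std_normal_distribution) x"
proof -
  interpret N: real_distribution std_normal_distribution by (rule real_dist_normal_dist)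
  have "emeasure std_normal_distribution {x} = 0"
    by (subst emeasure_density) (auto intro!: nn_integral_null_set)
  then show ?thesis unfolding N.isCont_cdf by (simp add: measure_def)
qed

text \<open>The bounded quantity dominates the probability that a normal variable has modulus less than
\<open>\<kappa>\<close> or greater than \<open>R\<close>. It is written with the distribution function because weak convergence
gives the convergence of precisely these values.\<close>

lemma std_normal_concentration:
  assumes "\<epsilon> > 0"
  obtains \<kappa> R where "\<kappa> > 0" "R > 0"
    "cdf std_normal_distribution \<kappa> - cdf std_normal_distribution (- \<kappa>)
       + cdf std_normal_distribution (- R) + (1 - cdf std_normal_distribution R) < \<epsilon>"
proof -
  interpret N: real_distribution std_normal_distribution by (rule real_dist_normal_dist)
  let ?F = "cdf std_normal_distribution"
  have "((\<lambda>\<kappa>. ?F \<kappa> - ?F (- \<kappa>)) \<longlongrightarrow> ?F 0 - ?F (- 0)) (at_right 0)"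
    by (intro tendsto_intros isCont_tendsto_compose[OF isCont_cdf_std_normal])
  then have "\<forall>\<^sub>F \<kappa> in at_right 0. ?F \<kappa> - ?F (- \<kappa>) < \<epsilon> / 2"
    using assms by (intro order_tendstoD) auto
  moreover have "\<forall>\<^sub>F \<kappa> in at_right 0. (0::real) < \<kappa>" by (simp add: eventually_at_right_less)
  ultimately have "\<forall>\<^sub>F \<kappa> in at_right 0. 0 < \<kappa> \<and> ?F \<kappa> - ?F (- \<kappa>) < \<epsilon> / 2"
    by eventually_elim simp
  then obtain \<kappa> where \<kappa>: "\<kappa> > 0" "?F \<kappa> - ?F (- \<kappa>) < \<epsilon> / 2"
    using eventually_happens'[of "at_right (0::real)"] by auto
  have "((\<lambda>R. ?F (- R) + (1 - ?F R)) \<longlongrightarrow> 0 + (1 - 1)) at_top"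
    by (intro tendsto_intros filterlim_compose[OF N.cdf_lim_at_bot] N.cdf_lim_at_top_prob filterlim_uminus_at_bot_at_top)
  then have "\<forall>\<^sub>F R in at_top. ?F (- R) + (1 - ?F R) < \<epsilon> / 2"
    using assms by (intro order_tendstoD) auto
  moreover have "\<forall>\<^sub>F R in at_top. (0::real) < R" by (rule eventually_gt_at_top)
  ultimately have "\<forall>\<^sub>F R in at_top. 0 < R \<and> ?F (- R) + (1 - ?F R) < \<epsilon> / 2"
    by eventually_elim simp
  then obtain R where "R > 0" "?F (- R) + (1 - ?F R) < \<epsilon> / 2"
    using eventually_happens'[of "at_top :: real filter"] by auto
  with \<kappa> show ?thesis by (intro that[of \<kappa> R]) auto
qed

lemma steinhaus_sum_concentration:
  assumes h: "h = Re \<or> h = Im" and "\<epsilon> > 0"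
  obtains \<kappa> R where "\<kappa> > 0" "R > 0"
    "\<forall>\<^sub>F n in sequentially. measure steinhaus
       {\<omega>. \<not> (\<kappa> \<le> \<bar>h (\<Sum>i<n. \<omega> i) * sqrt (2 / n)\<bar> \<and> \<bar>h (\<Sum>i<n. \<omega> i) * sqrt (2 / n)\<bar> \<le> R)} < \<epsilon>"
proof -
  interpret prob_space steinhaus by (rule prob_space_steinhaus)
  obtain \<kappa> R where kR: "\<kappa> > 0" "R > 0"
    "cdf std_normal_distribution \<kappa> - cdf std_normal_distribution (- \<kappa>)
       + cdf std_normal_distribution (- R) + (1 - cdf std_normal_distribution R) < \<epsilon>"
    using std_normal_concentration[OF \<open>\<epsilon> > 0\<close>] by blast
  have [measurable]: "h \<in> borel_measurable borel" using h by auto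
  define S where "S n \<omega> = h (\<Sum>i<n. \<omega> i) * sqrt (2 / n)" for n and \<omega> :: "nat \<Rightarrow> complex"
  have S: "S n \<omega> = (\<Sum>i<n. h (\<omega> i)) / sqrt (n * (sqrt (1/2))\<^sup>2)" for n \<omega>
  proof -
    have "(sqrt (1/2))\<^sup>2 = (1/2::real)" by (rule real_sqrt_pow2) simp
    moreover have "sqrt (2 / n) = 1 / sqrt (n * (1/2))" by (simp add: real_sqrt_divide)
    moreover have "h (\<Sum>i<n. \<omega> i) = (\<Sum>i<n. h (\<omega> i))" using h by auto
    ultimately show ?thesis by (simp only: S_def times_divide_eq_right mult_1_right)
  qed
  have [measurable]: "S n \<in> borel_measurable steinhaus" for n
    unfolding S_def by measurable
  define F where "F n = cdf (distr steinhaus borel (S n))" for n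
  have F: "(\<lambda>n. F n x) \<longlonglongrightarrow> cdf std_normal_distribution x" for x
    using steinhaus_clt[OF h] isCont_cdf_std_normal
    unfolding weak_conv_m_def weak_conv_def F_def by (simp add: S[abs_def])
  have "(\<lambda>n. F n \<kappa> - F n (- \<kappa>) + F n (- R) + (1 - F n R)) \<longlonglongrightarrow>
     cdf std_normal_distribution \<kappa> - cdf std_normal_distribution (- \<kappa>)
       + cdf std_normal_distribution (- R) + (1 - cdf std_normal_distribution R)"
    by (intro tendsto_intros F)
  then have "\<forall>\<^sub>F n in sequentially. F n \<kappa> - F n (- \<kappa>) + F n (- R) + (1 - F n R) < \<epsilon>"
    using kR by (intro order_tendstoD) auto
  then have "\<forall>\<^sub>F n in sequentially. measure steinhaus {\<omega>. \<not> (\<kappa> \<le> \<bar>S n \<omega>\<bar> \<and> \<bar>S n \<omega>\<bar> \<le> R)} < \<epsilon>"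
  proof eventually_elim
    case (elim n)
    interpret D: real_distribution "distr steinhaus borel (S n)" by simp
    let ?D = "distr steinhaus borel (S n)"
    have "measure steinhaus {\<omega>. \<not> (\<kappa> \<le> \<bar>S n \<omega>\<bar> \<and> \<bar>S n \<omega>\<bar> \<le> R)}
       = measure ?D {x. \<not> (\<kappa> \<le> \<bar>x\<bar> \<and> \<bar>x\<bar> \<le> R)}"
      by (subst measure_distr) (auto intro!: arg_cong2[where f = measure])
    also have "\<dots> \<le> measure ?D (({-\<kappa><..\<kappa>} \<union> {..-R}) \<union> (UNIV - {..R}))"
      by (intro D.finite_measure_mono) auto
    also have "\<dots> \<le> measure ?D ({-\<kappa><..\<kappa>} \<union> {..-R}) + measure ?D (UNIV - {..R})"
      by (rule measure_Un_le) auto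
    also have "\<dots> \<le> measure ?D {-\<kappa><..\<kappa>} + measure ?D {..-R} + measure ?D (UNIV - {..R})"
      by (intro add_right_mono measure_Un_le) auto
    also have "measure ?D {-\<kappa><..\<kappa>} = F n \<kappa> - F n (- \<kappa>)"
      using D.cdf_diff_eq[of "-\<kappa>" \<kappa>] kR by (simp add: F_def)
    also have "measure ?D {..-R} = F n (- R)" by (simp add: F_def cdf_def)
    also have "measure ?D (UNIV - {..R}) = 1 - F n R"
      using D.prob_compl[of "{..R}"] by (simp add: F_def cdf_def)
    finally show ?case using elim by simp
  qed
  then show ?thesis using kR(1,2) by (intro that[of \<kappa> R]) (auto simp: S_def)
qed

text \<open>The estimate is uniform in the unimodular weights \<open>u\<close>, because they do not change the law of
the sum. The numbers \<open>\<kappa>\<close> and \<open>R\<close> depend on \<open>\<epsilon>\<close> only; the polynomial \<open>G\<close> with which the sum is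
composed can thus be fixed before the number of terms is chosen.\<close>

lemma steinhaus_sum_off_strip:
  assumes "\<epsilon> > 0"
  obtains \<kappa> R where "\<kappa> > 0"
    "\<forall>\<^sub>F n in sequentially. \<forall>u. (\<forall>j. norm (u j) = 1) \<longrightarrow>
       measure steinhaus {\<omega>. (\<Sum>i<n. u i * \<omega> i) * of_real (sqrt (2 / n)) \<notin> off_strip \<kappa> R} < \<epsilon>"
proof -
  interpret prob_space steinhaus by (rule prob_space_steinhaus)
  obtain \<kappa> R where 1: "\<kappa> > 0" "R > 0"
    "\<forall>\<^sub>F n in sequentially. measure steinhaus
       {\<omega>. \<not> (\<kappa> \<le> \<bar>Re (\<Sum>i<n. \<omega> i) * sqrt (2 / n)\<bar> \<and> \<bar>Re (\<Sum>i<n. \<omega> i) * sqrt (2 / n)\<bar> \<le> R)} < \<epsilon> / 2"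
    using steinhaus_sum_concentration[of Re "\<epsilon>/2"] assms by auto
  obtain \<kappa>' R' where 2: "\<kappa>' > 0" "R' > 0"
    "\<forall>\<^sub>F n in sequentially. measure steinhaus
       {\<omega>. \<not> (\<kappa>' \<le> \<bar>Im (\<Sum>i<n. \<omega> i) * sqrt (2 / n)\<bar> \<and> \<bar>Im (\<Sum>i<n. \<omega> i) * sqrt (2 / n)\<bar> \<le> R')} < \<epsilon> / 2"
    using steinhaus_sum_concentration[of Im "\<epsilon>/2"] assms by auto
  show ?thesis
  proof
    show "\<kappa> > 0" by fact
    show "\<forall>\<^sub>F n in sequentially. \<forall>u. (\<forall>j. norm (u j) = 1) \<longrightarrow>
       measure steinhaus {\<omega>. (\<Sum>i<n. u i * \<omega> i) * of_real (sqrt (2 / n)) \<notin> off_strip \<kappa> (max R R')} < \<epsilon>"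
      using 1(3) 2(3)
    proof eventually_elim
      case (elim n)
      let ?X = "\<lambda>\<omega>. (\<Sum>i<n. \<omega> i) * complex_of_real (sqrt (2 / n))"
      let ?A = "{\<omega>. \<not> (\<kappa> \<le> \<bar>Re (\<Sum>i<n. \<omega> i) * sqrt (2 / n)\<bar> \<and> \<bar>Re (\<Sum>i<n. \<omega> i) * sqrt (2 / n)\<bar> \<le> R)}"
      let ?B = "{\<omega>. \<not> (\<kappa>' \<le> \<bar>Im (\<Sum>i<n. \<omega> i) * sqrt (2 / n)\<bar> \<and> \<bar>Im (\<Sum>i<n. \<omega> i) * sqrt (2 / n)\<bar> \<le> R')}"
      have "{\<omega> \<in> space steinhaus. ?X \<omega> \<notin> off_strip \<kappa> (max R R')} \<in> sets steinhaus" by measurable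
      then have C: "{\<omega>. ?X \<omega> \<notin> off_strip \<kappa> (max R R')} \<in> sets steinhaus" by simp
      have "{\<omega> \<in> space steinhaus. \<omega> \<in> ?A} \<in> sets steinhaus" "{\<omega> \<in> space steinhaus. \<omega> \<in> ?B} \<in> sets steinhaus"
        unfolding mem_Collect_eq by measurable
      then have AB: "?A \<in> sets steinhaus" "?B \<in> sets steinhaus" by simp_all
      have sub: "{\<omega>. ?X \<omega> \<notin> off_strip \<kappa> (max R R')} \<subseteq> ?A \<union> ?B"
        by (auto simp: off_strip_def simp del: of_real_divide Re_sum Im_sum)
      have "measure steinhaus {\<omega>. ?X \<omega> \<notin> off_strip \<kappa> (max R R')} \<le> measure steinhaus (?A \<union> ?B)"
        by (rule finite_measure_mono[OF sub]) (use AB in auto)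
      also have "\<dots> \<le> measure steinhaus ?A + measure steinhaus ?B"
        using AB by (rule measure_Un_le)
      also have "\<dots> < \<epsilon>" using elim by linarith
      finally have lt: "measure steinhaus {\<omega>. ?X \<omega> \<notin> off_strip \<kappa> (max R R')} < \<epsilon>" .
      show ?case
      proof (intro allI impI)
        fix u :: "nat \<Rightarrow> complex" assume u: "\<forall>j. norm (u j) = 1"
        have m: "(\<lambda>\<omega> j. u j * \<omega> j) \<in> steinhaus \<rightarrow>\<^sub>M steinhaus"
          unfolding steinhaus_def
          by (rule measurable_PiM_single') (auto simp flip: steinhaus_def)
        have "measure steinhaus {\<omega>. ?X \<omega> \<notin> off_strip \<kappa> (max R R')}
            = measure (distr steinhaus steinhaus (\<lambda>\<omega> j. u j * \<omega> j)) {\<omega>. ?X \<omega> \<notin> off_strip \<kappa> (max R R')}"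
          by (subst steinhaus_rotation) (use u in auto)
        also have "\<dots> = measure steinhaus {\<omega>. ?X (\<lambda>j. u j * \<omega> j) \<notin> off_strip \<kappa> (max R R')}"
          by (subst measure_distr[OF m C]) (simp add: vimage_def)
        finally show "measure steinhaus
          {\<omega>. (\<Sum>i<n. u i * \<omega> i) * of_real (sqrt (2 / n)) \<notin> off_strip \<kappa> (max R R')} < \<epsilon>"
          using lt by simp
      qed
    qed
  qed
qed

lemma poly_lacunary_poly: "poly (lacunary_poly m c N) z = (\<Sum>j<N. z ^ ((m + 1) ^ j) * c j)"
  by (simp add: lacunary_poly_def poly_sum poly_monom mult.commute)

text \<open>For every point of the circle, the random polynomial takes a value outside \<open>off_strip \<kappa> R\<close>
with small probability. By Fubini, the exceptional set on the circle is small on average over the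
random coefficients, and hence small for some choice of them.\<close>

lemma lacunary_poly_off_strip:
  assumes "\<epsilon> > 0"
  obtains \<kappa> R where "\<kappa> > 0"
    "\<And>m. \<forall>\<^sub>F n in sequentially. \<exists>c. (\<forall>j. norm (c j) = 1) \<and>
       measure haar_circle {z. poly (smult (of_real (sqrt (2 / n))) (lacunary_poly m c n)) z \<notin> off_strip \<kappa> R} < \<epsilon>"
proof -
  interpret St: prob_space steinhaus by (rule prob_space_steinhaus)
  interpret Ha: prob_space haar_circle by (rule prob_space_haar_circle)
  interpret P: pair_sigma_finite steinhaus haar_circle ..
  obtain \<kappa> R where kR: "\<kappa> > 0"
    "\<forall>\<^sub>F n in sequentially. \<forall>u. (\<forall>j. norm (u j) = 1) \<longrightarrow>
       measure steinhaus {\<omega>. (\<Sum>i<n. u i * \<omega> i) * of_real (sqrt (2 / n)) \<notin> off_strip \<kappa> R} < \<epsilon> / 2"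
    using steinhaus_sum_off_strip[of "\<epsilon>/2"] assms by auto
  have "\<forall>\<^sub>F n in sequentially. \<exists>c. (\<forall>j. norm (c j) = 1) \<and>
       measure haar_circle {z. poly (smult (of_real (sqrt (2 / n))) (lacunary_poly m c n)) z \<notin> off_strip \<kappa> R} < \<epsilon>" for m
    using kR(2)
  proof eventually_elim
    case (elim n)
    let ?Y = "\<lambda>\<omega> z. (\<Sum>j<n. z ^ ((m + 1) ^ j) * \<omega> j) * complex_of_real (sqrt (2 / n))"
    define f where "f \<omega> z = (indicator (- off_strip \<kappa> R) (?Y \<omega> z) :: ennreal)" for \<omega> z
    have [measurable]: "(\<lambda>(\<omega>, z). f \<omega> z) \<in> borel_measurable (steinhaus \<Otimes>\<^sub>M haar_circle)"
      unfolding f_def by measurable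
    have slice: "(\<integral>\<^sup>+z. f \<omega> z \<partial>haar_circle) = ennreal (measure haar_circle {z. ?Y \<omega> z \<notin> off_strip \<kappa> R})" for \<omega>
    proof -
      have "(\<integral>\<^sup>+z. f \<omega> z \<partial>haar_circle) = (\<integral>\<^sup>+z. indicator {z. ?Y \<omega> z \<notin> off_strip \<kappa> R} z \<partial>haar_circle)"
        by (intro nn_integral_cong) (simp add: f_def indicator_def)
      also have "\<dots> = emeasure haar_circle {z. ?Y \<omega> z \<notin> off_strip \<kappa> R}"
        by (intro nn_integral_indicator) simp
      finally show ?thesis by (simp add: Ha.emeasure_eq_measure)
    qed
    have slice': "(\<integral>\<^sup>+\<omega>. f \<omega> z \<partial>steinhaus) \<le> ennreal (\<epsilon> / 2)" if z: "norm z = 1" for z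
    proof -
      have "{\<omega> \<in> space steinhaus. ?Y \<omega> z \<notin> off_strip \<kappa> R} \<in> sets steinhaus" by measurable
      then have s: "{\<omega>. ?Y \<omega> z \<notin> off_strip \<kappa> R} \<in> sets steinhaus" by simp
      have "(\<integral>\<^sup>+\<omega>. f \<omega> z \<partial>steinhaus) = (\<integral>\<^sup>+\<omega>. indicator {\<omega>. ?Y \<omega> z \<notin> off_strip \<kappa> R} \<omega> \<partial>steinhaus)"
        by (intro nn_integral_cong) (simp add: f_def indicator_def)
      also have "\<dots> = ennreal (measure steinhaus {\<omega>. ?Y \<omega> z \<notin> off_strip \<kappa> R})"
        by (subst nn_integral_indicator[OF s]) (simp add: St.emeasure_eq_measure)
      also have "\<dots> \<le> ennreal (\<epsilon> / 2)"
        using elim[rule_format, of "\<lambda>j. z ^ ((m + 1) ^ j)"] z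
        by (intro ennreal_leI) (simp add: norm_power)
      finally show ?thesis .
    qed
    have "(\<integral>\<^sup>+\<omega>. (\<integral>\<^sup>+z. f \<omega> z \<partial>haar_circle) \<partial>steinhaus) = (\<integral>\<^sup>+z. (\<integral>\<^sup>+\<omega>. f \<omega> z \<partial>steinhaus) \<partial>haar_circle)"
      by (rule P.Fubini'[symmetric]) simp
    also have "\<dots> \<le> (\<integral>\<^sup>+z. ennreal (\<epsilon> / 2) \<partial>haar_circle)"
    proof (rule nn_integral_mono_AE)
      show "AE z in haar_circle. (\<integral>\<^sup>+\<omega>. f \<omega> z \<partial>steinhaus) \<le> ennreal (\<epsilon> / 2)"
        using AE_haar_circle_norm by eventually_elim (rule slice')
    qed
    also have "\<dots> = ennreal (\<epsilon> / 2)" using Ha.emeasure_space_1 by simp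
    finally have avg: "(\<integral>\<^sup>+\<omega>. (\<integral>\<^sup>+z. f \<omega> z \<partial>haar_circle) \<partial>steinhaus) \<le> ennreal (\<epsilon> / 2)" .
    have "\<exists>c. (\<forall>j. norm (c j) = 1) \<and> measure haar_circle {z. ?Y c z \<notin> off_strip \<kappa> R} < \<epsilon>"
    proof (rule ccontr)
      assume no: "\<not> ?thesis"
      have "AE \<omega> in steinhaus. ennreal \<epsilon> \<le> (\<integral>\<^sup>+z. f \<omega> z \<partial>haar_circle)"
        using AE_steinhaus_norm
      proof eventually_elim
        case (elim \<omega>)
        then have "\<not> measure haar_circle {z. ?Y \<omega> z \<notin> off_strip \<kappa> R} < \<epsilon>" using no by blast
        then have "\<epsilon> \<le> measure haar_circle {z. ?Y \<omega> z \<notin> off_strip \<kappa> R}" by (rule leI)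
        then show ?case unfolding slice by (rule ennreal_leI)
      qed
      then have "(\<integral>\<^sup>+\<omega>. ennreal \<epsilon> \<partial>steinhaus) \<le> (\<integral>\<^sup>+\<omega>. (\<integral>\<^sup>+z. f \<omega> z \<partial>haar_circle) \<partial>steinhaus)"
        by (rule nn_integral_mono_AE)
      then have "ennreal \<epsilon> \<le> ennreal (\<epsilon> / 2)" using avg St.emeasure_space_1 by simp
      then show False using assms by simp
    qed
    then show ?case
      by (simp only: poly_smult poly_lacunary_poly mult.commute[of "complex_of_real _"])
  qed
  then show ?thesis using kR(1) by (intro that[of \<kappa> R]) auto
qed

text \<open>The polynomial is \<open>G(Y)\<close>, where \<open>Y\<close> is a normalised lacunary polynomial with values mostly
in \<open>off_strip \<kappa> R\<close>, and \<open>G\<close> vanishes at \<open>0\<close> and is nearly \<open>1\<close> there. As \<open>G\<close> has no constant term,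
\<open>G(Y)\<close> is a combination of powers \<open>Y ^ i\<close> with \<open>i \<ge> 1\<close>, all of which are flat when the number of
terms is large.\<close>

lemma (in orlicz) approximate_one:
  assumes small: "\<phi> \<in> o[at_right 0](\<lambda>t. t\<^sup>2)" and \<epsilon>: "\<epsilon> > 0"
  obtains P A where "lux_le \<epsilon> (coeff P)" "A \<in> sets borel" "measure haar_circle A < \<epsilon>"
    "\<And>z. z \<notin> A \<Longrightarrow> norm (poly P z - 1) \<le> \<epsilon>"
proof -
  obtain \<kappa> R where kR: "\<kappa> > 0"
    "\<And>m. \<forall>\<^sub>F n in sequentially. \<exists>c. (\<forall>j. norm (c j) = 1) \<and>
       measure haar_circle {z. poly (smult (of_real (sqrt (2 / n))) (lacunary_poly m c n)) z \<notin> off_strip \<kappa> R} < \<epsilon>"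
    using lacunary_poly_off_strip[OF \<epsilon>] by blast
  obtain G where G: "poly G 0 = 0"
    "\<And>w. \<kappa> \<le> \<bar>Re w\<bar> \<Longrightarrow> \<bar>Re w\<bar> \<le> R \<Longrightarrow> \<bar>Im w\<bar> \<le> R \<Longrightarrow> norm (poly G w - 1) \<le> \<epsilon>"
    using polynomial_one_off_strip[OF kR(1) \<epsilon>, of R] by blast
  define m where "m = degree G"
  define B where "B i = norm (coeff G i) + 1" for i
  have B: "B i > 0" for i by (simp add: B_def add_nonneg_pos)
  \<comment> \<open>The share \<open>\<epsilon>'\<close> allotted to each power: the powers contribute \<open>\<epsilon> / 2\<close> in total, the other half
    is the slack in \<open>lux_le_sum\<close>.\<close>
  define SB where "SB = (\<Sum>i<Suc m. B i)"
  have SB: "SB > 0" unfolding SB_def using B by (intro sum_pos) auto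
  define \<epsilon>' where "\<epsilon>' = \<epsilon> / (2 * SB)"
  have \<epsilon>': "\<epsilon>' > 0" using \<epsilon> SB by (simp add: \<epsilon>'_def)
  \<comment> \<open>\<open>M\<close> bounds the square sums of all the powers, whatever the number of terms is.\<close>
  define M where "M = (2::real) ^ m * fact m"
  have "M > 0" by (simp add: M_def)
  from lux_le_flat[OF small this \<epsilon>'] obtain \<delta> where \<delta>: "\<delta> > 0"
    "\<And>a. (\<And>k. norm (a k) \<le> \<delta>) \<Longrightarrow> (\<And>n. (\<Sum>k<n. (norm (a k))\<^sup>2) \<le> M) \<Longrightarrow> lux_le \<epsilon>' a" by blast
  have "(\<lambda>n. sqrt (2 / real n) * fact m) \<longlonglongrightarrow> sqrt 0 * fact m"
    by (intro tendsto_intros lim_const_over_n)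
  then have "\<forall>\<^sub>F n in sequentially. sqrt (2 / real n) * fact m < \<delta>"
    using \<delta>(1) by (intro order_tendstoD) auto
  \<comment> \<open>From two terms on, the normalising factor \<open>sqrt (2 / n)\<close> is at most \<open>1\<close>, and its powers are
    no larger than itself.\<close>
  moreover have "\<forall>\<^sub>F n in sequentially. 2 \<le> (n::nat)" by (rule eventually_ge_at_top)
  ultimately have "\<forall>\<^sub>F n in sequentially. 2 \<le> n \<and> sqrt (2 / real n) * fact m < \<delta> \<and> (\<exists>c. (\<forall>j. norm (c j) = 1) \<and>
       measure haar_circle {z. poly (smult (of_real (sqrt (2 / n))) (lacunary_poly m c n)) z \<notin> off_strip \<kappa> R} < \<epsilon>)"
    using kR(2)[of m] by eventually_elim auto
  then obtain n where "2 \<le> n \<and> sqrt (2 / real n) * fact m < \<delta> \<and> (\<exists>c. (\<forall>j. norm (c j) = 1) \<and>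
       measure haar_circle {z. poly (smult (of_real (sqrt (2 / n))) (lacunary_poly m c n)) z \<notin> off_strip \<kappa> R} < \<epsilon>)"
    using eventually_happens'[OF sequentially_bot] by blast
  then obtain c where n: "2 \<le> n" "sqrt (2 / real n) * fact m < \<delta>" and c: "\<And>j. norm (c j) = 1" and
    A: "measure haar_circle {z. poly (smult (of_real (sqrt (2 / n))) (lacunary_poly m c n)) z \<notin> off_strip \<kappa> R} < \<epsilon>"
    by blast
  define s where "s = sqrt (2 / real n)"
  have s: "0 \<le> s" "s \<le> 1" "s\<^sup>2 * n = 2" using n by (auto simp: s_def)
  define Y where "Y = smult (of_real s) (lacunary_poly m c n)"
  define P where "P = (\<Sum>i<Suc m. smult (coeff G i) (Y ^ i))"
  have PG: "poly P z = poly G (poly Y z)" for z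
    by (simp add: P_def poly_sum poly_altdef[of G] m_def lessThan_Suc_atMost del: sum.lessThan_Suc)
  have lux_Y: "lux_le \<epsilon>' (coeff (Y ^ i))" if i: "1 \<le> i" "i \<le> m" for i
  proof (rule \<delta>(2))
    let ?X = "lacunary_poly m c n"
    have Y: "norm (coeff (Y ^ i) k) = s ^ i * norm (coeff (?X ^ i) k)" for k
      using s by (simp add: Y_def smult_power norm_mult norm_power flip: of_real_power)
    have X: "norm (coeff (?X ^ i) k) \<le> fact i" "(\<Sum>k<N. (norm (coeff (?X ^ i) k))\<^sup>2) \<le> fact i * of_nat n ^ i" for k N
      using lacunary_power_bounds[of c i m n] c i by auto
    show "norm (coeff (Y ^ i) k) \<le> \<delta>" for k
    proof -
      have "s ^ i \<le> s ^ 1" using s i by (intro power_decreasing) auto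
      then have "s ^ i * norm (coeff (?X ^ i) k) \<le> s * fact m"
        using s i X(1)[of k] fact_mono[of i m, where 'a = real]
          by (intro mult_mono) (auto intro: order.trans)
      then show ?thesis unfolding Y using n(2) by (simp add: s_def)
    qed
    show "(\<Sum>k<N. (norm (coeff (Y ^ i) k))\<^sup>2) \<le> M" for N
    proof -
      have "(\<Sum>k<N. (norm (coeff (Y ^ i) k))\<^sup>2) = (s\<^sup>2) ^ i * (\<Sum>k<N. (norm (coeff (?X ^ i) k))\<^sup>2)"
        unfolding Y by (simp add: sum_distrib_left power2_eq_square power_mult_distrib mult_ac)
      also have "\<dots> \<le> (s\<^sup>2) ^ i * (fact i * of_nat n ^ i)"
        using X(2)[of N] s by (intro mult_left_mono) auto
      also have "\<dots> = (s\<^sup>2 * n) ^ i * fact i" by (simp add: power_mult_distrib)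
      also have "\<dots> \<le> M"
        unfolding s(3) M_def using i by (intro mult_mono power_increasing fact_mono) auto
      finally show ?thesis .
    qed
  qed
  have lux_term: "lux_le (B i * \<epsilon>') (\<lambda>k. coeff G i * coeff (Y ^ i) k)" if "i < Suc m" for i
  proof (cases i)
    case 0
    have "coeff G 0 = 0" using G(1) by (simp add: poly_0_coeff_0)
    then show ?thesis using 0 lux_le_zero[of "B i * \<epsilon>'"] B[of i] \<epsilon>' by simp
  next
    case (Suc j)
    then show ?thesis using that B[of i] by (intro lux_le_smult lux_Y) (auto simp: B_def)
  qed
  have "lux_le ((\<Sum>i<Suc m. B i * \<epsilon>') + \<epsilon> / 2) (\<lambda>k. \<Sum>i<Suc m. coeff G i * coeff (Y ^ i) k)"
  proof (rule lux_le_sum[where c = "\<lambda>i. B i * \<epsilon>'" and a = "\<lambda>i k. coeff G i * coeff (Y ^ i) k"])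
    show "lux_le (B i * \<epsilon>') (\<lambda>k. coeff G i * coeff (Y ^ i) k)" if "i < Suc m" for i
      using that by (rule lux_term)
  qed (use \<epsilon> in simp)
  moreover have "(\<Sum>i<Suc m. B i * \<epsilon>') + \<epsilon> / 2 = \<epsilon>"
    using SB unfolding sum_distrib_right[symmetric] SB_def[symmetric] by (simp add: \<epsilon>'_def)
  moreover have "(\<lambda>k. \<Sum>i<Suc m. coeff G i * coeff (Y ^ i) k) = coeff P"
    by (simp add: P_def coeff_sum fun_eq_iff)
  ultimately have "lux_le \<epsilon> (coeff P)" by simp
  moreover have "{z. poly Y z \<notin> off_strip \<kappa> R} \<in> sets borel"
  proof -
    have "poly Y \<in> borel_measurable borel"
      by (intro borel_measurable_continuous_onI continuous_on_poly continuous_on_id)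
    from measurable_sets_borel[OF this, of "- off_strip \<kappa> R"]
    show ?thesis by (simp add: vimage_def Compl_eq)
  qed
  moreover have "measure haar_circle {z. poly Y z \<notin> off_strip \<kappa> R} < \<epsilon>"
    using A by (simp add: Y_def s_def)
  moreover have "norm (poly P z - 1) \<le> \<epsilon>" if "z \<notin> {z. poly Y z \<notin> off_strip \<kappa> R}" for z
    using that G(2) by (simp add: PG off_strip_def)
  ultimately show ?thesis by (rule that)
qed

section \<open>Trigonometric polynomials and convergence in measure\<close>

text \<open>Trigonometric polynomials, in the form to which multiplication of a polynomial by a negative
power of \<open>z\<close> leads; off the circle the function is arbitrary.\<close>

definition is_trig :: "(complex \<Rightarrow> complex) \<Rightarrow> bool" where
  "is_trig f \<longleftrightarrow> (\<exists>q M. \<forall>z. norm z = 1 \<longrightarrow> f z = poly q z / z ^ M)"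

lemma is_trig_const: "is_trig (\<lambda>z. c)"
  unfolding is_trig_def by (intro exI[of _ "[:c:]"] exI[of _ 0]) simp

lemma is_trig_add:
  assumes "is_trig f" "is_trig g" shows "is_trig (\<lambda>z. f z + g z)"
proof -
  obtain p M q N where pq: "\<And>z. norm z = 1 \<Longrightarrow> f z = poly p z / z ^ M" "\<And>z. norm z = 1 \<Longrightarrow> g z = poly q z / z ^ N"
    using assms unfolding is_trig_def by blast
  have "f z + g z = poly (p * monom 1 N + q * monom 1 M) z / z ^ (M + N)" if "norm z = 1" for z
  proof -
    have "z \<noteq> 0" using that by auto
    then show ?thesis unfolding pq[OF that] by (simp add: poly_monom field_simps power_add)
  qed
  then show ?thesis unfolding is_trig_def by blast
qed

lemma is_trig_mult:
  assumes "is_trig f" "is_trig g" shows "is_trig (\<lambda>z. f z * g z)"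
proof -
  obtain p M q N where pq: "\<And>z. norm z = 1 \<Longrightarrow> f z = poly p z / z ^ M" "\<And>z. norm z = 1 \<Longrightarrow> g z = poly q z / z ^ N"
    using assms unfolding is_trig_def by blast
  have "f z * g z = poly (p * q) z / z ^ (M + N)" if "norm z = 1" for z
    unfolding pq[OF that] by (simp add: power_add)
  then show ?thesis unfolding is_trig_def by blast
qed

text \<open>On the circle the conjugate of \<open>z\<close> is \<open>1 / z\<close>, so real-linear functions of \<open>z\<close> are
trigonometric polynomials.\<close>

lemma is_trig_real_polynomial:
  fixes f :: "complex \<Rightarrow> real"
  assumes "real_polynomial_function f"
  shows "is_trig (\<lambda>z. of_real (f z))"
  using assms
proof (induction rule: real_polynomial_function.induct)
  case (linear f)
  interpret bounded_linear f by fact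
  define a where "a = (complex_of_real (f 1) - \<i> * of_real (f \<i>)) / 2"
  define b where "b = (complex_of_real (f 1) + \<i> * of_real (f \<i>)) / 2"
  have "of_real (f z) = poly [:b, 0, a:] z / z ^ 1" if z: "norm z = 1" for z
  proof -
    have z0: "z \<noteq> 0" using z by auto
    have cnj: "cnj z = 1 / z" using z z0 complex_norm_square[of z] by (simp add: field_simps)
    have "f z = Re z * f 1 + Im z * f \<i>"
    proof -
      have "z = Re z *\<^sub>R 1 + Im z *\<^sub>R \<i>" by (simp add: complex_eq_iff)
      then have "f z = f (Re z *\<^sub>R 1 + Im z *\<^sub>R \<i>)" by simp
      then show ?thesis by (simp add: add scaleR)
    qed
    then have "complex_of_real (f z) = a * z + b * cnj z"
      by (simp add: a_def b_def complex_eq_iff field_simps)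
    then show ?thesis using z0 by (simp add: cnj field_simps)
  qed
  then show ?case unfolding is_trig_def by blast
qed (simp_all add: is_trig_const is_trig_add is_trig_mult)

lemma is_trig_uniformly_dense:
  assumes "continuous_on (sphere 0 1) \<psi>" "\<epsilon> > 0"
  obtains g where "is_trig g" "\<And>z. norm z = 1 \<Longrightarrow> norm (g z - \<psi> z) < \<epsilon>"
proof -
  obtain g where g: "polynomial_function g" "\<And>z. z \<in> sphere 0 1 \<Longrightarrow> norm (\<psi> z - g z) < \<epsilon>"
    using Stone_Weierstrass_polynomial_function[OF _ assms] by (metis compact_sphere)
  have "real_polynomial_function (\<lambda>z. Re (g z))" "real_polynomial_function (\<lambda>z. Im (g z))"
    using g(1) bounded_linear_Re bounded_linear_Im
      unfolding polynomial_function_def comp_def by blast+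
  then have "is_trig (\<lambda>z. of_real (Re (g z)) + \<i> * of_real (Im (g z)))"
    by (intro is_trig_add is_trig_mult is_trig_const is_trig_real_polynomial)
  then have "is_trig g" by (simp flip: complex_eq)
  then show ?thesis using g(2) by (intro that[of g]) (auto simp: norm_minus_commute)
qed

text \<open>The functions in the closure of the trigonometric polynomials with respect to convergence in
measure. The set \<open>B\<close> need only contain the points of bad approximation, so no proof is required
that they form a measurable set.\<close>

definition trig_approximable :: "(complex \<Rightarrow> complex) \<Rightarrow> bool" where
  "trig_approximable \<psi> \<longleftrightarrow> (\<forall>\<epsilon>>0. \<exists>g B. is_trig g \<and> B \<in> sets borel \<and> measure haar_circle B < \<epsilon> \<and>
     (\<forall>z. norm z = 1 \<longrightarrow> z \<notin> B \<longrightarrow> norm (g z - \<psi> z) < \<epsilon>))"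

lemma trig_approximable_limit:
  assumes "\<And>\<epsilon>. \<epsilon> > 0 \<Longrightarrow> \<exists>g B. trig_approximable g \<and> B \<in> sets borel \<and> measure haar_circle B < \<epsilon> \<and>
     (\<forall>z. norm z = 1 \<longrightarrow> z \<notin> B \<longrightarrow> norm (g z - \<psi> z) < \<epsilon>)"
  shows "trig_approximable \<psi>"
  unfolding trig_approximable_def
proof (intro allI impI)
  fix \<epsilon> :: real assume "\<epsilon> > 0"
  then have e2: "\<epsilon> / 2 > 0" by simp
  obtain g B where g: "trig_approximable g" and B: "B \<in> sets borel" "measure haar_circle B < \<epsilon> / 2"
    "\<forall>z. norm z = 1 \<longrightarrow> z \<notin> B \<longrightarrow> norm (g z - \<psi> z) < \<epsilon> / 2"
    using assms[OF e2] by blast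
  obtain h C where h: "is_trig h" and C: "C \<in> sets borel" "measure haar_circle C < \<epsilon> / 2"
    "\<forall>z. norm z = 1 \<longrightarrow> z \<notin> C \<longrightarrow> norm (h z - g z) < \<epsilon> / 2"
    using g e2 unfolding trig_approximable_def by blast
  have "measure haar_circle (B \<union> C) \<le> measure haar_circle B + measure haar_circle C"
    using B(1) C(1) by (intro measure_Un_le) auto
  then have "measure haar_circle (B \<union> C) < \<epsilon>" using B(2) C(2) by linarith
  moreover have "norm (h z - \<psi> z) < \<epsilon>" if "norm z = 1" "z \<notin> B \<union> C" for z
    using that B(3) C(3) norm_triangle_ineq[of "h z - g z" "g z - \<psi> z"] by fastforce
  ultimately show "\<exists>g B. is_trig g \<and> B \<in> sets borel \<and> measure haar_circle B < \<epsilon> \<and>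
     (\<forall>z. norm z = 1 \<longrightarrow> z \<notin> B \<longrightarrow> norm (g z - \<psi> z) < \<epsilon>)"
    using h B(1) C(1) by (intro exI[of _ h] exI[of _ "B \<union> C"]) auto
qed

lemma trig_approximable_add:
  assumes "trig_approximable f" "trig_approximable g"
  shows "trig_approximable (\<lambda>z. f z + g z)"
  unfolding trig_approximable_def
proof (intro allI impI)
  fix \<epsilon> :: real assume "\<epsilon> > 0"
  then have e2: "\<epsilon> / 2 > 0" by simp
  obtain f' B where f: "is_trig f'" and B: "B \<in> sets borel" "measure haar_circle B < \<epsilon> / 2"
    "\<forall>z. norm z = 1 \<longrightarrow> z \<notin> B \<longrightarrow> norm (f' z - f z) < \<epsilon> / 2"
    using assms(1) e2 unfolding trig_approximable_def by blast
  obtain g' C where g: "is_trig g'" and C: "C \<in> sets borel" "measure haar_circle C < \<epsilon> / 2"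
    "\<forall>z. norm z = 1 \<longrightarrow> z \<notin> C \<longrightarrow> norm (g' z - g z) < \<epsilon> / 2"
    using assms(2) e2 unfolding trig_approximable_def by blast
  have "measure haar_circle (B \<union> C) \<le> measure haar_circle B + measure haar_circle C"
    using B(1) C(1) by (intro measure_Un_le) auto
  then have "measure haar_circle (B \<union> C) < \<epsilon>" using B(2) C(2) by linarith
  moreover have "norm (f' z + g' z - (f z + g z)) < \<epsilon>" if "norm z = 1" "z \<notin> B \<union> C" for z
  proof -
    have "norm (f' z - f z) < \<epsilon> / 2" "norm (g' z - g z) < \<epsilon> / 2" using that B(3) C(3) by auto
    then show ?thesis using norm_diff_triangle_ineq[of "f' z" "g' z" "f z" "g z"] by linarith
  qed
  ultimately show "\<exists>h B. is_trig h \<and> B \<in> sets borel \<and> measure haar_circle B < \<epsilon> \<and>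
     (\<forall>z. norm z = 1 \<longrightarrow> z \<notin> B \<longrightarrow> norm (h z - (f z + g z)) < \<epsilon>)"
    using is_trig_add[OF f g] B(1) C(1)
      by (intro exI[of _ "\<lambda>z. f' z + g' z"] exI[of _ "B \<union> C"]) auto
qed

lemma trig_approximable_continuous:
  assumes "continuous_on (sphere 0 1) \<psi>" shows "trig_approximable \<psi>"
  unfolding trig_approximable_def
proof (intro allI impI)
  fix \<epsilon> :: real assume e: "\<epsilon> > 0"
  obtain g where "is_trig g" "\<And>z. norm z = 1 \<Longrightarrow> norm (g z - \<psi> z) < \<epsilon>"
    using is_trig_uniformly_dense[OF assms e] by blast
  then show "\<exists>g B. is_trig g \<and> B \<in> sets borel \<and> measure haar_circle B < \<epsilon> \<and>
     (\<forall>z. norm z = 1 \<longrightarrow> z \<notin> B \<longrightarrow> norm (g z - \<psi> z) < \<epsilon>)"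
    using e by (intro exI[of _ g] exI[of _ "{}"]) auto
qed

lemma haar_circle_regular:
  assumes S: "S \<in> sets borel" and "\<epsilon> > 0"
  obtains K U where "compact K" "open U" "K \<subseteq> S" "S \<subseteq> U" "measure haar_circle (U - K) < \<epsilon>"
proof -
  interpret prob_space haar_circle by (rule prob_space_haar_circle)
  have top: "emeasure haar_circle (space haar_circle) \<noteq> \<infinity>" using emeasure_space_1 by simp
  have e2: "\<epsilon> / 2 > 0" using assms by simp
  obtain K where K: "K \<subseteq> S" "compact K" "measure haar_circle S < measure haar_circle K + \<epsilon> / 2"
  proof (cases "measure haar_circle S < \<epsilon> / 2")
    case True
    then show ?thesis by (intro that[of "{}"]) auto
  next
    case False
    then have "ennreal (measure haar_circle S - \<epsilon> / 2) < emeasure haar_circle S"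
      using e2 by (simp add: emeasure_eq_measure ennreal_less_iff)
    then obtain K where K: "K \<subseteq> S" "compact K" "ennreal (measure haar_circle S - \<epsilon> / 2) < emeasure haar_circle K"
      unfolding inner_regular[OF sets_haar_circle top S] less_SUP_iff by auto
    then have "measure haar_circle S - \<epsilon> / 2 < measure haar_circle K"
      using False by (simp add: emeasure_eq_measure ennreal_less_iff)
    with K show ?thesis by (intro that[of K]) auto
  qed
  have "emeasure haar_circle S < ennreal (measure haar_circle S + \<epsilon> / 2)"
    using e2 by (simp add: emeasure_eq_measure ennreal_less_iff)
  then obtain U where U: "S \<subseteq> U" "open U" "emeasure haar_circle U < ennreal (measure haar_circle S + \<epsilon> / 2)"
    unfolding outer_regular[OF sets_haar_circle top S] INF_less_iff by auto
  then have "measure haar_circle U < measure haar_circle S + \<epsilon> / 2"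
    by (simp add: emeasure_eq_measure ennreal_less_iff)
  moreover have "measure haar_circle (U - K) = measure haar_circle U - measure haar_circle K"
    using K U by (intro finite_measure_Diff) (auto intro: borel_compact)
  ultimately show ?thesis using K U by (intro that[of K U]) auto
qed

text \<open>By regularity, an indicator function agrees with a continuous Urysohn function off a small
set.\<close>

lemma trig_approximable_indicator:
  assumes S: "S \<in> sets borel"
  shows "trig_approximable (\<lambda>z. indicator S z *\<^sub>R c)"
proof (rule trig_approximable_limit)
  fix \<epsilon> :: real assume e: "\<epsilon> > 0"
  obtain K U where KU: "compact K" "open U" "K \<subseteq> S" "S \<subseteq> U" "measure haar_circle (U - K) < \<epsilon>"
    using haar_circle_regular[OF S e] by blast
  have "closed K" "closed (- U)" "K \<inter> - U = {}" using KU compact_imp_closed by auto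
  then obtain u :: "complex \<Rightarrow> complex" where u: "continuous_on UNIV u" "\<And>z. z \<in> K \<Longrightarrow> u z = c" "\<And>z. z \<in> - U \<Longrightarrow> u z = 0"
    using Urysohn[of K "- U" c 0] by metis
  have "trig_approximable u"
    using u(1) continuous_on_subset by (intro trig_approximable_continuous) blast
  moreover have "U - K \<in> sets borel" using KU by (auto intro: borel_compact)
  moreover have "u z = indicator S z *\<^sub>R c" if "z \<notin> U - K" for z
    using that u KU by (cases "z \<in> K") (auto simp: indicator_def)
  ultimately show "\<exists>g B. trig_approximable g \<and> B \<in> sets borel \<and> measure haar_circle B < \<epsilon> \<and>
     (\<forall>z. norm z = 1 \<longrightarrow> z \<notin> B \<longrightarrow> norm (g z - indicator S z *\<^sub>R c) < \<epsilon>)"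
    using KU(5) e by (intro exI[of _ u] exI[of _ "U - K"]) auto
qed

text \<open>A pointwise limit of simple functions is also a limit in measure: the sets \<open>D n\<close> on which
some later approximation is still bad decrease to the empty set.\<close>

lemma trig_approximable_borel:
  assumes \<psi> [measurable]: "\<psi> \<in> borel_measurable borel"
  shows "trig_approximable \<psi>"
proof (rule trig_approximable_limit)
  fix \<epsilon> :: real assume e: "\<epsilon> > 0"
  interpret prob_space haar_circle by (rule prob_space_haar_circle)
  obtain s where s: "\<And>i. simple_function borel (s i)" "\<And>z. (\<lambda>i. s i z) \<longlonglongrightarrow> \<psi> z"
    using borel_measurable_implies_sequence_metric[OF \<psi>, of 0] by auto
  have [measurable]: "s i \<in> borel_measurable borel" for i
    using s(1) by (rule borel_measurable_simple_function)
  define D where "D n = {z. \<exists>i\<ge>n. \<epsilon> \<le> norm (s i z - \<psi> z)}" for n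
  have D: "D n \<in> sets borel" for n unfolding D_def by measurable
  have "(\<lambda>n. measure haar_circle (D n)) \<longlonglongrightarrow> measure haar_circle (\<Inter>n. D n)"
  proof (rule finite_Lim_measure_decseq)
    show "range D \<subseteq> events" using D by auto
    show "decseq D" by (auto simp: decseq_def D_def intro: order.trans)
  qed
  moreover have "(\<Inter>n. D n) = {}"
  proof -
    have "\<exists>n. z \<notin> D n" for z
    proof -
      obtain n where "\<forall>i\<ge>n. norm (s i z - \<psi> z) < \<epsilon>"
        using LIMSEQ_D[OF s(2) e] by blast
      then show ?thesis by (intro exI[of _ n]) (auto simp: D_def not_le)
    qed
    then show ?thesis by auto
  qed
  ultimately have "(\<lambda>n. measure haar_circle (D n)) \<longlonglongrightarrow> 0" by simp
  then obtain n where n: "measure haar_circle (D n) < \<epsilon>"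
    using LIMSEQ_D[of _ 0, OF _ e] by fastforce
  have "trig_approximable (\<lambda>z. \<Sum>y\<in>F. indicator (s n -` {y}) z *\<^sub>R y)" if "finite F" for F
    using that
  proof (induction F rule: finite_induct)
    case empty
    show ?case by (simp add: trig_approximable_continuous)
  next
    case (insert y F)
    have "s n -` {y} \<in> sets borel" using measurable_sets_borel[of "s n" borel "{y}"] by simp
    from trig_approximable_add[OF trig_approximable_indicator[OF this] insert.IH]
    show ?case unfolding sum.insert[OF insert.hyps] .
  qed
  from this[OF simple_functionD(1)[OF s(1)[of n]]]
  have "trig_approximable (\<lambda>z. \<Sum>y\<in>s n ` space borel. indicator (s n -` {y}) z *\<^sub>R y)" .
  also have "(\<lambda>z. \<Sum>y\<in>s n ` space borel. indicator (s n -` {y}) z *\<^sub>R y) = s n"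
  proof (rule ext)
    fix z
    have "s n z = (\<Sum>y\<in>s n ` space borel. indicator (s n -` {y} \<inter> space borel) z *\<^sub>R y)"
      by (rule simple_function_indicator_representation_banach[OF s(1)]) simp
    then show "(\<Sum>y\<in>s n ` space borel. indicator (s n -` {y}) z *\<^sub>R y) = s n z"
      unfolding space_borel Int_UNIV_right by (rule sym)
  qed
  finally have "trig_approximable (s n)" .
  then show "\<exists>g B. trig_approximable g \<and> B \<in> sets borel \<and> measure haar_circle B < \<epsilon> \<and>
     (\<forall>z. norm z = 1 \<longrightarrow> z \<notin> B \<longrightarrow> norm (g z - \<psi> z) < \<epsilon>)"
    using n D by (intro exI[of _ "s n"] exI[of _ "D n"]) (auto simp: D_def not_le)
qed

text \<open>A countable family of targets, indexed by a countable type: the exponent in the denominator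
and the list of rational real and imaginary parts of the coefficients in the numerator.\<close>

definition rational_trig :: "nat \<times> (rat \<times> rat) list \<Rightarrow> complex \<Rightarrow> complex" where
  "rational_trig t z = poly (Poly (map (\<lambda>(a, b). Complex (of_rat a) (of_rat b)) (snd t))) z / z ^ fst t"

lemma rational_poly_dense:
  assumes "\<epsilon> > 0"
  shows "\<exists>xs. \<forall>z. norm z = 1 \<longrightarrow> norm (poly (Poly (map (\<lambda>(a, b). Complex (of_rat a) (of_rat b)) xs)) z - poly q z) < \<epsilon>"
  using assms
proof (induction q arbitrary: \<epsilon>)
  case 0
  then show ?case by (intro exI[of _ "[]"]) simp
next
  case (pCons c q)
  let ?r = "\<lambda>(a, b). Complex (of_rat a) (of_rat b)"
  obtain xs where xs: "\<And>z. norm z = 1 \<Longrightarrow> norm (poly (Poly (map ?r xs)) z - poly q z) < \<epsilon> / 2"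
    using pCons.IH[of "\<epsilon>/2"] pCons.prems by auto
  obtain a where a: "Re c < of_rat a" "of_rat a < Re c + \<epsilon> / 4"
    using of_rat_dense[of "Re c" "Re c + \<epsilon> / 4"] pCons.prems by auto
  obtain b where b: "Im c < of_rat b" "of_rat b < Im c + \<epsilon> / 4"
    using of_rat_dense[of "Im c" "Im c + \<epsilon> / 4"] pCons.prems by auto
  have ab: "norm (Complex (of_rat a) (of_rat b) - c) < \<epsilon> / 2"
    using cmod_le[of "Complex (of_rat a) (of_rat b) - c"] a b by simp
  have "norm (poly (Poly (map ?r ((a, b) # xs))) z - poly (pCons c q) z) < \<epsilon>" if z: "norm z = 1" for z
  proof -
    have "poly (Poly (map ?r ((a, b) # xs))) z - poly (pCons c q) z
        = (Complex (of_rat a) (of_rat b) - c) + z * (poly (Poly (map ?r xs)) z - poly q z)"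
      by (simp add: algebra_simps)
    then have "norm (poly (Poly (map ?r ((a, b) # xs))) z - poly (pCons c q) z)
        \<le> norm (Complex (of_rat a) (of_rat b) - c) + norm (z * (poly (Poly (map ?r xs)) z - poly q z))"
      by (simp only: norm_triangle_ineq)
    also have "norm (z * (poly (Poly (map ?r xs)) z - poly q z)) = norm (poly (Poly (map ?r xs)) z - poly q z)"
      using z by (simp add: norm_mult)
    finally show ?thesis using ab xs[OF z] by linarith
  qed
  then show ?case by blast
qed

lemma rational_trig_dense:
  assumes "\<psi> \<in> borel_measurable borel" "\<epsilon> > 0"
  obtains t B where "B \<in> sets borel" "measure haar_circle B < \<epsilon>"
    "\<And>z. norm z = 1 \<Longrightarrow> z \<notin> B \<Longrightarrow> norm (rational_trig t z - \<psi> z) < \<epsilon>"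
proof -
  have e2: "\<epsilon> / 2 > 0" using assms by simp
  obtain g B where g: "is_trig g" and B: "B \<in> sets borel" "measure haar_circle B < \<epsilon> / 2"
     "\<forall>z. norm z = 1 \<longrightarrow> z \<notin> B \<longrightarrow> norm (g z - \<psi> z) < \<epsilon> / 2"
    using trig_approximable_borel[OF assms(1)] e2 unfolding trig_approximable_def by blast
  obtain q M where qM: "\<And>z. norm z = 1 \<Longrightarrow> g z = poly q z / z ^ M"
    using g unfolding is_trig_def by blast
  obtain xs where xs: "\<And>z. norm z = 1 \<Longrightarrow>
      norm (poly (Poly (map (\<lambda>(a, b). Complex (of_rat a) (of_rat b)) xs)) z - poly q z) < \<epsilon> / 2"
    using rational_poly_dense[OF e2] by blast
  have "norm (rational_trig (M, xs) z - \<psi> z) < \<epsilon>" if z: "norm z = 1" "z \<notin> B" for z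
  proof -
    have "norm (rational_trig (M, xs) z - g z) < \<epsilon> / 2"
      using xs[OF z(1)] z(1) unfolding qM[OF z(1)] rational_trig_def fst_conv snd_conv
      by (simp add: norm_divide norm_power flip: diff_divide_distrib)
    then show ?thesis
      using B(3) z norm_triangle_ineq[of "rational_trig (M, xs) z - g z" "g z - \<psi> z"] by fastforce
  qed
  moreover have "measure haar_circle B < \<epsilon>" using B(2) e2 by linarith
  ultimately show ?thesis using B(1) by (intro that[of B "(M, xs)"]) auto
qed

section \<open>The Orlicz space of analytic functions\<close>

text \<open>The default value \<open>0\<close> outside the disc is the one that membership in \<open>ell_a\<close> prescribes.\<close>

definition series_fun :: "(nat \<Rightarrow> complex) \<Rightarrow> complex \<Rightarrow> complex" where
  "series_fun a z = (if norm z < 1 then \<Sum>k. a k * z ^ k else 0)"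

lemma summable_bounded_coeffs:
  fixes a :: "nat \<Rightarrow> complex"
  assumes "\<And>k. norm (a k) \<le> B" "norm z < 1"
  shows "summable (\<lambda>k. norm (a k * z ^ k))"
proof (rule summable_comparison_test'[of "\<lambda>k. B * norm z ^ k" 0])
  show "summable (\<lambda>k. B * norm z ^ k)"
    using assms(2) by (intro summable_mult summable_geometric) auto
  show "norm (norm (a k * z ^ k)) \<le> B * norm z ^ k" for k
    using assms(1)[of k] by (simp add: norm_mult norm_power mult_right_mono)
qed

lemma series_fun_sums:
  assumes "\<And>k. norm (a k) \<le> B" "norm z < 1"
  shows "(\<lambda>k. a k * z ^ k) sums series_fun a z"
  using summable_sums[OF summable_norm_cancel[OF summable_bounded_coeffs[OF assms]]] assms(2)
  by (simp add: series_fun_def)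

lemma analytic_series_fun:
  assumes "\<And>k. norm (a k) \<le> B"
  shows "series_fun a analytic_on ball 0 1"
  by (rule power_series_analytic[of 0 1 a]) (use series_fun_sums[OF assms] in auto)

lemma taylor_coeff_series_fun:
  assumes B: "\<And>k. norm (a k) \<le> B"
  shows "taylor_coeff (series_fun a) = a"
proof -
  have "ereal (norm (1/2 :: complex)) \<le> conv_radius a"
    by (rule conv_radius_geI[OF summable_norm_cancel[OF summable_bounded_coeffs[OF B]]]) simp
  then have "fps_conv_radius (Abs_fps a) > 0"
    by (auto simp: fps_conv_radius_def intro: less_le_trans[rotated])
  moreover have "\<forall>\<^sub>F z in nhds 0. eval_fps (Abs_fps a) z = series_fun a z"
  proof -
    have "\<forall>\<^sub>F z in nhds 0. z \<in> ball (0::complex) 1" by (intro eventually_nhds_in_open) auto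
    then show ?thesis by eventually_elim (simp add: eval_fps_def series_fun_def)
  qed
  ultimately have "series_fun a has_fps_expansion Abs_fps a" by (simp add: has_fps_expansion_def)
  then show ?thesis by (simp add: taylor_coeff_def fun_eq_iff fps_expansion_eqI)
qed

lemma ell_a_sums:
  assumes "f \<in> ell_a \<phi>" "norm z < 1"
  shows "(\<lambda>k. taylor_coeff f k * z ^ k) sums f z"
proof -
  have "f holomorphic_on ball 0 1" using assms(1) analytic_imp_holomorphic by (auto simp: ell_a_def)
  from holomorphic_power_series[OF this, of z] assms(2)
  show ?thesis by (simp add: taylor_coeff_def fps_expansion_def)
qed

context orlicz
begin

lemma series_fun_in_ell_a:
  assumes a: "lux_le c a"
  shows "series_fun a \<in> ell_a \<phi>" "taylor_coeff (series_fun a) = a"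
proof -
  obtain C where "C > 0" and C: "\<And>c a k. lux_le c a \<Longrightarrow> norm (a k) \<le> C * c"
    using lux_le_coeff_bound by blast
  have B: "norm (a k) \<le> C * c" for k using C[OF a] .
  show "taylor_coeff (series_fun a) = a" by (rule taylor_coeff_series_fun[OF B])
  with analytic_series_fun[OF B] show "series_fun a \<in> ell_a \<phi>"
    using a unfolding lux_le_iff_suminf ell_a_def by (auto simp: series_fun_def)
qed

text \<open>By convexity, dividing the argument by \<open>M \<ge> 1\<close> divides the modular by at least \<open>M\<close>.\<close>

lemma ell_a_lux_le:
  assumes "f \<in> ell_a \<phi>"
  obtains c where "lux_le c (taylor_coeff f)"
proof -
  let ?a = "taylor_coeff f"
  obtain l where l: "l > 0" "summable (\<lambda>k. \<phi> (norm (?a k) / l))"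
    using assms by (auto simp: ell_a_def)
  define M where "M = max 1 (\<Sum>k. \<phi> (norm (?a k) / l))"
  have M: "M \<ge> 1" "M \<ge> (\<Sum>k. \<phi> (norm (?a k) / l))" by (auto simp: M_def)
  have "(\<Sum>k<n. \<phi> (norm (?a k) / (l * M))) \<le> 1" for n
  proof -
    have "(\<Sum>k<n. \<phi> (norm (?a k) / (l * M))) \<le> (\<Sum>k<n. (1 / M) * \<phi> (norm (?a k) / l))"
    proof (intro sum_mono)
      fix k
      show "\<phi> (norm (?a k) / (l * M)) \<le> (1 / M) * \<phi> (norm (?a k) / l)"
        using phi_scale[of "norm (?a k) / l" "1 / M"] l M by (simp add: field_simps)
    qed
    also have "\<dots> = (1 / M) * (\<Sum>k<n. \<phi> (norm (?a k) / l))" by (simp add: sum_distrib_left)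
    also have "\<dots> \<le> (1 / M) * (\<Sum>k. \<phi> (norm (?a k) / l))"
      using l M phi_nonneg by (intro mult_left_mono sum_le_suminf) auto
    also have "\<dots> \<le> 1" using M by (simp add: field_simps)
    finally show ?thesis .
  qed
  then have "lux_le (l * M) ?a" using l M by (simp add: lux_le_def)
  then show ?thesis by (rule that)
qed

interpretation Metric_space "ell_a \<phi>" "luxemburg_dist \<phi>"
  by (rule Metric_space_ell_a[OF orlicz_function])

lemma luxemburg_dist_le:
  assumes "f \<in> ell_a \<phi>" "g \<in> ell_a \<phi>" "lux_le c (\<lambda>k. taylor_coeff f k - taylor_coeff g k)"
  shows "luxemburg_dist \<phi> f g \<le> c"
proof -
  have "lux_le c (taylor_coeff (\<lambda>z. f z - g z))"
  proof -
    have "taylor_coeff (\<lambda>z. f z - g z) = (\<lambda>k. taylor_coeff f k - taylor_coeff g k)"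
      using assms(1,2) by (simp add: taylor_coeff_diff ell_a_def fun_eq_iff)
    then show ?thesis using assms(3) by simp
  qed
  then have "luxemburg_norm \<phi> (\<lambda>z. f z - g z) \<le> c"
    unfolding luxemburg_norm_def lux_le_iff_suminf by (intro cInf_lower bdd_belowI[of _ 0]) auto
  then show ?thesis using assms by (simp add: luxemburg_dist_def)
qed

lemma lux_le_of_luxemburg_dist:
  assumes fg: "f \<in> ell_a \<phi>" "g \<in> ell_a \<phi>" and "luxemburg_dist \<phi> f g < c"
  shows "lux_le c (\<lambda>k. taylor_coeff f k - taylor_coeff g k)"
proof -
  let ?D = "taylor_coeff (\<lambda>z. f z - g z)"
  have D: "?D = (\<lambda>k. taylor_coeff f k - taylor_coeff g k)"
    using fg by (simp add: taylor_coeff_diff ell_a_def fun_eq_iff)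
  have N: "luxemburg_norm \<phi> (\<lambda>z. f z - g z) = Inf {c. lux_le c ?D}"
    unfolding luxemburg_norm_def lux_le_iff_suminf ..
  obtain c0 where "lux_le c0 ?D" using ell_a_lux_le[OF ell_a_diff[OF orlicz_function fg]] .
  then have ne: "{c. lux_le c ?D} \<noteq> {}" by blast
  have "Inf {c. lux_le c ?D} < c" using assms by (simp add: luxemburg_dist_def N)
  from cInf_lessD[OF ne this] obtain c' where c': "lux_le c' ?D" "c' < c" by auto
  have "lux_le c ?D" by (rule lux_le_mono[OF c'(1) order.refl]) (use c'(2) in simp)
  then show ?thesis unfolding D .
qed

lemma openin_ell_a_topologyI:
  assumes "U \<subseteq> ell_a \<phi>"
    and "\<And>f. f \<in> U \<Longrightarrow> \<exists>\<eta>>0. \<forall>g\<in>ell_a \<phi>. lux_le \<eta> (\<lambda>k. taylor_coeff f k - taylor_coeff g k) \<longrightarrow> g \<in> U"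
  shows "openin (ell_a_topology \<phi>) U"
  unfolding ell_a_topology_def openin_mtopology
proof (intro conjI allI impI assms(1))
  fix f assume f: "f \<in> U"
  then obtain \<eta> where \<eta>: "\<eta> > 0" "\<And>g. g \<in> ell_a \<phi> \<Longrightarrow> lux_le \<eta> (\<lambda>k. taylor_coeff f k - taylor_coeff g k) \<Longrightarrow> g \<in> U"
    using assms(2) by blast
  have "mball f \<eta> \<subseteq> U" using \<eta>(2) lux_le_of_luxemburg_dist by (auto simp: in_mball)
  then show "\<exists>r>0. mball f r \<subseteq> U" using \<eta>(1) by blast
qed

lemma in_closure_ell_a_topologyI:
  assumes f: "f \<in> ell_a \<phi>" and S: "S \<subseteq> ell_a \<phi>"
    and "\<And>\<epsilon>. \<epsilon> > 0 \<Longrightarrow> \<exists>g\<in>S. lux_le \<epsilon> (\<lambda>k. taylor_coeff f k - taylor_coeff g k)"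
  shows "f \<in> ell_a_topology \<phi> closure_of S"
  unfolding ell_a_topology_def metric_closure_of
proof (intro CollectI conjI f allI impI)
  fix \<epsilon> :: real assume "\<epsilon> > 0"
  then have e2: "\<epsilon> / 2 > 0" by simp
  obtain g where g: "g \<in> S" "lux_le (\<epsilon> / 2) (\<lambda>k. taylor_coeff f k - taylor_coeff g k)"
    using assms(3)[OF e2] by (rule bexE)
  have "g \<in> ell_a \<phi>" using g(1) S by blast
  with luxemburg_dist_le[OF f this g(2)] e2 f have "g \<in> mball f \<epsilon>" by (auto simp: in_mball)
  then show "\<exists>y\<in>S. y \<in> mball f \<epsilon>" using g(1) by blast
qed

text \<open>A Cauchy sequence converges coefficientwise, because the norm controls each coefficient. The
norm estimate passes to the limit at the price of a factor \<open>2\<close>: for each finite set of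
coefficients, a late enough term \<open>a n'\<close> satisfies \<open>norm (a n k - b k) \<le> 2 * norm (a n k - a n'
k)\<close>. By monotonicity of \<open>\<phi>\<close>, the modular of \<open>a n - b\<close> at scale \<open>\<epsilon>\<close> is then bounded by that of
\<open>a n - a n'\<close> at scale \<open>\<epsilon> / 2\<close>.\<close>

lemma mcomplete_ell_a: "Metric_space.mcomplete (ell_a \<phi>) (luxemburg_dist \<phi>)"
  unfolding mcomplete_def
proof (intro allI impI)
  fix \<sigma> assume "MCauchy \<sigma>"
  then have \<sigma>: "\<And>n. \<sigma> n \<in> ell_a \<phi>"
    and Cauchy: "\<And>\<epsilon>. \<epsilon> > 0 \<Longrightarrow> \<exists>N. \<forall>n n'. N \<le> n \<longrightarrow> N \<le> n' \<longrightarrow> luxemburg_dist \<phi> (\<sigma> n) (\<sigma> n') < \<epsilon>"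
    unfolding MCauchy_def by auto
  define a where "a n = taylor_coeff (\<sigma> n)" for n
  have lux: "\<exists>N. \<forall>n n'. N \<le> n \<longrightarrow> N \<le> n' \<longrightarrow> lux_le \<epsilon> (\<lambda>k. a n k - a n' k)" if "\<epsilon> > 0" for \<epsilon>
    using Cauchy[OF that] lux_le_of_luxemburg_dist[OF \<sigma> \<sigma>] unfolding a_def by meson
  obtain C where C: "C > 0" "\<And>c a k. lux_le c a \<Longrightarrow> norm (a k) \<le> C * c"
    using lux_le_coeff_bound by blast
  have "convergent (\<lambda>n. a n k)" for k
  proof (intro Cauchy_convergent metric_CauchyI)
    fix e :: real assume e: "e > 0"
    then have "e / (2 * C) > 0" using C by simp
    from lux[OF this] obtain N where N: "\<And>n n'. N \<le> n \<Longrightarrow> N \<le> n' \<Longrightarrow> lux_le (e / (2 * C)) (\<lambda>k. a n k - a n' k)"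
      by blast
    have "dist (a n k) (a n' k) < e" if "N \<le> n" "N \<le> n'" for n n'
    proof -
      have "norm (a n k - a n' k) \<le> C * (e / (2 * C))" using C(2)[OF N[OF that]] .
      also have "\<dots> < e" using C e by simp
      finally show ?thesis by (simp add: dist_norm)
    qed
    then show "\<exists>M. \<forall>m\<ge>M. \<forall>n\<ge>M. dist (a m k) (a n k) < e" by blast
  qed
  then obtain b where b: "\<And>k. (\<lambda>n. a n k) \<longlonglongrightarrow> b k" unfolding convergent_def by metis
  have lim: "\<exists>N. \<forall>n\<ge>N. lux_le \<epsilon> (\<lambda>k. a n k - b k)" if \<epsilon>: "\<epsilon> > 0" for \<epsilon>
  proof -
    have "\<epsilon> / 2 > 0" using \<epsilon> by simp
    from lux[OF this] obtain N where N: "\<And>n n'. N \<le> n \<Longrightarrow> N \<le> n' \<Longrightarrow> lux_le (\<epsilon> / 2) (\<lambda>k. a n k - a n' k)"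
      by blast
    have "lux_le \<epsilon> (\<lambda>k. a n k - b k)" if n: "N \<le> n" for n
      unfolding lux_le_def
    proof (intro conjI allI \<epsilon>)
      fix K
      have "\<forall>\<^sub>F n' in sequentially. norm (a n k - b k) \<le> 2 * norm (a n k - a n' k)" for k
      proof (cases "a n k = b k")
        case False
        have "(\<lambda>n'. 2 * norm (a n k - a n' k)) \<longlonglongrightarrow> 2 * norm (a n k - b k)"
          by (intro tendsto_intros b)
        moreover have "norm (a n k - b k) < 2 * norm (a n k - b k)" using False by simp
        ultimately have "\<forall>\<^sub>F n' in sequentially. norm (a n k - b k) < 2 * norm (a n k - a n' k)"
          by (rule order_tendstoD)
        then show ?thesis by eventually_elim simp
      qed simp
      then have "\<forall>\<^sub>F n' in sequentially. \<forall>k\<in>{..<K}. norm (a n k - b k) \<le> 2 * norm (a n k - a n' k)"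
        by (intro eventually_ball_finite) auto
      then have "\<forall>\<^sub>F n' in sequentially. N \<le> n' \<and> (\<forall>k\<in>{..<K}. norm (a n k - b k) \<le> 2 * norm (a n k - a n' k))"
        by (intro eventually_conj eventually_ge_at_top)
      then obtain n' where n': "N \<le> n'" "\<And>k. k < K \<Longrightarrow> norm (a n k - b k) \<le> 2 * norm (a n k - a n' k)"
        using eventually_happens'[OF sequentially_bot] by fastforce
      have "(\<Sum>k<K. \<phi> (norm (a n k - b k) / \<epsilon>)) \<le> (\<Sum>k<K. \<phi> (norm (a n k - a n' k) / (\<epsilon> / 2)))"
      proof (intro sum_mono phi_mono)
        fix k assume "k \<in> {..<K}"
        then have "norm (a n k - b k) \<le> 2 * norm (a n k - a n' k)" using n'(2) by simp
        then have "norm (a n k - b k) / \<epsilon> \<le> 2 * norm (a n k - a n' k) / \<epsilon>"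
          using \<epsilon> by (intro divide_right_mono) auto
        then show "norm (a n k - b k) / \<epsilon> \<le> norm (a n k - a n' k) / (\<epsilon> / 2)"
          by (simp add: mult.commute)
      qed (use \<epsilon> in auto)
      also have "\<dots> \<le> 1" using N[OF n n'(1)] unfolding lux_le_def by blast
      finally show "(\<Sum>k<K. \<phi> (norm (a n k - b k) / \<epsilon>)) \<le> 1" .
    qed
    then show ?thesis by blast
  qed
  obtain N where "lux_le 1 (\<lambda>k. a N k - b k)" using lim[of 1] by auto
  then have 1: "lux_le 1 (\<lambda>k. b k - a N k)" by (subst lux_le_minus)
  obtain c where "lux_le c (a N)" using ell_a_lux_le[OF \<sigma>[of N]] unfolding a_def .
  from lux_le_add[OF 1 this] have "lux_le (1 + c) b" by simp
  note g = series_fun_in_ell_a[OF this]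
  have "limitin mtopology \<sigma> (series_fun b) sequentially"
    unfolding limitin_metric
  proof (intro conjI allI impI g)
    fix \<epsilon> :: real assume "\<epsilon> > 0"
    then have e2: "\<epsilon> / 2 > 0" by simp
    from lim[OF this] obtain N where N: "\<And>n. N \<le> n \<Longrightarrow> lux_le (\<epsilon> / 2) (\<lambda>k. a n k - b k)" by blast
    show "\<forall>\<^sub>F n in sequentially. \<sigma> n \<in> ell_a \<phi> \<and> luxemburg_dist \<phi> (\<sigma> n) (series_fun b) < \<epsilon>"
    proof (rule eventually_sequentiallyI[of N])
      fix n assume "N \<le> n"
      from luxemburg_dist_le[OF \<sigma>[of n] g(1), of "\<epsilon> / 2"] N[OF this] e2
      show "\<sigma> n \<in> ell_a \<phi> \<and> luxemburg_dist \<phi> (\<sigma> n) (series_fun b) < \<epsilon>"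
        using \<sigma> by (simp add: g(2) a_def)
    qed
  qed
  then show "\<exists>x. limitin mtopology \<sigma> x sequentially" by blast
qed

lemma completely_metrizable_ell_a: "completely_metrizable_space (ell_a_topology \<phi>)"
  unfolding ell_a_topology_def using mcomplete_ell_a by (rule completely_metrizable_space_mtopology)

lemma pointwise_bound:
  "\<exists>C>0. \<forall>f\<in>ell_a \<phi>. \<forall>g\<in>ell_a \<phi>. \<forall>\<eta> \<rho> z. lux_le \<eta> (\<lambda>k. taylor_coeff f k - taylor_coeff g k) \<longrightarrow>
     norm z \<le> \<rho> \<longrightarrow> \<rho> < 1 \<longrightarrow> norm (f z - g z) \<le> C / (1 - \<rho>) * \<eta>"
proof -
  obtain C where C: "C > 0" "\<And>c a k. lux_le c a \<Longrightarrow> norm (a k) \<le> C * c"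
    using lux_le_coeff_bound by blast
  show ?thesis
  proof (intro exI[of _ C] conjI C(1) ballI allI impI)
    fix f g \<eta> \<rho> and z :: complex
    assume fg: "f \<in> ell_a \<phi>" "g \<in> ell_a \<phi>" and l: "lux_le \<eta> (\<lambda>k. taylor_coeff f k - taylor_coeff g k)"
      and z: "norm z \<le> \<rho>" "\<rho> < 1"
    let ?d = "\<lambda>k. taylor_coeff f k - taylor_coeff g k"
    have r: "0 \<le> \<rho>" using z by (meson norm_ge_zero order.trans)
    have "(\<lambda>k. taylor_coeff f k * z ^ k - taylor_coeff g k * z ^ k) sums (f z - g z)"
      using z by (intro sums_diff ell_a_sums[OF fg(1)] ell_a_sums[OF fg(2)]) auto
    then have s: "(\<lambda>k. ?d k * z ^ k) sums (f z - g z)" by (simp add: left_diff_distrib)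
    have geo: "(\<lambda>k. C * \<eta> * \<rho> ^ k) sums (C * \<eta> * (1 / (1 - \<rho>)))"
      using r z by (intro sums_mult geometric_sums) auto
    have "norm (f z - g z) = norm (\<Sum>k. ?d k * z ^ k)" using sums_unique[OF s] by simp
    also have "\<dots> \<le> (\<Sum>k. C * \<eta> * \<rho> ^ k)"
    proof (rule norm_suminf_le)
      show "norm (?d k * z ^ k) \<le> C * \<eta> * \<rho> ^ k" for k
        unfolding norm_mult norm_power
        using C(1) l C(2)[OF l, of k] z r by (intro mult_mono power_mono) (auto simp: lux_le_def)
    qed (use geo in \<open>simp add: sums_iff\<close>)
    also have "\<dots> = C / (1 - \<rho>) * \<eta>" using sums_unique[OF geo] by simp
    finally show "norm (f z - g z) \<le> C / (1 - \<rho>) * \<eta>" .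
  qed
qed

text \<open>A polynomial is a multiple of \<open>1\<close> in the ring of polynomials, so boundedness of
multiplication gives the claim once it is known for the sequence \<open>coeff 1\<close>.\<close>

lemma lux_le_poly: obtains c where "lux_le c (coeff p)"
proof -
  obtain C where "C > 0" "\<And>c q. lux_le c (coeff q) \<Longrightarrow> lux_le (C * c) (coeff (p * q))"
    using lux_le_poly_mult[of p] by blast
  moreover have "lux_le (max 1 (1 / \<phi> 1) * max 1 (\<phi> 1)) (coeff 1)"
  proof -
    let ?c = "max 1 (1 / \<phi> 1) * max 1 (\<phi> 1)"
    have p1: "\<phi> 1 > 0" by (rule phi_pos) simp
    have c: "?c \<ge> 1" "?c \<ge> \<phi> 1"
      using p1 mult_mono[of 1 "max 1 (1 / \<phi> 1)" 1 "max 1 (\<phi> 1)"] mult_mono[of 1 "max 1 (1 / \<phi> 1)" "\<phi> 1" "max 1 (\<phi> 1)"]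
        by auto
    have "\<phi> (1 / ?c) \<le> (1 / ?c) * \<phi> 1" using phi_scale[of 1 "1 / ?c"] c by simp
    also have "\<dots> \<le> 1" using c by (simp add: divide_le_eq)
    finally have "\<phi> (1 / ?c) \<le> 1" .
    moreover have "(\<Sum>k<n. \<phi> (norm (coeff (1::complex poly) k) / ?c)) = (\<Sum>k<n. if k = 0 then \<phi> (1 / ?c) else 0)" for n
      by (intro sum.cong) auto
    ultimately show ?thesis using c by (auto simp: lux_le_def)
  qed
  ultimately have "lux_le (C * (max 1 (1 / \<phi> 1) * max 1 (\<phi> 1))) (coeff (p * 1))" by blast
  then show ?thesis using that by simp
qed

definition poly_fun :: "complex poly \<Rightarrow> complex \<Rightarrow> complex" where
  "poly_fun p = series_fun (coeff p)"

lemma poly_fun_in_ell_a: "poly_fun p \<in> ell_a \<phi>"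
  and taylor_coeff_poly_fun: "taylor_coeff (poly_fun p) = coeff p"
  unfolding poly_fun_def by (rule lux_le_poly[of p], erule series_fun_in_ell_a)+

lemma poly_fun_eq: "norm z < 1 \<Longrightarrow> poly_fun p z = poly p z"
proof -
  assume "norm z < 1"
  have "(\<Sum>k. coeff p k * z ^ k) = (\<Sum>k\<le>degree p. coeff p k * z ^ k)"
    by (rule suminf_finite) (auto simp: coeff_eq_0)
  then show ?thesis using \<open>norm z < 1\<close> by (simp add: poly_fun_def series_fun_def poly_altdef)
qed

text \<open>The coefficients tend to \<open>0\<close>, so the \<open>\<Delta>\<^sub>2\<close> inequality applies to all but finitely many of
them and preserves summability when the argument is doubled. Iterating this reaches every scale.\<close>

lemma Delta2_summable:
  assumes D: "Delta2 \<phi>" and f: "f \<in> ell_a \<phi>" and \<epsilon>: "\<epsilon> > 0"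
  shows "summable (\<lambda>k. \<phi> (norm (taylor_coeff f k) / \<epsilon>))"
proof -
  let ?a = "\<lambda>k. norm (taylor_coeff f k)"
  obtain K t0 where K: "K > 0" and t0: "0 < t0" and K2: "\<And>t. 0 < t \<Longrightarrow> t < t0 \<Longrightarrow> \<phi> (2 * t) \<le> K * \<phi> t"
    using D unfolding Delta2_def by auto
  obtain c where c: "c > 0" "summable (\<lambda>k. \<phi> (?a k / c))" using f by (auto simp: ell_a_def)
  have small: "\<forall>\<^sub>F k in sequentially. ?a k / c < s" if s: "s > 0" for s
  proof -
    have "(\<lambda>k. \<phi> (?a k / c)) \<longlonglongrightarrow> 0" by (rule summable_LIMSEQ_zero[OF c(2)])
    then have "\<forall>\<^sub>F k in sequentially. \<phi> (?a k / c) < \<phi> s"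
      using phi_pos[OF s] by (rule order_tendstoD)
    then show ?thesis by eventually_elim (use phi_mono[of s] s in \<open>force simp: not_less[symmetric]\<close>)
  qed
  have "summable (\<lambda>k. \<phi> (2 ^ j * (?a k / c)))" for j
  proof (induction j)
    case (Suc j)
    have "\<forall>\<^sub>F k in sequentially. ?a k / c < t0 / 2 ^ j" using t0 by (intro small) auto
    then have "\<forall>\<^sub>F k in sequentially. norm (\<phi> (2 ^ Suc j * (?a k / c))) \<le> K * \<phi> (2 ^ j * (?a k / c))"
    proof eventually_elim
      case (elim k)
      have nn: "0 \<le> 2 ^ j * (?a k / c)" using c by simp
      have "\<phi> (2 * (2 ^ j * (?a k / c))) \<le> K * \<phi> (2 ^ j * (?a k / c))"
      proof (cases "2 ^ j * (?a k / c) = 0")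
        case False
        moreover have "2 ^ j * (?a k / c) < t0" using elim by (simp add: field_simps)
        ultimately show ?thesis using nn by (intro K2) linarith+
      next
        case True
        then show ?thesis by (simp only: mult_zero_right phi_zero)
      qed
      moreover have "0 \<le> \<phi> (2 * (2 ^ j * (?a k / c)))" using nn by (intro phi_nonneg) simp
      ultimately show ?case by (simp add: mult.assoc)
    qed
    then show ?case by (rule summable_comparison_test_ev) (intro summable_mult Suc.IH)
  qed (use c in simp)
  moreover obtain j where j: "c / \<epsilon> < 2 ^ j" using real_arch_pow[of 2 "c / \<epsilon>"] by auto
  ultimately have sj: "summable (\<lambda>k. \<phi> (2 ^ j * (?a k / c)))" by blast
  show ?thesis
  proof (rule summable_comparison_test'[OF sj, of 0])
    fix k
    have "?a k / \<epsilon> = (c / \<epsilon>) * (?a k / c)" using c by simp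
    also have "\<dots> \<le> 2 ^ j * (?a k / c)" using j c by (intro mult_right_mono) auto
    finally have "\<phi> (?a k / \<epsilon>) \<le> \<phi> (2 ^ j * (?a k / c))" using \<epsilon> by (intro phi_mono) auto
    then show "norm (\<phi> (?a k / \<epsilon>)) \<le> \<phi> (2 ^ j * (?a k / c))"
      using phi_nonneg[of "?a k / \<epsilon>"] \<epsilon> by simp
  qed
qed

lemma sum_lessThan_add:
  fixes h :: "nat \<Rightarrow> real"
  shows "(\<Sum>k<N + n. h k) = (\<Sum>k<N. h k) + (\<Sum>k<n. h (k + N))"
proof (induction n)
  case (Suc n)
  then show ?case by (simp add: add.commute[of N n])
qed simp

text \<open>Taylor polynomials converge in norm, since the modular of the remainder at any scale \<open>\<epsilon>\<close> is
the tail of a convergent series.\<close>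

lemma Delta2_poly_dense:
  assumes "Delta2 \<phi>"
  shows "ell_a_topology \<phi> closure_of range poly_fun = ell_a \<phi>"
proof
  show "ell_a_topology \<phi> closure_of range poly_fun \<subseteq> ell_a \<phi>"
    using closure_of_subset_topspace topspace_ell_a_topology[OF orlicz_function] by metis
  show "ell_a \<phi> \<subseteq> ell_a_topology \<phi> closure_of range poly_fun"
  proof
    fix f assume f: "f \<in> ell_a \<phi>"
    show "f \<in> ell_a_topology \<phi> closure_of range poly_fun"
    proof (rule in_closure_ell_a_topologyI[OF f])
      fix \<epsilon> :: real assume \<epsilon>: "\<epsilon> > 0"
      let ?u = "\<lambda>k. \<phi> (norm (taylor_coeff f k) / \<epsilon>)"
      have s: "summable ?u" by (rule Delta2_summable[OF assms f \<epsilon>])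
      obtain N where N: "norm (\<Sum>i. ?u (i + N)) < 1" using suminf_exist_split[OF _ s, of 1] by auto
      define p where "p = (\<Sum>k<N. monom (taylor_coeff f k) k)"
      have p: "coeff p k = (if k < N then taylor_coeff f k else 0)" for k
        by (simp add: p_def coeff_sum)
      have "lux_le \<epsilon> (\<lambda>k. taylor_coeff f k - coeff p k)"
        unfolding lux_le_def
      proof (intro conjI allI \<epsilon>)
        fix n
        have "(\<Sum>k<n. \<phi> (norm (taylor_coeff f k - coeff p k) / \<epsilon>)) \<le> (\<Sum>k<N + n. \<phi> (norm (taylor_coeff f k - coeff p k) / \<epsilon>))"
          using \<epsilon> by (intro sum_mono2 phi_nonneg) auto
        also have "\<dots> = (\<Sum>k<N. \<phi> (norm (taylor_coeff f k - coeff p k) / \<epsilon>)) + (\<Sum>k<n. \<phi> (norm (taylor_coeff f (k + N) - coeff p (k + N)) / \<epsilon>))"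
          by (rule sum_lessThan_add)
        also have "\<dots> = (\<Sum>k<n. ?u (k + N))" by (simp add: p)
        also have "\<dots> \<le> (\<Sum>k. ?u (k + N))"
          using \<epsilon> by (intro sum_le_suminf phi_nonneg summable_ignore_initial_segment[OF s]) auto
        also have "\<dots> \<le> 1" using N by simp
        finally show "(\<Sum>k<n. \<phi> (norm (taylor_coeff f k - coeff p k) / \<epsilon>)) \<le> 1" .
      qed
      then show "\<exists>g\<in>range poly_fun. lux_le \<epsilon> (\<lambda>k. taylor_coeff f k - taylor_coeff g k)"
        by (intro bexI[of _ "poly_fun p"]) (auto simp: taylor_coeff_poly_fun)
    qed (use poly_fun_in_ell_a in blast)
  qed
qed

end

section \<open>Universality by Baire category\<close>

lemma (in orlicz) lux_le_poly_shift:
  assumes "lux_le c (coeff p)" shows "lux_le c (coeff (poly_shift M p))"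
  unfolding lux_le_def
proof (intro conjI allI)
  show c: "0 < c" using assms by (simp add: lux_le_def)
  fix n
  have "(\<Sum>k<n. \<phi> (norm (coeff (poly_shift M p) k) / c)) = (\<Sum>k<n. \<phi> (norm (coeff p (k + M)) / c))"
    by (simp add: coeff_poly_shift)
  also have "\<dots> \<le> (\<Sum>k<M. \<phi> (norm (coeff p k) / c)) + (\<Sum>k<n. \<phi> (norm (coeff p (k + M)) / c))"
    using c by (simp add: sum_nonneg phi_nonneg)
  also have "\<dots> = (\<Sum>k<M + n. \<phi> (norm (coeff p k) / c))" by (rule sum_lessThan_add[symmetric])
  also have "\<dots> \<le> 1" using assms unfolding lux_le_def by blast
  finally show "(\<Sum>k<n. \<phi> (norm (coeff (poly_shift M p) k) / c)) \<le> 1" .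
qed

lemma poly_bounded_circle:
  fixes q :: "complex poly"
  obtains B where "B > 0" "\<And>z. norm z = 1 \<Longrightarrow> norm (poly q z) \<le> B"
proof -
  obtain B where "B > 0" "\<And>z. z \<in> sphere 0 1 \<Longrightarrow> norm (poly q z) \<le> B"
    using poly_approximable_bounded[OF poly_approximable_poly[of "sphere 0 1" q]] by auto
  then show ?thesis by (intro that[of B]) auto
qed

text \<open>Let \<open>P\<close> be nearly \<open>1\<close> and of small norm. Its first \<open>M\<close> coefficients are small and may be
dropped, and then \<open>P\<close> can be divided by \<open>z ^ M\<close> within the polynomials. The quotient is nearly \<open>z
^ (- M)\<close>, and it remains to multiply by \<open>q\<close>.\<close>

lemma (in orlicz) approximate_trig:
  assumes small: "\<phi> \<in> o[at_right 0](\<lambda>t. t\<^sup>2)" and \<epsilon>: "\<epsilon> > 0"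
  obtains P A where "lux_le \<epsilon> (coeff P)" "A \<in> sets borel" "measure haar_circle A < \<epsilon>"
    "\<And>z. norm z = 1 \<Longrightarrow> z \<notin> A \<Longrightarrow> norm (poly P z - poly q z / z ^ M) \<le> \<epsilon>"
proof -
  obtain C where C: "C > 0" "\<And>c a k. lux_le c a \<Longrightarrow> norm (a k) \<le> C * c"
    using lux_le_coeff_bound by blast
  obtain Q where Q: "Q > 0" "\<And>c p. lux_le c (coeff p) \<Longrightarrow> lux_le (Q * c) (coeff (q * p))"
    using lux_le_poly_mult[of q] by blast
  obtain B where B: "B > 0" "\<And>z. norm z = 1 \<Longrightarrow> norm (poly q z) \<le> B"
    using poly_bounded_circle[of q] by blast
  \<comment> \<open>\<open>S\<close> dominates the three factors by which the initial accuracy \<open>\<delta>\<close> deteriorates: in the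
    measure of the exceptional set, in the norm, and in the distance to the target.\<close>
  define S where "S = 1 + Q + B * (1 + M * C)"
  have S: "S \<ge> 1" "S \<ge> Q" "S \<ge> B * (1 + M * C)" "S > 0"
    using Q B C by (auto simp: S_def add_pos_nonneg)
  define \<delta> where "\<delta> = \<epsilon> / S"
  have \<delta>: "\<delta> > 0" using S \<epsilon> by (simp add: \<delta>_def)
  have \<delta>': "s * \<delta> \<le> \<epsilon>" if "s \<le> S" for s
  proof -
    have "s * \<delta> \<le> S * \<delta>" using that \<delta> by (intro mult_right_mono) auto
    then show ?thesis using S by (simp add: \<delta>_def)
  qed
  obtain P A where P: "lux_le \<delta> (coeff P)" and A: "A \<in> sets borel" "measure haar_circle A < \<delta>"
    "\<And>z. z \<notin> A \<Longrightarrow> norm (poly P z - 1) \<le> \<delta>"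
    using approximate_one[OF small \<delta>] by blast
  define P' where "P' = poly_shift M P"
  have split: "P = poly_cutoff M P + monom 1 M * P'"
    by (rule poly_eqI) (simp add: P'_def coeff_poly_cutoff coeff_monom_mult coeff_poly_shift)
  have cut: "norm (poly (poly_cutoff M P) z) \<le> M * (C * \<delta>)" if z: "norm z = 1" for z
  proof -
    have eq: "poly_cutoff M P = (\<Sum>k<M. monom (coeff P k) k)"
      by (rule poly_eqI) (simp add: coeff_poly_cutoff coeff_sum)
    have "norm (poly (poly_cutoff M P) z) \<le> (\<Sum>k<M. norm (coeff P k * z ^ k))"
      unfolding eq poly_sum poly_monom by (rule norm_sum)
    also have "\<dots> \<le> (\<Sum>k<M. C * \<delta>)"
      using C(2)[OF P] z by (intro sum_mono) (simp add: norm_mult norm_power)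
    finally show ?thesis by simp
  qed
  have "lux_le (Q * \<delta>) (coeff (q * P'))" unfolding P'_def by (intro Q(2) lux_le_poly_shift P)
  from lux_le_mono[OF this order.refl \<delta>'[OF S(2)]] have "lux_le \<epsilon> (coeff (q * P'))" .
  moreover have "measure haar_circle A < \<epsilon>" using A(2) \<delta>'[OF S(1)] by simp
  moreover have "norm (poly (q * P') z - poly q z / z ^ M) \<le> \<epsilon>" if z: "norm z = 1" "z \<notin> A" for z
  proof -
    have z0: "z \<noteq> 0" using z by auto
    have "poly P z = poly (poly_cutoff M P) z + z ^ M * poly P' z"
      by (subst split) (simp add: poly_monom)
    then have "z ^ M * poly P' z - 1 = (poly P z - 1) - poly (poly_cutoff M P) z" by simp
    then have "norm (z ^ M * poly P' z - 1) \<le> norm (poly P z - 1) + norm (poly (poly_cutoff M P) z)"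
      by (simp only: norm_triangle_ineq4)
    also have "\<dots> \<le> (1 + M * C) * \<delta>" using A(3)[OF z(2)] cut[OF z(1)] by (simp add: algebra_simps)
    finally have 1: "norm (z ^ M * poly P' z - 1) \<le> (1 + M * C) * \<delta>" .
    have "poly (q * P') z - poly q z / z ^ M = poly q z / z ^ M * (z ^ M * poly P' z - 1)"
      using z0 by (simp add: field_simps)
    then have "norm (poly (q * P') z - poly q z / z ^ M) = norm (poly q z) * norm (z ^ M * poly P' z - 1)"
      using z(1) by (simp add: norm_mult norm_divide norm_power)
    also have "\<dots> \<le> B * ((1 + M * C) * \<delta>)" using B 1 z by (intro mult_mono) auto
    also have "\<dots> \<le> \<epsilon>" using \<delta>'[OF S(3)] by (simp add: mult.assoc)
    finally show ?thesis .
  qed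
  ultimately show ?thesis using A(1) by (intro that[of "q * P'" A]) auto
qed

text \<open>Choose rational trigonometric polynomials that approach the target fast in measure, and for
each of them an index at which \<open>F\<close> is close to it. The exceptional sets have summable measures, so
by Borel--Cantelli almost every point is eventually outside all of them. The indices are chosen
without reference to \<open>w\<close>, so one sequence serves all \<open>w\<close>; each \<open>w\<close> is eventually covered by the
exhaustion \<open>K\<close>.\<close>

lemma universal_of_approximations:
  fixes F :: "nat \<Rightarrow> 'w \<Rightarrow> complex \<Rightarrow> complex"
  assumes approx: "\<And>t m. \<exists>n\<ge>m. \<exists>A\<in>sets borel. measure haar_circle A < (1/2) ^ m \<and>
      (\<forall>\<zeta> w. norm \<zeta> = 1 \<longrightarrow> \<zeta> \<notin> A \<longrightarrow> w \<in> K m \<longrightarrow> norm (F n w \<zeta> - rational_trig t \<zeta>) \<le> 1 / (real m + 1))"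
    and exhaust: "\<And>w. w \<in> W \<Longrightarrow> \<forall>\<^sub>F m in sequentially. w \<in> K m"
    and \<psi>: "\<psi> \<in> borel_measurable circle_measure"
  shows "\<exists>n. strict_mono n \<and> (\<forall>w\<in>W. AE \<zeta> in circle_measure. (\<lambda>l. F (n l) w \<zeta>) \<longlonglongrightarrow> \<psi> \<zeta>)"
proof -
  interpret prob_space haar_circle by (rule prob_space_haar_circle)
  obtain \<psi>' where \<psi>': "\<psi>' \<in> borel_measurable borel" "AE z in circle_measure. \<psi> z = \<psi>' z"
    using circle_measurable_borel_version[OF \<psi>] by blast
  have "\<exists>t B. B \<in> sets borel \<and> measure haar_circle B < (1/2) ^ l \<and>
      (\<forall>z. norm z = 1 \<longrightarrow> z \<notin> B \<longrightarrow> norm (rational_trig t z - \<psi>' z) < (1/2) ^ l)" for l :: nat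
    using rational_trig_dense[OF \<psi>'(1), of "(1/2) ^ l"]
      by (metis half_gt_zero_iff zero_less_one zero_less_power)
  then obtain t B where B: "\<And>l. B l \<in> sets borel" "\<And>l. measure haar_circle (B l) < (1/2) ^ l"
      "\<And>l z. norm z = 1 \<Longrightarrow> z \<notin> B l \<Longrightarrow> norm (rational_trig (t l) z - \<psi>' z) < (1/2) ^ l" by metis
  obtain N A where N: "\<And>t m. N t m \<ge> m" and A: "\<And>t m. A t m \<in> sets borel" "\<And>t m. measure haar_circle (A t m) < (1/2) ^ m"
      "\<And>t m \<zeta> w. norm \<zeta> = 1 \<Longrightarrow> \<zeta> \<notin> A t m \<Longrightarrow> w \<in> K m \<Longrightarrow> norm (F (N t m) w \<zeta> - rational_trig t \<zeta>) \<le> 1 / (real m + 1)"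
  proof -
    define good where "good t m n A \<longleftrightarrow> n \<ge> m \<and> A \<in> sets borel \<and> measure haar_circle A < (1/2) ^ m \<and>
      (\<forall>\<zeta> w. norm \<zeta> = 1 \<longrightarrow> \<zeta> \<notin> A \<longrightarrow> w \<in> K m \<longrightarrow> norm (F n w \<zeta> - rational_trig t \<zeta>) \<le> 1 / (real m + 1))"
      for t m n A
    have "\<forall>t m. \<exists>n A. good t m n A" using approx unfolding good_def by blast
    then obtain N A where "\<And>t m. good t m (N t m) (A t m)" by metis
    then show ?thesis unfolding good_def by (intro that[of N A]) blast+
  qed
  \<comment> \<open>Each precision parameter exceeds the index chosen before, which makes the indices increase.\<close>
  define m where "m = rec_nat 0 (\<lambda>l m. Suc (N (t l) m))"
  have m_Suc: "m (Suc l) = Suc (N (t l) (m l))" for l by (simp add: m_def)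
  define n where "n l = N (t l) (m l)" for l
  have nm: "m l \<le> n l" "n l < m (Suc l)" for l using N by (auto simp: n_def m_Suc)
  have "strict_mono n" by (rule strict_monoI_Suc) (use nm in \<open>meson less_le_trans\<close>)
  have "strict_mono m" by (rule strict_monoI_Suc) (use nm in \<open>meson le_less_trans\<close>)
  then have lm: "l \<le> m l" for l by (rule strict_mono_imp_increasing)
  have mtop: "filterlim m sequentially sequentially" by (rule filterlim_subseq) fact
  define E where "E l = A (t l) (m l) \<union> B l" for l
  have E: "E l \<in> sets borel" for l using A B by (simp add: E_def)
  have E_le: "measure haar_circle (E l) \<le> 2 * (1/2) ^ l" for l
  proof -
    have "measure haar_circle (E l) \<le> measure haar_circle (A (t l) (m l)) + measure haar_circle (B l)"
      unfolding E_def using A B by (intro measure_Un_le) auto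
    also have "\<dots> \<le> (1/2) ^ m l + (1/2) ^ l" using A(2)[of "t l" "m l"] B(2)[of l] by linarith
    also have "\<dots> \<le> 2 * (1/2) ^ l" using power_decreasing[OF lm[of l], of "1/2::real"] by simp
    finally show ?thesis .
  qed
  have "summable (\<lambda>l. 2 * (1/2) ^ l :: real)" by (intro summable_mult summable_geometric) auto
  then have "summable (\<lambda>l. measure haar_circle (E l))"
    by (rule summable_comparison_test'[where N = 0]) (simp add: E_le)
  then have "AE z in haar_circle. \<forall>\<^sub>F l in sequentially. z \<in> space haar_circle - E l"
    using E by (intro borel_cantelli_AE1) (auto simp: emeasure_eq_measure)
  then have ev: "AE z in circle_measure. \<forall>\<^sub>F l in sequentially. z \<notin> E l"
    by (intro AE_circle_measure) simp
  have sphere: "AE z in circle_measure. norm z = 1"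
    by (rule AE_I2) (simp add: space_circle_measure)
  have "AE \<zeta> in circle_measure. (\<lambda>l. F (n l) w \<zeta>) \<longlonglongrightarrow> \<psi> \<zeta>" if w: "w \<in> W" for w
    using ev sphere \<psi>'(2)
  proof eventually_elim
    case (elim \<zeta>)
    have "\<forall>\<^sub>F l in sequentially. w \<in> K (m l)"
      using exhaust[OF w] mtop by (rule eventually_compose_filterlim)
    with elim(1) have ev_le: "\<forall>\<^sub>F l in sequentially. norm (F (n l) w \<zeta> - \<psi>' \<zeta>) \<le> 1 / (real l + 1) + (1/2) ^ l"
    proof eventually_elim
      case (elim l)
      then have "\<zeta> \<notin> A (t l) (m l)" "\<zeta> \<notin> B l" by (auto simp: E_def)
      then have "norm (F (n l) w \<zeta> - rational_trig (t l) \<zeta>) \<le> 1 / (real (m l) + 1)"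
        "norm (rational_trig (t l) \<zeta> - \<psi>' \<zeta>) < (1/2) ^ l"
        unfolding n_def using A(3) B(3) \<open>norm \<zeta> = 1\<close> elim(2) by auto
      moreover have "1 / (real (m l) + 1) \<le> 1 / (real l + 1)"
        using lm[of l] by (intro divide_left_mono) auto
      ultimately show ?case
        using norm_triangle_ineq[of "F (n l) w \<zeta> - rational_trig (t l) \<zeta>" "rational_trig (t l) \<zeta> - \<psi>' \<zeta>"]
          by simp
    qed
    have lim: "(\<lambda>l. 1 / (real l + 1) + (1/2) ^ l) \<longlonglongrightarrow> 0 + 0"
      by (intro tendsto_add LIMSEQ_power_zero) (use LIMSEQ_inverse_real_of_nat in \<open>simp_all add: inverse_eq_divide add.commute\<close>)
    have "(\<lambda>l. F (n l) w \<zeta> - \<psi>' \<zeta>) \<longlonglongrightarrow> 0"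
      by (rule Lim_null_comparison[OF ev_le lim[unfolded add_0_left]])
    then show ?case using elim(3) by (simp add: LIM_zero_iff)
  qed
  with \<open>strict_mono n\<close> show ?thesis by blast
qed

context orlicz
begin

text \<open>The functions whose transforms \<open>F f n w\<close> come close to the target \<open>t\<close>, uniformly in \<open>w \<in> K
m\<close>, at some index \<open>n \<ge> m\<close>. The strict inequality \<open>\<delta> < 1 / (m + 1)\<close> leaves room for small
perturbations of \<open>f\<close> and makes the set open. Radial values and partial sums are the two instances
of \<open>F\<close>.\<close>

definition approx_set ::
  "((complex \<Rightarrow> complex) \<Rightarrow> nat \<Rightarrow> 'w \<Rightarrow> complex \<Rightarrow> complex) \<Rightarrow> (nat \<Rightarrow> 'w set) \<Rightarrow> (nat \<times> (rat \<times> rat) list) \<Rightarrow> nat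
    \<Rightarrow> (complex \<Rightarrow> complex) set" where
  "approx_set F K t m = {f \<in> ell_a \<phi>. \<exists>n\<ge>m. \<exists>A\<in>sets borel. \<exists>\<delta><1 / (real m + 1). measure haar_circle A < (1/2) ^ m \<and>
      (\<forall>\<zeta> w. norm \<zeta> = 1 \<longrightarrow> \<zeta> \<notin> A \<longrightarrow> w \<in> K m \<longrightarrow> norm (F f n w \<zeta> - rational_trig t \<zeta>) \<le> \<delta>)}"

lemma approx_setD:
  assumes "f \<in> approx_set F K t m"
  shows "\<exists>n\<ge>m. \<exists>A\<in>sets borel. measure haar_circle A < (1/2) ^ m \<and>
      (\<forall>\<zeta> w. norm \<zeta> = 1 \<longrightarrow> \<zeta> \<notin> A \<longrightarrow> w \<in> K m \<longrightarrow> norm (F f n w \<zeta> - rational_trig t \<zeta>) \<le> 1 / (real m + 1))"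
proof -
  obtain n A \<delta> where n: "n \<ge> m" and A: "A \<in> sets borel" "measure haar_circle A < (1/2) ^ m"
    and \<delta>: "\<delta> < 1 / (real m + 1)"
    and le: "\<And>\<zeta> w. norm \<zeta> = 1 \<Longrightarrow> \<zeta> \<notin> A \<Longrightarrow> w \<in> K m \<Longrightarrow> norm (F f n w \<zeta> - rational_trig t \<zeta>) \<le> \<delta>"
    using assms unfolding approx_set_def by blast
  have "\<forall>\<zeta> w. norm \<zeta> = 1 \<longrightarrow> \<zeta> \<notin> A \<longrightarrow> w \<in> K m \<longrightarrow> norm (F f n w \<zeta> - rational_trig t \<zeta>) \<le> 1 / (real m + 1)"
    using le \<delta> by (meson less_imp_le order.trans)
  then show ?thesis using n A by blast
qed

lemma openin_approx_set:
  assumes cont: "\<And>n m. \<exists>L>0. \<forall>f\<in>ell_a \<phi>. \<forall>g\<in>ell_a \<phi>. \<forall>\<eta> \<zeta> w. norm \<zeta> = 1 \<longrightarrow> w \<in> K m \<longrightarrow>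
      lux_le \<eta> (\<lambda>k. taylor_coeff f k - taylor_coeff g k) \<longrightarrow> norm (F f n w \<zeta> - F g n w \<zeta>) \<le> L * \<eta>"
  shows "openin (ell_a_topology \<phi>) (approx_set F K t m)"
proof (rule openin_ell_a_topologyI)
  show "approx_set F K t m \<subseteq> ell_a \<phi>" by (auto simp: approx_set_def)
  fix f assume "f \<in> approx_set F K t m"
  then obtain n A \<delta> where f: "f \<in> ell_a \<phi>" and n: "n \<ge> m" and A: "A \<in> sets borel" "measure haar_circle A < (1/2) ^ m"
    and \<delta>: "\<delta> < 1 / (real m + 1)"
    and le: "\<And>\<zeta> w. norm \<zeta> = 1 \<Longrightarrow> \<zeta> \<notin> A \<Longrightarrow> w \<in> K m \<Longrightarrow> norm (F f n w \<zeta> - rational_trig t \<zeta>) \<le> \<delta>"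
    unfolding approx_set_def by blast
  obtain L where L: "L > 0" "\<And>f g \<eta> \<zeta> w. f \<in> ell_a \<phi> \<Longrightarrow> g \<in> ell_a \<phi> \<Longrightarrow> norm \<zeta> = 1 \<Longrightarrow> w \<in> K m \<Longrightarrow>
      lux_le \<eta> (\<lambda>k. taylor_coeff f k - taylor_coeff g k) \<Longrightarrow> norm (F f n w \<zeta> - F g n w \<zeta>) \<le> L * \<eta>"
    using cont[of m n] by blast
  define \<eta> where "\<eta> = (1 / (real m + 1) - \<delta>) / (2 * L)"
  have \<eta>1: "\<eta> > 0" unfolding \<eta>_def using \<delta> L(1) by (intro divide_pos_pos) auto
  have "L * \<eta> = (1 / (real m + 1) - \<delta>) / 2" unfolding \<eta>_def using L(1) by simp
  moreover have "x + (b - x) / 2 < b" if "x < b" for x b :: real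
    using that by (simp add: field_simps)
  ultimately have \<eta>: "\<eta> > 0" "\<delta> + L * \<eta> < 1 / (real m + 1)" using \<delta> \<eta>1 by simp_all
  have "g \<in> approx_set F K t m"
    if g: "g \<in> ell_a \<phi>" and l: "lux_le \<eta> (\<lambda>k. taylor_coeff f k - taylor_coeff g k)" for g
  proof -
    have "norm (F g n w \<zeta> - rational_trig t \<zeta>) \<le> \<delta> + L * \<eta>" if z: "norm \<zeta> = 1" "\<zeta> \<notin> A" "w \<in> K m" for \<zeta> w
      using le[OF z] L(2)[OF f g z(1,3) l] norm_triangle_ineq4[of "F f n w \<zeta> - rational_trig t \<zeta>" "F f n w \<zeta> - F g n w \<zeta>"]
      by simp
    then show ?thesis unfolding approx_set_def using g n A \<eta>(2) by blast
  qed
  then show "\<exists>\<eta>>0. \<forall>g\<in>ell_a \<phi>. lux_le \<eta> (\<lambda>k. taylor_coeff f k - taylor_coeff g k) \<longrightarrow> g \<in> approx_set F K t m"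
    using \<eta>(1) by blast
qed

text \<open>To a given polynomial \<open>p\<close> one adds a polynomial \<open>P\<close> of small norm that is close to the
target minus \<open>p\<close> in measure. At a late index, the transform of the polynomial \<open>p + P\<close> is close to
its value on the circle.\<close>

lemma approx_set_poly_dense:
  assumes small: "\<phi> \<in> o[at_right 0](\<lambda>t. t\<^sup>2)"
    and poly: "\<And>p m \<epsilon>. \<epsilon> > 0 \<Longrightarrow> \<exists>n\<ge>m. \<forall>\<zeta> w. norm \<zeta> = 1 \<longrightarrow> w \<in> K m \<longrightarrow> norm (F (poly_fun p) n w \<zeta> - poly p \<zeta>) \<le> \<epsilon>"
  shows "range poly_fun \<subseteq> ell_a_topology \<phi> closure_of (approx_set F K t m \<inter> range poly_fun)"
proof
  fix f assume "f \<in> range poly_fun"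
  then obtain p where f: "f = poly_fun p" by blast
  show "f \<in> ell_a_topology \<phi> closure_of (approx_set F K t m \<inter> range poly_fun)"
  proof (rule in_closure_ell_a_topologyI)
    show "f \<in> ell_a \<phi>" unfolding f by (rule poly_fun_in_ell_a)
    show "approx_set F K t m \<inter> range poly_fun \<subseteq> ell_a \<phi>" by (auto simp: approx_set_def)
    fix \<epsilon> :: real assume \<epsilon>: "\<epsilon> > 0"
    define e where "e = min \<epsilon> (min ((1/2) ^ m) (1 / (4 * (real m + 1))))"
    have e: "e > 0" "e \<le> \<epsilon>" "e \<le> (1/2) ^ m" "e \<le> 1 / (4 * (real m + 1))"
      using \<epsilon> by (auto simp: e_def)
    define M where "M = fst t"
    obtain q where q: "\<And>z. rational_trig t z = poly q z / z ^ M"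
      unfolding rational_trig_def M_def by blast
    obtain P A where P: "lux_le e (coeff P)" and A: "A \<in> sets borel" "measure haar_circle A < e"
      and PA: "\<And>z. norm z = 1 \<Longrightarrow> z \<notin> A \<Longrightarrow> norm (poly P z - poly (q - monom 1 M * p) z / z ^ M) \<le> e"
      using approximate_trig[OF small e(1), of "q - monom 1 M * p" M] by blast
    obtain n where n: "n \<ge> m" "\<And>\<zeta> w. norm \<zeta> = 1 \<Longrightarrow> w \<in> K m \<Longrightarrow> norm (F (poly_fun (p + P)) n w \<zeta> - poly (p + P) \<zeta>) \<le> e"
      using poly[OF e(1), of m "p + P"] by blast
    have "norm (F (poly_fun (p + P)) n w \<zeta> - rational_trig t \<zeta>) \<le> 1 / (2 * (real m + 1))"
      if z: "norm \<zeta> = 1" "\<zeta> \<notin> A" and w: "w \<in> K m" for \<zeta> w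
    proof -
      have "\<zeta> \<noteq> 0" using z by auto
      then have eq: "poly P \<zeta> - poly (q - monom 1 M * p) \<zeta> / \<zeta> ^ M = poly (p + P) \<zeta> - rational_trig t \<zeta>"
        by (simp add: q poly_monom field_simps)
      have "norm (poly (p + P) \<zeta> - rational_trig t \<zeta>) \<le> e" using PA[OF z] unfolding eq .
      then have "norm (F (poly_fun (p + P)) n w \<zeta> - rational_trig t \<zeta>) \<le> 2 * e"
        using n(2)[OF z(1) w] norm_triangle_ineq[of "F (poly_fun (p + P)) n w \<zeta> - poly (p + P) \<zeta>" "poly (p + P) \<zeta> - rational_trig t \<zeta>"]
        by simp
      also have "\<dots> \<le> 1 / (2 * (real m + 1))" using e(4) by (simp add: field_simps)
      finally show ?thesis .
    qed
    moreover have "1 / (2 * (real m + 1)) < 1 / (real m + 1)" by (simp add: field_simps)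
    moreover have "measure haar_circle A < (1/2) ^ m" using A(2) e(3) by linarith
    ultimately have "poly_fun (p + P) \<in> approx_set F K t m"
      unfolding approx_set_def using n(1) A(1) poly_fun_in_ell_a by blast
    moreover have "lux_le \<epsilon> (\<lambda>k. taylor_coeff f k - taylor_coeff (poly_fun (p + P)) k)"
      using lux_le_mono[OF P _ e(2)] by (simp add: f taylor_coeff_poly_fun)
    ultimately show "\<exists>g\<in>approx_set F K t m \<inter> range poly_fun. lux_le \<epsilon> (\<lambda>k. taylor_coeff f k - taylor_coeff g k)"
      by blast
  qed
qed

end

definition radial_value :: "(nat \<Rightarrow> real) \<Rightarrow> (complex \<Rightarrow> complex) \<Rightarrow> nat \<Rightarrow> complex \<Rightarrow> complex \<Rightarrow> complex" where
  "radial_value r f n w \<zeta> = f (of_real (r n) * (\<zeta> - w) + w)"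

definition inner_disc :: "nat \<Rightarrow> complex set" where
  "inner_disc m = {w. norm w \<le> 1 - 1 / (real m + 1)}"

text \<open>The argument of type \<open>unit\<close> stands for the parameter \<open>w\<close>, so that partial sums and radial
values fit the same scheme.\<close>

definition partial_sum :: "(complex \<Rightarrow> complex) \<Rightarrow> nat \<Rightarrow> unit \<Rightarrow> complex \<Rightarrow> complex" where
  "partial_sum f d u \<zeta> = (\<Sum>i = 0..d. taylor_coeff f i * \<zeta> ^ i)"

text \<open>The point is the convex combination of \<open>\<zeta>\<close> and \<open>w\<close> with weights \<open>s\<close> and \<open>1 - s\<close>. As long as
\<open>w\<close> stays in a smaller disc, it stays in a compact subset of the unit disc that depends on \<open>s\<close> and
\<open>m\<close>.\<close>

lemma norm_radial_point:
  assumes "0 < s" "s < 1" "norm \<zeta> = 1" "w \<in> inner_disc m"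
  shows "norm (of_real s * (\<zeta> - w) + w) \<le> 1 - (1 - s) / (real m + 1)"
proof -
  have "of_real s * (\<zeta> - w) + w = of_real s * \<zeta> + of_real (1 - s) * w" by (simp add: algebra_simps)
  then have "norm (of_real s * (\<zeta> - w) + w) \<le> norm (of_real s * \<zeta>) + norm (of_real (1 - s) * w)"
    by (simp only: norm_triangle_ineq)
  also have "\<dots> = s + (1 - s) * norm w" using assms unfolding norm_mult norm_of_real by simp
  also have "\<dots> \<le> s + (1 - s) * (1 - 1 / (real m + 1))"
    using assms by (intro add_left_mono mult_left_mono) (auto simp: inner_disc_def)
  also have "\<dots> = 1 - (1 - s) / (real m + 1)" by (simp add: algebra_simps)
  finally show ?thesis .
qed

lemma norm_radial_point_less:
  assumes "0 < s" "s < 1" "norm \<zeta> = 1" "w \<in> inner_disc m"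
  shows "norm (of_real s * (\<zeta> - w) + w) < 1"
proof -
  have "0 < (1 - s) / (real m + 1)" using assms by simp
  then show ?thesis using norm_radial_point[OF assms] by linarith
qed

lemma (in orlicz) radial_value_continuous:
  assumes r: "\<And>n. r n \<in> {0<..<1}"
  shows "\<exists>L>0. \<forall>f\<in>ell_a \<phi>. \<forall>g\<in>ell_a \<phi>. \<forall>\<eta> \<zeta> w. norm \<zeta> = 1 \<longrightarrow> w \<in> inner_disc m \<longrightarrow>
      lux_le \<eta> (\<lambda>k. taylor_coeff f k - taylor_coeff g k) \<longrightarrow>
      norm (radial_value r f n w \<zeta> - radial_value r g n w \<zeta>) \<le> L * \<eta>"
proof -
  obtain C where C: "C > 0"
    "\<And>f g \<eta> \<rho> z. f \<in> ell_a \<phi> \<Longrightarrow> g \<in> ell_a \<phi> \<Longrightarrow> lux_le \<eta> (\<lambda>k. taylor_coeff f k - taylor_coeff g k) \<Longrightarrow>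
       norm z \<le> \<rho> \<Longrightarrow> \<rho> < 1 \<Longrightarrow> norm (f z - g z) \<le> C / (1 - \<rho>) * \<eta>"
    using pointwise_bound by blast
  define \<rho> where "\<rho> = 1 - (1 - r n) / (real m + 1)"
  have \<rho>: "\<rho> < 1" using r[of n] by (simp add: \<rho>_def)
  show ?thesis
  proof (intro exI[of _ "C / (1 - \<rho>)"] conjI ballI allI impI)
    show "C / (1 - \<rho>) > 0" using C \<rho> by simp
    fix f g \<eta> w and \<zeta> :: complex assume "f \<in> ell_a \<phi>" "g \<in> ell_a \<phi>" "norm \<zeta> = 1" "w \<in> inner_disc m"
      "lux_le \<eta> (\<lambda>k. taylor_coeff f k - taylor_coeff g k)"
    then show "norm (radial_value r f n w \<zeta> - radial_value r g n w \<zeta>) \<le> C / (1 - \<rho>) * \<eta>"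
      unfolding radial_value_def using r[of n] \<rho> norm_radial_point[of "r n" \<zeta> w m]
      by (intro C(2)) (auto simp: \<rho>_def)
  qed
qed

lemma (in orlicz) radial_value_poly:
  assumes r: "\<And>n. r n \<in> {0<..<1}" "r \<longlonglongrightarrow> 1" and \<epsilon>: "\<epsilon> > 0"
  shows "\<exists>n\<ge>m. \<forall>\<zeta> w. norm \<zeta> = 1 \<longrightarrow> w \<in> inner_disc m \<longrightarrow> norm (radial_value r (poly_fun p) n w \<zeta> - poly p \<zeta>) \<le> \<epsilon>"
proof -
  have "uniformly_continuous_on (cball 0 1) (poly p)"
    by (intro compact_uniformly_continuous continuous_on_poly continuous_on_id compact_cball)
  then obtain \<delta> where \<delta>: "\<delta> > 0" "\<And>x y. x \<in> cball 0 1 \<Longrightarrow> y \<in> cball 0 1 \<Longrightarrow> dist y x < \<delta> \<Longrightarrow> dist (poly p y) (poly p x) < \<epsilon>"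
    unfolding uniformly_continuous_on_def using \<epsilon> by metis
  have "\<forall>\<^sub>F n in sequentially. 1 - \<delta> / 2 < r n" using r(2) \<delta>(1) by (intro order_tendstoD) auto
  then have "\<forall>\<^sub>F n in sequentially. m \<le> n \<and> 1 - \<delta> / 2 < r n"
    by (intro eventually_conj eventually_ge_at_top)
  then obtain n where n: "m \<le> n" "1 - \<delta> / 2 < r n"
    using eventually_happens'[OF sequentially_bot] by blast
  have "norm (radial_value r (poly_fun p) n w \<zeta> - poly p \<zeta>) \<le> \<epsilon>" if z: "norm \<zeta> = 1" "w \<in> inner_disc m" for \<zeta> w
  proof -
    let ?z = "of_real (r n) * (\<zeta> - w) + w"
    have zn: "norm ?z < 1" using norm_radial_point_less[OF _ _ z] r(1)[of n] by simp
    have "?z - \<zeta> = of_real (1 - r n) * (w - \<zeta>)" by (simp add: algebra_simps)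
    then have "norm (?z - \<zeta>) = (1 - r n) * norm (w - \<zeta>)"
      using r(1)[of n] by (simp only: norm_mult norm_of_real) simp
    also have "\<dots> \<le> (1 - r n) * 2"
    proof (rule mult_left_mono)
      have "norm w \<le> 1"
        using z(2) by (simp add: inner_disc_def) (smt (verit) divide_nonneg_nonneg of_nat_0_le_iff)
      then show "norm (w - \<zeta>) \<le> 2" using norm_triangle_ineq4[of w \<zeta>] z(1) by simp
    qed (use r(1)[of n] in simp)
    also have "\<dots> < \<delta>" using n(2) by simp
    finally have "dist ?z \<zeta> < \<delta>" by (simp only: dist_norm)
    moreover have "?z \<in> cball 0 1" "\<zeta> \<in> cball 0 1" using zn z(1) by simp_all
    ultimately have "dist (poly p ?z) (poly p \<zeta>) < \<epsilon>" by (intro \<delta>(2))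
    then show ?thesis by (simp add: radial_value_def poly_fun_eq[OF zn] dist_norm)
  qed
  then show ?thesis using n(1) by blast
qed

lemma (in orlicz) partial_sum_continuous:
  "\<exists>L>0. \<forall>f\<in>ell_a \<phi>. \<forall>g\<in>ell_a \<phi>. \<forall>\<eta> (\<zeta>::complex) w. norm \<zeta> = 1 \<longrightarrow> w \<in> UNIV \<longrightarrow>
      lux_le \<eta> (\<lambda>k. taylor_coeff f k - taylor_coeff g k) \<longrightarrow> norm (partial_sum f d w \<zeta> - partial_sum g d w \<zeta>) \<le> L * \<eta>"
proof -
  obtain C where C: "C > 0" "\<And>c a k. lux_le c a \<Longrightarrow> norm (a k) \<le> C * c"
    using lux_le_coeff_bound by blast
  show ?thesis
  proof (intro exI[of _ "(d + 1) * C"] conjI ballI allI impI)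
    show "real (d + 1) * C > 0" using C by simp
    fix f g \<eta> w and \<zeta> :: complex assume z: "norm \<zeta> = 1" and l: "lux_le \<eta> (\<lambda>k. taylor_coeff f k - taylor_coeff g k)"
    have "partial_sum f d w \<zeta> - partial_sum g d w \<zeta> = (\<Sum>i = 0..d. (taylor_coeff f i - taylor_coeff g i) * \<zeta> ^ i)"
      by (simp add: partial_sum_def sum_subtractf left_diff_distrib)
    also have "norm \<dots> \<le> (\<Sum>i = 0..d. norm ((taylor_coeff f i - taylor_coeff g i) * \<zeta> ^ i))"
      by (rule norm_sum)
    also have "\<dots> \<le> (\<Sum>i = 0..d. C * \<eta>)"
      using C(2)[OF l] z by (intro sum_mono) (simp add: norm_mult norm_power)
    finally show "norm (partial_sum f d w \<zeta> - partial_sum g d w \<zeta>) \<le> real (d + 1) * C * \<eta>" by simp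
  qed
qed

lemma (in orlicz) partial_sum_poly:
  assumes "\<epsilon> > 0"
  shows "\<exists>d\<ge>m. \<forall>\<zeta> w. norm \<zeta> = 1 \<longrightarrow> w \<in> UNIV \<longrightarrow> norm (partial_sum (poly_fun p) d w \<zeta> - poly p \<zeta>) \<le> \<epsilon>"
proof (intro exI[of _ "max m (degree p)"] conjI allI impI)
  fix \<zeta> :: complex and w :: unit
  have "partial_sum (poly_fun p) (max m (degree p)) w \<zeta> = poly p \<zeta>"
    unfolding partial_sum_def taylor_coeff_poly_fun poly_altdef
    by (rule sum.mono_neutral_right) (auto simp: coeff_eq_0)
  then show "norm (partial_sum (poly_fun p) (max m (degree p)) w \<zeta> - poly p \<zeta>) \<le> \<epsilon>"
    using assms by simp
qed simp

lemma (in orlicz) universal_radialI: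
  assumes "\<And>t m. f \<in> approx_set (radial_value r) inner_disc t m"
  shows "universal_radial r f"
  unfolding universal_radial_def
proof
  fix \<psi> :: "complex \<Rightarrow> complex" assume \<psi>: "\<psi> \<in> borel_measurable circle_measure"
  have "\<exists>n. strict_mono n \<and> (\<forall>w\<in>ball 0 1. AE \<zeta> in circle_measure. (\<lambda>l. radial_value r f (n l) w \<zeta>) \<longlonglongrightarrow> \<psi> \<zeta>)"
  proof (rule universal_of_approximations[OF _ _ \<psi>])
    show "\<exists>n\<ge>m. \<exists>A\<in>sets borel. measure haar_circle A < (1/2) ^ m \<and> (\<forall>\<zeta> w. norm \<zeta> = 1 \<longrightarrow> \<zeta> \<notin> A \<longrightarrow>
        w \<in> inner_disc m \<longrightarrow> norm (radial_value r f n w \<zeta> - rational_trig t \<zeta>) \<le> 1 / (real m + 1))" for t m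
      using assms[of t m] by (rule approx_setD)
    fix w :: complex assume "w \<in> ball 0 1"
    then have "0 < 1 - norm w" by simp
    moreover have "(\<lambda>m. 1 / (real m + 1)) \<longlonglongrightarrow> 0"
      using LIMSEQ_inverse_real_of_nat by (simp add: inverse_eq_divide add.commute)
    ultimately have "\<forall>\<^sub>F m in sequentially. 1 / (real m + 1) < 1 - norm w" by (intro order_tendstoD)
    then show "\<forall>\<^sub>F m in sequentially. w \<in> inner_disc m"
      by eventually_elim (simp add: inner_disc_def)
  qed
  then show "\<exists>n. strict_mono n \<and> (\<forall>w\<in>ball 0 1. AE \<zeta> in circle_measure. (\<lambda>l. f (of_real (r (n l)) * (\<zeta> - w) + w)) \<longlonglongrightarrow> \<psi> \<zeta>)"
    unfolding radial_value_def .
qed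

lemma (in orlicz) universal_partial_sumsI:
  assumes "\<And>t m. f \<in> approx_set partial_sum (\<lambda>_. UNIV) t m"
  shows "universal_partial_sums f"
  unfolding universal_partial_sums_def
proof
  fix \<psi> :: "complex \<Rightarrow> complex" assume \<psi>: "\<psi> \<in> borel_measurable circle_measure"
  have "\<exists>n. strict_mono n \<and> (\<forall>w\<in>UNIV. AE \<zeta> in circle_measure. (\<lambda>l. partial_sum f (n l) w \<zeta>) \<longlonglongrightarrow> \<psi> \<zeta>)"
  proof (rule universal_of_approximations[OF _ _ \<psi>])
    show "\<exists>n\<ge>m. \<exists>A\<in>sets borel. measure haar_circle A < (1/2) ^ m \<and> (\<forall>\<zeta> w. norm \<zeta> = 1 \<longrightarrow> \<zeta> \<notin> A \<longrightarrow>
        w \<in> UNIV \<longrightarrow> norm (partial_sum f n w \<zeta> - rational_trig t \<zeta>) \<le> 1 / (real m + 1))" for t m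
      using approx_setD[OF assms[of t m]] .
  qed simp
  then show "\<exists>d. strict_mono d \<and> (AE \<zeta> in circle_measure. (\<lambda>n. \<Sum>i = 0..d n. taylor_coeff f i * \<zeta> ^ i) \<longlonglongrightarrow> \<psi> \<zeta>)"
    unfolding partial_sum_def by (elim exE conjE bexE ballE[of _ _ "()"]) (auto intro: exI)
qed

text \<open>The closure of the polynomials is closed in a complete space, so Baire's theorem holds in
it. Density of \<open>U\<close> is only required at polynomials, and by polynomials in \<open>U\<close>.\<close>

lemma (in orlicz) Baire_poly_closure:
  assumes count: "countable \<G>" and ne: "\<G> \<noteq> {}"
    and opn: "\<And>U. U \<in> \<G> \<Longrightarrow> openin (ell_a_topology \<phi>) U"
    and dns: "\<And>U. U \<in> \<G> \<Longrightarrow> range poly_fun \<subseteq> ell_a_topology \<phi> closure_of (U \<inter> range poly_fun)"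
  shows "ell_a_topology \<phi> closure_of range poly_fun \<subseteq>
     ell_a_topology \<phi> closure_of (\<Inter>\<G> \<inter> ell_a_topology \<phi> closure_of range poly_fun)"
proof -
  let ?T = "ell_a_topology \<phi>"
  define Mc where "Mc = ?T closure_of range poly_fun"
  let ?X = "subtopology ?T Mc"
  have top: "topspace ?T = ell_a \<phi>" by (rule topspace_ell_a_topology[OF orlicz_function])
  have Mc: "Mc \<subseteq> topspace ?T" unfolding Mc_def by (rule closure_of_subset_topspace)
  then have topX: "topspace ?X = Mc" by (simp add: topspace_subtopology Int_absorb1)
  have cl: "?X closure_of V = Mc \<inter> ?T closure_of V" if "V \<subseteq> Mc" for V
    using that by (simp add: closure_of_subtopology Int_absorb1)
  have pM: "range poly_fun \<subseteq> Mc"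
    unfolding Mc_def using poly_fun_in_ell_a top by (intro closure_of_subset) auto
  have "?X closure_of \<Inter>((\<lambda>U. Mc \<inter> U) ` \<G>) = topspace ?X"
  proof (rule Baire_category)
    show "completely_metrizable_space ?X \<or> locally_compact_space ?X \<and> regular_space ?X"
      unfolding Mc_def
      by (intro disjI1 completely_metrizable_space_closedin completely_metrizable_ell_a closedin_closure_of)
    show "countable ((\<lambda>U. Mc \<inter> U) ` \<G>)" using count by simp
    fix V assume "V \<in> (\<lambda>U. Mc \<inter> U) ` \<G>"
    then obtain U where U: "U \<in> \<G>" "V = Mc \<inter> U" by blast
    have "Mc \<subseteq> ?T closure_of (U \<inter> range poly_fun)"
      unfolding Mc_def by (rule closure_of_minimal[OF dns[OF U(1)] closedin_closure_of])
    also have "\<dots> \<subseteq> ?T closure_of V" using pM U(2) by (intro closure_of_mono) auto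
    finally have "Mc \<subseteq> ?T closure_of V" .
    moreover have "V \<subseteq> Mc" using U(2) by simp
    ultimately have "?X closure_of V = topspace ?X" unfolding topX by (simp add: cl Int_absorb2)
    moreover have "openin ?X V"
      unfolding U(2) using opn[OF U(1)] by (rule openin_subtopology_Int2)
    ultimately show "openin ?X V \<and> ?X closure_of V = topspace ?X" by simp
  qed
  moreover have "\<Inter>((\<lambda>U. Mc \<inter> U) ` \<G>) = \<Inter>\<G> \<inter> Mc" using ne by auto
  ultimately have "Mc \<inter> ?T closure_of (\<Inter>\<G> \<inter> Mc) = Mc" unfolding topX by (simp add: cl)
  then show ?thesis unfolding Mc_def by blast
qed

theorem theorem1p4:
  fixes \<phi> :: "real \<Rightarrow> real" and r :: "nat \<Rightarrow> real"
  assumes "orlicz_function \<phi>"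
    and "\<phi> \<in> o[at_right 0](\<lambda>t. t\<^sup>2)"
    and "\<And>n. r n \<in> {0<..<1}" and "r \<longlonglongrightarrow> 1"
  shows "(\<exists>f \<in> ell_a \<phi>. universal_radial r f \<and> universal_partial_sums f) \<and>
         (Delta2 \<phi> \<longrightarrow>
            ell_a_topology \<phi> closure_of universal_functions \<phi> r = ell_a \<phi> \<and>
            (\<exists>G \<subseteq> universal_functions \<phi> r.
               gdelta_in (ell_a_topology \<phi>) G \<and> ell_a_topology \<phi> closure_of G = ell_a \<phi>))"
proof -
  interpret orlicz \<phi> by unfold_locales fact
  let ?T = "ell_a_topology \<phi>"
  have top: "topspace ?T = ell_a \<phi>" by (rule topspace_ell_a_topology[OF assms(1)])
  define R where "R t m = approx_set (radial_value r) inner_disc t m" for t m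
  define S where "S t m = approx_set partial_sum (\<lambda>_. UNIV) t m" for t m
  define \<G> where "\<G> = (\<Union>t. range (R t)) \<union> (\<Union>t. range (S t))"
  define Mc where "Mc = ?T closure_of range poly_fun"
  have countable: "countable \<G>" by (simp add: \<G>_def)
  have opn: "openin ?T U" if "U \<in> \<G>" for U
  proof -
    have "openin ?T (R t m)" "openin ?T (S t m)" for t m
      unfolding R_def S_def
      by (intro openin_approx_set radial_value_continuous assms(3) partial_sum_continuous)+
    then show ?thesis using that by (auto simp: \<G>_def)
  qed
  have dns: "range poly_fun \<subseteq> ?T closure_of (U \<inter> range poly_fun)" if U: "U \<in> \<G>" for U
  proof -
    have "range poly_fun \<subseteq> ?T closure_of (R t m \<inter> range poly_fun)"
      "range poly_fun \<subseteq> ?T closure_of (S t m \<inter> range poly_fun)" for t m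
      unfolding R_def S_def
      by (intro approx_set_poly_dense assms(2) radial_value_poly[OF assms(3,4)] partial_sum_poly; assumption)+
    moreover obtain t m where "U = R t m \<or> U = S t m" using U unfolding \<G>_def by blast
    ultimately show ?thesis by blast
  qed
  have R_in: "R t m \<in> \<G>" for t m unfolding \<G>_def by (intro UnI1 UN_I[of t] UNIV_I rangeI)
  have S_in: "S t m \<in> \<G>" for t m unfolding \<G>_def by (intro UnI2 UN_I[of t] UNIV_I rangeI)
  have universal: "\<Inter>\<G> \<subseteq> universal_functions \<phi> r"
  proof
    fix f assume f: "f \<in> \<Inter>\<G>"
    have fR: "f \<in> R t m" for t m by (rule InterD[OF f R_in])
    have fS: "f \<in> S t m" for t m by (rule InterD[OF f S_in])
    have "f \<in> ell_a \<phi>" using fR unfolding R_def approx_set_def by blast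
    moreover have "universal_radial r f" by (rule universal_radialI[OF fR[unfolded R_def]])
    moreover have "universal_partial_sums f"
      by (rule universal_partial_sumsI[OF fS[unfolded S_def]])
    ultimately show "f \<in> universal_functions \<phi> r" by (simp add: universal_functions_def)
  qed
  have ne: "\<G> \<noteq> {}" using R_in by blast
  have Baire: "Mc \<subseteq> ?T closure_of (\<Inter>\<G> \<inter> Mc)"
    unfolding Mc_def by (rule Baire_poly_closure[OF countable ne opn dns])
  show ?thesis
  proof (intro conjI impI)
    have "poly_fun 0 \<in> Mc"
      unfolding Mc_def
        using closure_of_subset[of "range poly_fun" ?T] poly_fun_in_ell_a top by blast
    then have "\<Inter>\<G> \<inter> Mc \<noteq> {}" using Baire by auto
    then show "\<exists>f \<in> ell_a \<phi>. universal_radial r f \<and> universal_partial_sums f"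
      using universal unfolding universal_functions_def by blast
  next
    assume "Delta2 \<phi>"
    then have "Mc = ell_a \<phi>" unfolding Mc_def by (rule Delta2_poly_dense)
    then have "ell_a \<phi> \<subseteq> ?T closure_of (\<Inter>\<G>)"
      using Baire closure_of_mono[of "\<Inter>\<G> \<inter> Mc" "\<Inter>\<G>" ?T] by auto
    then have G: "?T closure_of V = ell_a \<phi>" if "\<Inter>\<G> \<subseteq> V" for V
      using closure_of_mono[OF that, of ?T] closure_of_subset_topspace[of ?T V] top by auto
    show "?T closure_of universal_functions \<phi> r = ell_a \<phi>" by (rule G[OF universal])
    have "gdelta_in ?T (\<Inter>\<G>)"
      using countable ne opn by (intro gdelta_in_Inter open_imp_gdelta_in)
    then show "\<exists>G \<subseteq> universal_functions \<phi> r. gdelta_in ?T G \<and> ?T closure_of G = ell_a \<phi>"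
      using G[OF subset_refl] universal by blast
  qed
qed

end
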